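(* Let $p$ be a prime with $p\neq 2,11$. Then $$\sum_{k=0}^{p-1}\binom{2k}k\frac{W_k}{(-44)^k}\equiv\begin{cases} x^2-2p\pmod p&\text{if } \left(\frac p{11}\right)=1 \text{ and so } 4p=x^2+11y^2 \text{ with } x,y\in\mathbb Z,\\ 0\pmod p&\text{if } \left(\frac p{11}\right)=-1.\end{cases}$$
   Context: For each nonnegative integer $n$, $W_n=\sum_{k=0}^{[n/3]}\binom{2k}k\binom{3k}k\binom n{3k}(-3)^{n-3k}$, where $[x]$ is the greatest integer not exceeding $x$. $\left(\frac p{11}\right)$ denotes the Legendre symbol. Congruences modulo $p$ between rational numbers are taken in the ring of rational numbers whose denominator is not divisible by $p$. *)

theory Defs
  imports "HOL-Number_Theory.Number_Theory"
begin

definition W :: "nat \<Rightarrow> int" where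
  "W n = (\<Sum>k = 0..n div 3.
     int ((2 * k) choose k) * int ((3 * k) choose k) * int (n choose (3 * k)) * (- 3) ^ (n - 3 * k))"

(* quotient_of r is the reduced fraction (numerator, denominator) of r. *)
definition p_integral :: "nat \<Rightarrow> rat set" where
  "p_integral p = {r. \<not> int p dvd snd (quotient_of r)}"

(* Congruence modulo the ideal generated by p in the ring p_integral p.  Both sides must
   lie in that ring, so p-integrality is part of any congruence that is asserted. *)
definition rat_cong :: "nat \<Rightarrow> rat \<Rightarrow> rat \<Rightarrow> bool" where
  "rat_cong p a b \<longleftrightarrow>
     a \<in> p_integral p \<and> b \<in> p_integral p \<and> (\<exists>c \<in> p_integral p. a - b = of_nat p * c)"

end

theory Submission
  imports "HOL-Algebra.Algebraic_Closure_Type" "HOL-Computational_Algebra.Formal_Power_Series"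
    "Berlekamp_Zassenhaus.Finite_Field" Defs
begin

text \<open>Let \<open>h\<close> be the Hasse invariant of the curve \<open>y\<^sup>2 = x\<^sup>3 - 264 x + 1694\<close>, the coefficient of
  \<open>x\<close> to the power \<open>p - 1\<close> in \<open>(x\<^sup>3 - 264 x + 1694)\<close> to the power \<open>(p - 1) / 2\<close>. Modulo \<open>p\<close> it is a
  value of a polynomial that satisfies a second order differential equation; the symmetric
  square of that equation also annihilates the hypergeometric polynomial to which the sum
  reduces, so the sum is congruent to \<open>h\<^sup>2\<close>.

  The curve has complex multiplication by \<open>w\<close> with \<open>w\<^sup>2 = w - 3\<close>, and the parallelogram law makes
  \<open>m\<^sup>2 + m n + 3 n\<^sup>2\<close> the degree of \<open>m + n w\<close>. If \<open>4 p = x\<^sup>2 + 11 y\<^sup>2\<close>, then an element of norm \<open>p\<close>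
  and trace \<open>x\<close> is inseparable, hence plus or minus the Frobenius endomorphism; counting points by
  the degree of \<open>1\<close> minus Frobenius gives \<open>h \<equiv> \<plusminus>x\<close>. If \<open>p\<close> is inert, then \<open>w\<close> is not fixed by
  the \<open>p\<close>-th power map, and comparing coefficients of the invariant differential at a fixed point
  of the isogeny \<open>w\<close> gives \<open>h w\<^sup>p = w h\<close>, so \<open>h = 0\<close>. The case \<open>p = 3\<close> is checked directly.\<close>

section \<open>The group law\<close>

text \<open>Endomorphisms are never treated as maps and never composed. They are points of
  \<open>c * y^2 = x^3 + a * x + b\<close> over the rational functions in \<open>x\<close>, with
  \<open>c\<close> the cubic itself; the chord law then adds endomorphisms, and the function field
  of the curve is avoided. In place of the ring structure stand two things: the degree form on the
  lattice of \<open>m + n w\<close>, fixed by the degrees of \<open>1\<close>, \<open>w\<close> and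
  \<open>1 + w\<close>, and the factor by which the invariant differential is multiplied, which is
  additive. The price is a group law over a field that is not algebraically closed.

  The curve has \<open>j = -32768\<close>, the value attached to discriminant -11, and the sum
  reaches it through \<open>27 / 512 = -1728 / j\<close>, the argument of the hypergeometric
  polynomial. The model is singular modulo 2, 3 and 11, hence the separate treatment of 3. Modulo 7
  the coefficient 1694 vanishes, \<open>j\<close> becomes 1728 and there are further automorphisms,
  so the identification with plus or minus Frobenius breaks down; but 28 is not of the form
  \<open>x^2 + 11 y^2\<close>, so the ordinary case never meets 7.\<close>

datatype 'a point = Infty | Aff 'a 'a

fun on_curve :: "'a::field \<Rightarrow> 'a \<Rightarrow> 'a \<Rightarrow> 'a point \<Rightarrow> bool" where
  "on_curve c a b Infty = True"
| "on_curve c a b (Aff x y) = (c * y^2 = x^3 + a * x + b)"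

fun pneg :: "'a::field point \<Rightarrow> 'a point" where
  "pneg Infty = Infty"
| "pneg (Aff x y) = Aff x (- y)"

text \<open>\<open>padd\<close> sends opposite points to \<open>Infty\<close> first, so for points
  of the curve the tangent branch is reached only by equal points, and \<open>y1\<close> alone may
  enter it.\<close>

definition slope :: "'a::field \<Rightarrow> 'a \<Rightarrow> 'a \<Rightarrow> 'a \<Rightarrow> 'a \<Rightarrow> 'a \<Rightarrow> 'a" where
  "slope c a x1 y1 x2 y2 =
     (if x1 = x2 then (3 * x1^2 + a) / (2 * c * y1) else (y2 - y1) / (x2 - x1))"

fun padd :: "'a::field \<Rightarrow> 'a \<Rightarrow> 'a point \<Rightarrow> 'a point \<Rightarrow> 'a point" where
  "padd c a Infty Q = Q"
| "padd c a P Infty = P"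
| "padd c a (Aff x1 y1) (Aff x2 y2) =
     (if x1 = x2 \<and> y1 = - y2 then Infty
      else let l = slope c a x1 y1 x2 y2; x3 = c * l^2 - x1 - x2
           in Aff x3 (l * (x1 - x3) - y1))"

lemma padd_Infty_right [simp]: "padd c a P Infty = P"
  by (cases P) auto

lemma on_curve_pneg [simp]: "on_curve c a b (pneg P) = on_curve c a b P"
  by (cases P) auto

lemma padd_pneg [simp]: "padd c a P (pneg P) = Infty" "padd c a (pneg P) P = Infty"
  by (cases P; auto)+

lemma same_x:
  fixes c :: "'a::field"
  assumes "c \<noteq> 0" "c * y1^2 = x^3 + a * x + b" "c * y2^2 = x^3 + a * x + b"
  shows "y1 = y2 \<or> y1 = - y2"
proof -
  have "y1^2 = y2^2" using assms by (metis mult_left_cancel)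
  then show ?thesis by (simp add: power2_eq_iff)
qed

context
  fixes c a b :: "'a::field"
  assumes c0: "c \<noteq> 0" and two: "(2::'a) \<noteq> 0"
begin

lemma padd_commute:
  assumes "on_curve c a b P" "on_curve c a b Q"
  shows "padd c a P Q = padd c a Q P"
proof (cases P; cases Q)
  fix x1 y1 x2 y2 assume PQ: "P = Aff x1 y1" "Q = Aff x2 y2"
  show ?thesis
  proof (cases "x1 = x2")
    case True
    then show ?thesis using assms PQ same_x[OF c0, of y1 x1 a b y2] by (auto simp: slope_def Let_def)
  next
    case False
    define l where "l = (y2 - y1) / (x2 - x1)"
    have l': "(y1 - y2) / (x1 - x2) = l"
      unfolding l_def by (metis minus_diff_eq minus_divide_divide)
    have "y2 - y1 = l * (x2 - x1)" using False by (simp add: l_def)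
    then have 1: "l * (x1 - t) - y1 = l * (x2 - t) - y2" for t
      by (simp add: algebra_simps)
    have 2: "c * l^2 - x2 - x1 = c * l^2 - x1 - x2" by simp
    have "slope c a x1 y1 x2 y2 = l" "slope c a x2 y2 x1 y1 = l"
      using False l' by (auto simp: slope_def l_def)
    then show ?thesis using False PQ unfolding PQ padd.simps Let_def by (simp only: 1 2 if_False simp_thms) auto
  qed
qed auto

text \<open>Vieta's formulas for the cubic in \<open>t\<close> obtained by substituting the chord or
  tangent; its third root is the abscissa of the sum. In the tangent case the linear coefficient,
  stated last, carries the information that \<open>x1\<close> is a double root.\<close>

lemma slope_line:
  assumes P: "c * y1^2 = x1^3 + a * x1 + b" and Q: "c * y2^2 = x2^3 + a * x2 + b"
    and ne: "\<not> (x1 = x2 \<and> y1 = - y2)"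
  defines "l \<equiv> slope c a x1 y1 x2 y2"
  defines "k \<equiv> y1 - l * x1"
  shows "y2 = l * x2 + k"
    and "t^3 + a * t + b - c * (l * t + k)^2 = (t - x1) * (t - x2) * (t - (c * l^2 - x1 - x2))"
    and "x1 = x2 \<Longrightarrow> 2 * c * y1 * l = 3 * x1^2 + a"
    and "a - 2 * c * l * k = x1 * x2 + (x1 + x2) * (c * l^2 - x1 - x2)"
proof -
  show 1: "x1 = x2 \<Longrightarrow> 2 * c * y1 * l = 3 * x1^2 + a"
  proof -
    assume x: "x1 = x2"
    then have y: "y1 = y2" using same_x[OF c0, of y1 x1 a b y2] P Q ne by auto
    have "y1 \<noteq> 0" using ne x y by auto
    then show ?thesis using x c0 two by (simp add: l_def slope_def)
  qed
  have 2: "x1 \<noteq> x2 \<Longrightarrow> l * (x2 - x1) = y2 - y1" by (simp add: l_def slope_def)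
  show y2: "y2 = l * x2 + k"
  proof (cases "x1 = x2")
    case True
    then show ?thesis using same_x[OF c0, of y1 x1 a b y2] P Q ne by (auto simp: k_def)
  next
    case False
    then show ?thesis using 2 by (simp add: k_def algebra_simps)
  qed
  have k: "y1 = l * x1 + k" by (simp add: k_def)
  show e1: "a - 2 * c * l * k = x1 * x2 + (x1 + x2) * (c * l^2 - x1 - x2)"
  proof (cases "x1 = x2")
    case True
    have a: "a = 2 * c * (l * x1 + k) * l - 3 * x1^2" using 1[OF True] k by simp
    show ?thesis unfolding a True[symmetric] by Groebner_Basis.algebra
  next
    case False
    have "(x2 - x1) * (a - 2 * c * l * k) = (x2 - x1) * (x1 * x2 + (x1 + x2) * (c * l^2 - x1 - x2))"
      using P Q k y2 by Groebner_Basis.algebra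
    then show ?thesis using False by simp
  qed
  show "t^3 + a * t + b - c * (l * t + k)^2 = (t - x1) * (t - x2) * (t - (c * l^2 - x1 - x2))"
    using P k e1 by Groebner_Basis.algebra
qed

lemma padd_Aff:
  assumes "\<not> (x1 = x2 \<and> y1 = - y2)"
  defines "l \<equiv> slope c a x1 y1 x2 y2"
  shows "padd c a (Aff x1 y1) (Aff x2 y2) =
    Aff (c * l^2 - x1 - x2) (- (l * (c * l^2 - x1 - x2) + (y1 - l * x1)))"
  using assms by (auto simp: Let_def algebra_simps)

lemma on_curve_padd:
  assumes "on_curve c a b P" "on_curve c a b Q"
  shows "on_curve c a b (padd c a P Q)"
proof (cases P; cases Q)
  fix x1 y1 x2 y2 assume PQ: "P = Aff x1 y1" "Q = Aff x2 y2"
  show ?thesis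
  proof (cases "x1 = x2 \<and> y1 = - y2")
    case False
    define l where "l = slope c a x1 y1 x2 y2"
    define x3 where "x3 = c * l^2 - x1 - x2"
    have "x3^3 + a * x3 + b - c * (l * x3 + (y1 - l * x1))^2 = 0"
      using slope_line(2)[of y1 x1 y2 x2 x3] assms PQ False by (simp add: l_def x3_def)
    then show ?thesis unfolding PQ padd_Aff[OF False] l_def[symmetric] x3_def[symmetric]
        on_curve.simps power2_minus by simp
  qed (use PQ in auto)
qed (use assms in auto)

text \<open>The parabola \<open>l * x + k + e * (x - x1) * (x - x2)\<close> passes through all three
  points and meets the curve in a fourth one, whose reflection is the sum of the three. The right
  side depends only on the parabola and on \<open>x1 + x2 + x3\<close>, which do not single out a
  pair; this is what makes associativity visible.\<close>

lemma padd_third: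
  assumes P: "c * y1^2 = x1^3 + a * x1 + b" and Q: "c * y2^2 = x2^3 + a * x2 + b"
    and ne: "\<not> (x1 = x2 \<and> y1 = - y2)" and y3: "c * y3^2 = x3^3 + a * x3 + b"
    and e: "y3 = l * x3 + k + e * (x3 - x1) * (x3 - x2)"
    and l: "l = slope c a x1 y1 x2 y2" and k: "k = y1 - l * x1"
    and x4: "x4 = c * l^2 - x1 - x2" and ne': "x3 \<noteq> x4"
    and e': "c * e * (y3 + l * x3 + k) = x3 - x4"
  shows "padd c a (padd c a (Aff x1 y1) (Aff x2 y2)) (Aff x3 y3) =
    (let c1 = l - e * (x1 + x2); c0 = k + e * x1 * x2;
         x5 = 1 / (c * e^2) - 2 * c1 / e - (x1 + x2 + x3)
     in Aff x5 (- (c0 + c1 * x5 + e * x5^2)))"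
proof -
  have e0: "e \<noteq> 0" using e' ne' by auto
  define y4 where "y4 = - (l * x4 + k)"
  have 4: "padd c a (Aff x1 y1) (Aff x2 y2) = Aff x4 y4"
    using padd_Aff[OF ne] by (simp add: y4_def x4 k l)
  \<comment> \<open>Slope of the chord from \<open>(x4, y4)\<close> to the third point:
    \<open>y3 - y4\<close> is \<open>(y3 + l * x3 + k) - l * (x3 - x4)\<close>, and
    \<open>e'\<close> turns the bracket into \<open>(x3 - x4) / (c * e)\<close>.\<close>
  define m where "m = 1 / (c * e) - l"
  have mm: "c * e * (m + l) = 1" using c0 e0 by (simp add: m_def)
  have "(y3 - y4) * (c * e) = m * (x3 - x4) * (c * e)"
  proof -
    have "(y3 - y4) * (c * e) - m * (x3 - x4) * (c * e) =
      (c * e * (y3 + l * x3 + k) - (x3 - x4)) - (x3 - x4) * (c * e * (m + l) - 1)"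
      unfolding y4_def by Groebner_Basis.algebra
    then show ?thesis using e' mm by simp
  qed
  then have m1: "y3 - y4 = m * (x3 - x4)" using c0 e0 by simp
  have m2: "slope c a x4 y4 x3 y3 = m"
    using m1 ne' by (simp add: slope_def)
  define c1 where "c1 = l - e * (x1 + x2)"
  define c0' where "c0' = k + e * x1 * x2"
  define x5 where "x5 = 1 / (c * e^2) - 2 * c1 / e - (x1 + x2 + x3)"
  have x5e: "c * e^2 * (x5 + x1 + x2 + x3) = 1 - 2 * c * e * c1"
    using c0 e0 by (simp add: x5_def field_simps power2_eq_square)
  have "c * e^2 * (c * m^2 - x4 - x3) = c * e^2 * x5"
    using x5e mm unfolding c1_def x4 by Groebner_Basis.algebra
  then have x5: "c * m^2 - x4 - x3 = x5" using c0 e0 by simp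
  have "c * e * (m * x5 + (y4 - m * x4)) = c * e * (c0' + c1 * x5 + e * x5^2)"
  proof -
    have y4': "y4 = y3 - m * (x3 - x4)" using m1 by Groebner_Basis.algebra
    have "c * e * (m - l) = 1 - 2 * c * e * l" using mm by Groebner_Basis.algebra
    have *: "c * e * (e * (x5 + x3 - x1 - x2) + l - m) = 0"
      using x5e mm unfolding c1_def by Groebner_Basis.algebra
    then have **: "e * (x5 + x3 - x1 - x2) + l = m" using c0 e0 by simp
    show ?thesis unfolding y4' e c0'_def c1_def **[symmetric] by Groebner_Basis.algebra
  qed
  then have y5: "m * x5 + (y4 - m * x4) = c0' + c1 * x5 + e * x5^2" using c0 e0 by simp
  have "padd c a (Aff x4 y4) (Aff x3 y3) = Aff x5 (- (m * x5 + (y4 - m * x4)))"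
    using padd_Aff[of x4 x3 y4 y3] ne' by (simp add: m2 x5)
  then show ?thesis unfolding 4 y5 by (simp add: Let_def c1_def c0'_def x5_def)
qed

end

section \<open>Associativity in general position\<close>

context
  fixes c a b :: "'a::field"
  assumes c0: "c \<noteq> 0" and two: "(2::'a) \<noteq> 0"
begin

text \<open>\<open>padd_third\<close> is applied to either pair, the second bracketing being
  commuted first. Both times the parabola is the same, with leading coefficient \<open>e\<close>, so
  the results agree. \<open>n1\<close> and \<open>n2\<close> keep the second addition of each
  bracketing on a chord between distinct abscissas.\<close>

lemma padd_assoc_generic:
  assumes P: "c * y1^2 = x1^3 + a * x1 + b" and Q: "c * y2^2 = x2^3 + a * x2 + b"
    and S: "c * y3^2 = x3^3 + a * x3 + b"
    and ne: "\<not> (x1 = x2 \<and> y1 = - y2)" and x3: "x3 \<noteq> x1" "x3 \<noteq> x2"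
    and n1: "\<And>y. padd c a (Aff x1 y1) (Aff x2 y2) \<noteq> Aff x3 y"
    and n2: "\<And>y. padd c a (Aff x2 y2) (Aff x3 y3) \<noteq> Aff x1 y"
  shows "padd c a (padd c a (Aff x1 y1) (Aff x2 y2)) (Aff x3 y3) =
    padd c a (Aff x1 y1) (padd c a (Aff x2 y2) (Aff x3 y3))"
proof -
  define l where "l = slope c a x1 y1 x2 y2"
  define k where "k = y1 - l * x1"
  define x4 where "x4 = c * l^2 - x1 - x2"
  note line = slope_line[OF c0 two P Q ne, folded l_def, folded k_def]
  have x34: "x3 \<noteq> x4" using n1 padd_Aff[OF c0 two ne, of a] by (auto simp: x4_def l_def)
  define e where "e = (y3 - (l * x3 + k)) / ((x3 - x1) * (x3 - x2))"
  have e: "y3 = l * x3 + k + e * (x3 - x1) * (x3 - x2)"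
    using x3 by (simp add: e_def)
  have "c * (y3^2 - (l * x3 + k)^2) = (x3 - x1) * (x3 - x2) * (x3 - x4)"
    using line(2)[of x3] S by (simp add: x4_def right_diff_distrib)
  moreover have "c * (y3^2 - (l * x3 + k)^2) = (x3 - x1) * (x3 - x2) * (c * e * (y3 + l * x3 + k))"
  proof -
    have *: "y3 - (l * x3 + k) = e * (x3 - x1) * (x3 - x2)" using e by simp
    have "c * (y3^2 - (l * x3 + k)^2) = c * (y3 - (l * x3 + k)) * (y3 + l * x3 + k)"
      by Groebner_Basis.algebra
    then show ?thesis unfolding * by (simp add: mult_ac)
  qed
  ultimately have e': "c * e * (y3 + l * x3 + k) = x3 - x4" using x3 by simp
  have ne2: "\<not> (x2 = x3 \<and> y2 = - y3)" using x3 by auto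
  define l' where "l' = slope c a x2 y2 x3 y3"
  define k' where "k' = y2 - l' * x2"
  define x4' where "x4' = c * l'^2 - x2 - x3"
  have x14: "x1 \<noteq> x4'" using n2 padd_Aff[OF c0 two ne2, of a] by (auto simp: x4'_def l'_def)
  have y1: "y1 = l * x1 + k" by (simp add: k_def)
  have y2: "y2 = l * x2 + k" by (rule line(1))
  have "l' * (x3 - x2) = (l + e * (x3 - x1)) * (x3 - x2)"
  proof -
    have "l' * (x3 - x2) = y3 - y2" using x3 by (simp add: l'_def slope_def)
    also have "\<dots> = (l + e * (x3 - x1)) * (x3 - x2)" unfolding e y2 by Groebner_Basis.algebra
    finally show ?thesis .
  qed
  then have l': "l' = l + e * (x3 - x1)" using x3 by simp
  have h2: "y1 = l' * x1 + k' + e * (x1 - x2) * (x1 - x3)"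
    unfolding k'_def l' y2 y1 by Groebner_Basis.algebra
  have h1: "c * e * (y1 + l' * x1 + k') = x1 - x4'"
  proof -
    have "c * e * (y1 + l' * x1 + k') - (x1 - x4') - (c * e * (y3 + l * x3 + k) - (x3 - x4)) = 0"
      unfolding k'_def x4'_def x4_def l' y2 y1 e by Groebner_Basis.algebra
    then show ?thesis using e' by simp
  qed
  have on: "on_curve c a b (padd c a (Aff x2 y2) (Aff x3 y3))"
    by (intro on_curve_padd[OF c0 two]) (use Q S in auto)
  have "padd c a (Aff x1 y1) (padd c a (Aff x2 y2) (Aff x3 y3)) =
      padd c a (padd c a (Aff x2 y2) (Aff x3 y3)) (Aff x1 y1)"
    by (rule padd_commute[OF c0 two _ on]) (use P in auto)
  also have "\<dots> = (let c1 = l' - e * (x2 + x3); c0 = k' + e * x2 * x3;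
         x5 = 1 / (c * e^2) - 2 * c1 / e - (x2 + x3 + x1)
     in Aff x5 (- (c0 + c1 * x5 + e * x5^2)))"
    by (rule padd_third[OF c0 two Q S ne2 P h2 l'_def k'_def x4'_def x14 h1])
  also have "l' - e * (x2 + x3) = l - e * (x1 + x2)" unfolding l' by Groebner_Basis.algebra
  also have "k' + e * x2 * x3 = k + e * x1 * x2" unfolding k'_def y2 l' by Groebner_Basis.algebra
  also have "x2 + x3 + x1 = x1 + x2 + x3" by simp
  finally show ?thesis
    using padd_third[OF c0 two P Q ne S e l_def k_def x4_def x34 e'] by simp
qed

context
  assumes disc: "4 * a^3 + 27 * b^2 \<noteq> 0"
begin

lemma no_double_root: "x^3 + a * x + b = 0 \<Longrightarrow> 3 * x^2 + a \<noteq> 0"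
proof
  assume 1: "x^3 + a * x + b = 0" and 2: "3 * x^2 + a = 0"
  have A: "a = - 3 * x^2" using 2 by (simp add: add_eq_0_iff2)
  have "x^3 + a * x + b = b - 2 * x^3" unfolding A by Groebner_Basis.algebra
  then have B: "b = 2 * x^3" using 1 by simp
  have "4 * a^3 + 27 * b^2 = 0" unfolding A B by Groebner_Basis.algebra
  then show False using disc by simp
qed

lemma padd_cancel_generic:
  assumes P: "c * y1^2 = x1^3 + a * x1 + b" and S: "c * y3^2 = x3^3 + a * x3 + b"
    and ne: "x1 \<noteq> x3"
  shows "padd c a (padd c a (Aff x1 y1) (Aff x3 y3)) (Aff x3 (- y3)) = Aff x1 y1"
proof -
  have ne': "\<not> (x1 = x3 \<and> y1 = - y3)" using ne by auto
  define l where "l = slope c a x1 y1 x3 y3"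
  define k where "k = y1 - l * x1"
  define x4 where "x4 = c * l^2 - x1 - x3"
  define y4 where "y4 = - (l * x4 + k)"
  note line = slope_line[OF c0 two P S ne', folded l_def, folded k_def]
  have 4: "padd c a (Aff x1 y1) (Aff x3 y3) = Aff x4 y4"
    using padd_Aff[OF c0 two ne', of a] by (simp add: y4_def x4_def k_def l_def)
  \<comment> \<open>If \<open>x4 = x3\<close>, the chord is tangent at the third point, so
    subtracting that point again is a doubling; its slope is read off from
    \<open>tang\<close>.\<close>
  have tang: "3 * x3^2 + a = 2 * c * l * y3" if "x4 = x3"
  proof -
    have cl: "c * l^2 = x1 + 2 * x3" using that by (simp add: x4_def algebra_simps)
    have "3 * x3^2 + a - 2 * c * l * (l * x3 + k) =
      3 * x3^2 + (a - 2 * c * l * k) - 2 * (c * l^2) * x3" by Groebner_Basis.algebra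
    also have "\<dots> = 0" unfolding line(4) unfolding cl by Groebner_Basis.algebra
    finally show ?thesis using line(1) by simp
  qed
  have y3: "y3 \<noteq> 0" if "x4 = x3"
    using no_double_root[of x3] tang[OF that] S by auto
  have opp: "\<not> (x4 = x3 \<and> y4 = - (- y3))"
  proof
    assume h: "x4 = x3 \<and> y4 = - (- y3)"
    then have "y3 = - (l * x3 + k)" by (auto simp: y4_def)
    then have "y3 = - y3" by (simp only: line(1)[symmetric])
    then have "2 * y3 = 0" by (metis add.right_inverse mult_2)
    then have "y3 = 0" using two by (metis mult_eq_0_iff)
    then show False using y3 h by blast
  qed
  have sl: "slope c a x4 y4 x3 (- y3) = - l"
  proof (cases "x4 = x3")
    case True
    have y4: "y4 = - y3" using line(1) True by (simp add: y4_def)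
    have "(3 * x3^2 + a) / (2 * c * (- y3)) = - l"
      using y3[OF True] tang[OF True] c0 two by (simp add: field_simps)
    then show ?thesis by (simp add: slope_def True y4)
  next
    case False
    have "- y3 - y4 = - l * (x3 - x4)" unfolding y4_def line(1) by Groebner_Basis.algebra
    then show ?thesis using False by (simp add: slope_def)
  qed
  have x: "c * l^2 - x4 - x3 = x1" by (simp add: x4_def)
  show ?thesis unfolding 4 using padd_Aff[OF c0 two opp, of a]
    by (simp add: sl x) (simp add: y4_def k_def algebra_simps)
qed

lemma finite_same_x:
  assumes "finite F"
  shows "finite {S. on_curve c a b S \<and> (\<exists>x\<in>F. \<exists>y. S = Aff x y)}"
proof -
  have "finite {y. c * y^2 = x^3 + a * x + b}" for x
  proof (cases "\<exists>y. c * y^2 = x^3 + a * x + b")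
    case True
    then obtain y0 where "c * y0^2 = x^3 + a * x + b" by auto
    then have "{y. c * y^2 = x^3 + a * x + b} \<subseteq> {y0, - y0}" using same_x[OF c0] by blast
    then show ?thesis by (rule finite_subset) auto
  qed auto
  then have "finite (\<Union>x\<in>F. Aff x ` {y. c * y^2 = x^3 + a * x + b})"
    using assms by auto
  then show ?thesis by (rule finite_subset[rotated]) auto
qed

text \<open>Associativity is not yet available, but \<open>padd_cancel_generic\<close> already
  inverts the translation by \<open>R\<close> outside the points above its abscissa, which bounds
  the preimage.\<close>

lemma finite_translate:
  assumes R: "on_curve c a b R" and F: "finite F"
  shows "finite {S. on_curve c a b S \<and> padd c a R S \<in> F}"
proof (cases R)
  case Infty
  then show ?thesis using F by (auto intro: finite_subset[of _ F])
next
  case (Aff xr yr)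
  have "S \<in> insert Infty ({S. on_curve c a b S \<and> (\<exists>x\<in>{xr}. \<exists>y. S = Aff x y)} \<union>
     (\<lambda>U. padd c a U (pneg R)) ` F)" if S: "on_curve c a b S" "padd c a R S \<in> F" for S
  proof (cases S)
    case (Aff x y)
    show ?thesis
    proof (cases "x = xr")
      case True
      then show ?thesis using S Aff by auto
    next
      case False
      have "padd c a (padd c a S R) (pneg R) = S"
        using padd_cancel_generic[of y x yr xr] S R Aff \<open>R = Aff xr yr\<close> False by simp
      moreover have "padd c a S R = padd c a R S"
        by (rule padd_commute[OF c0 two]) (use S R in auto)
      ultimately show ?thesis using S(2) by (intro insertI2 UnI2) (auto intro!: image_eqI)
    qed
  qed auto
  then show ?thesis
    by (intro finite_subset[of "{S. on_curve c a b S \<and> padd c a R S \<in> F}"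
      "insert Infty ({S. on_curve c a b S \<and> (\<exists>x\<in>{xr}. \<exists>y. S = Aff x y)} \<union>
     (\<lambda>U. padd c a U (pneg R)) ` F)"] finite.insertI finite_UnI finite_same_x finite_imageI F) auto
qed

text \<open>For fixed \<open>P\<close> and \<open>Q\<close>, each side condition of
  \<open>padd_assoc_generic\<close> excludes finitely many \<open>S\<close>: those above three
  abscissas, and the preimage under translation by \<open>Q\<close> of the points above
  \<open>x1\<close>. If \<open>Q\<close> is opposite to \<open>P\<close>, cancellation replaces the
  generic formula.\<close>

lemma finite_not_assoc:
  assumes P: "on_curve c a b P" and Q: "on_curve c a b Q"
  shows "finite {S. on_curve c a b S \<and> padd c a (padd c a P Q) S \<noteq> padd c a P (padd c a Q S)}"
    (is "finite ?A")
proof (cases P)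
  case Infty
  then show ?thesis by simp
next
  case PA: (Aff x1 y1)
  show ?thesis
  proof (cases Q)
    case Infty
    then show ?thesis by simp
  next
    case QA: (Aff x2 y2)
    show ?thesis
    proof (cases "x1 = x2 \<and> y1 = - y2")
      case True
      have "?A \<subseteq> {S. on_curve c a b S \<and> (\<exists>x\<in>{x2}. \<exists>y. S = Aff x y)}"
      proof safe
        fix S assume S: "on_curve c a b S" and n: "padd c a (padd c a P Q) S \<noteq> padd c a P (padd c a Q S)"
        show "\<exists>x\<in>{x2}. \<exists>y. S = Aff x y"
        proof (cases S)
          case Infty
          then show ?thesis using n by simp
        next
          case (Aff x y)
          have "x = x2"
          proof (rule ccontr)
            assume x: "x \<noteq> x2"
            have "padd c a P (padd c a Q S) = padd c a (padd c a Q S) P"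
              by (intro padd_commute[OF c0 two] on_curve_padd[OF c0 two]) (use P Q S in auto)
            also have "\<dots> = padd c a (padd c a S Q) P"
              by (simp only: padd_commute[OF c0 two Q S])
            also have "\<dots> = S"
              using padd_cancel_generic[of y x y2 x2] x True PA QA Q S Aff by simp
            also have "S = padd c a (padd c a P Q) S" using PA QA True by simp
            finally show False using n by simp
          qed
          then show ?thesis using Aff by auto
        qed
      qed
      then show ?thesis by (rule finite_subset) (rule finite_same_x, simp)
    next
      case False
      obtain x4 y4 where 4: "padd c a P Q = Aff x4 y4" using padd_Aff[OF c0 two False, of a] PA QA by auto
      let ?B = "{S. on_curve c a b S \<and> (\<exists>x\<in>{x1,x2,x4}. \<exists>y. S = Aff x y)}"
      let ?C = "{S. on_curve c a b S \<and> padd c a Q S \<in>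
         {S. on_curve c a b S \<and> (\<exists>x\<in>{x1}. \<exists>y. S = Aff x y)}}"
      have "?A \<subseteq> ?B \<union> ?C"
      proof
        fix S assume "S \<in> ?A"
        then have S: "on_curve c a b S" and n: "padd c a (padd c a P Q) S \<noteq> padd c a P (padd c a Q S)"
          by auto
        show "S \<in> ?B \<union> ?C"
        proof (cases S)
          case Infty
          then show ?thesis using n by simp
        next
          case (Aff x3 y3)
          show ?thesis
          proof (rule ccontr)
            assume h: "S \<notin> ?B \<union> ?C"
            then have x: "x3 \<noteq> x1" "x3 \<noteq> x2" "x3 \<noteq> x4" using S Aff by auto
            have "\<And>y. padd c a (Aff x2 y2) (Aff x3 y3) \<noteq> Aff x1 y"
              using h S Aff QA on_curve_padd[OF c0 two Q S] by auto
            then have "padd c a (padd c a P Q) S = padd c a P (padd c a Q S)"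
              using padd_assoc_generic[of y1 x1 y2 x2 y3 x3] x 4 False P Q S PA QA Aff by auto
            then show False using n by simp
          qed
        qed
      qed
      then show ?thesis
        by (rule finite_subset) (intro finite_UnI finite_same_x finite_translate Q; simp)
    qed
  qed
qed

end
end

section \<open>Associativity without exceptions\<close>

lemma infinite_UNIV_alg_closed: "infinite (UNIV :: 'a::alg_closed_field set)"
proof
  assume fin: "finite (UNIV :: 'a set)"
  define q where "q = (\<Prod>z\<in>(UNIV::'a set). [:- z, 1:])"
  have "degree q = card (UNIV :: 'a set)" unfolding q_def
    by (subst degree_prod_eq_sum_degree) auto
  moreover have "card (UNIV :: 'a set) > 0" using fin by (simp add: card_gt_0_iff)
  ultimately have "degree (q + 1) > 0" by (simp add: degree_add_eq_left)
  then obtain z where "poly (q + 1) z = 0" using alg_closed_imp_poly_has_root by blast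
  moreover have "poly q z = 0" using fin by (auto simp: q_def poly_prod)
  ultimately show False by simp
qed

lemma infinite_on_curve:
  fixes c :: "'a::alg_closed_field"
  assumes "c \<noteq> 0"
  shows "infinite {S. on_curve c a b S}"
proof
  assume fin: "finite {S. on_curve c a b S}"
  have "x \<in> case_point undefined (\<lambda>x y. x) ` {S. on_curve c a b S}" for x
  proof -
    obtain y where "y^2 = (x^3 + a * x + b) / c" using nth_root_exists[of 2] by auto
    then have "on_curve c a b (Aff x y)" using assms by simp
    then show ?thesis by (intro image_eqI[of _ _ "Aff x y"]) auto
  qed
  then have "UNIV \<subseteq> case_point undefined (\<lambda>x y. x) ` {S. on_curve c a b S}" by blast
  then show False using fin infinite_UNIV_alg_closed[where 'a='a] by (meson finite_imageI finite_subset)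
qed

text \<open>Both sides are compared after adding a point in general position, where every sum
  that occurs falls under the generic case.\<close>

lemma padd_assoc_alg_closed:
  fixes c a b :: "'a::alg_closed_field"
  assumes c0: "c \<noteq> 0" and two: "(2::'a) \<noteq> 0" and disc: "4 * a^3 + 27 * b^2 \<noteq> 0"
    and P: "on_curve c a b P" and Q: "on_curve c a b Q" and R: "on_curve c a b R"
  shows "padd c a (padd c a P Q) R = padd c a P (padd c a Q R)"
proof -
  let ?E = "{S. on_curve c a b S}"
  define U where "U = padd c a (padd c a P Q) R"
  define V where "V = padd c a P (padd c a Q R)"
  define N where "N = (\<lambda>P Q. {S. on_curve c a b S \<and> padd c a (padd c a P Q) S \<noteq> padd c a P (padd c a Q S)})"
  note add = on_curve_padd[OF c0 two]
  have U: "on_curve c a b U" and V: "on_curve c a b V"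
    unfolding U_def V_def using P Q R by (auto intro!: add)
  have fN: "finite (N P' Q')" if "on_curve c a b P'" "on_curve c a b Q'" for P' Q'
    unfolding N_def by (rule finite_not_assoc[OF c0 two disc that])
  define xs where "xs = (\<lambda>S. case S of Infty \<Rightarrow> {} | Aff x y \<Rightarrow> {x::'a})"
  have fx: "finite (xs S)" for S by (cases S) (auto simp: xs_def)
  \<comment> \<open>The four sets built from \<open>N\<close> are the exceptions to the four
    regroupings below; the abscissas of \<open>U\<close> and \<open>V\<close> are avoided so that
    \<open>S\<close> can be cancelled at the end.\<close>
  define Bad where "Bad = insert Infty ({S. on_curve c a b S \<and> (\<exists>x\<in>xs U \<union> xs V. \<exists>y. S = Aff x y)} \<union>
     (N (padd c a P Q) R \<union> N Q R \<union> N P (padd c a Q R) \<union>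
      {S. on_curve c a b S \<and> padd c a R S \<in> N P Q}))"
  have "finite Bad" unfolding Bad_def
    by (intro finite.insertI finite_UnI finite_same_x[OF c0 two disc] fx fN finite_translate[OF c0 two disc] add P Q R)
  then obtain S where S: "on_curve c a b S" "S \<notin> Bad"
    using infinite_on_curve[OF c0, of a b] by (metis finite_subset mem_Collect_eq subsetI)
  obtain x y where SA: "S = Aff x y" using S by (cases S) (auto simp: Bad_def)
  have "padd c a U S = padd c a (padd c a P Q) (padd c a R S)"
    using S by (auto simp: U_def Bad_def N_def)
  also have "\<dots> = padd c a P (padd c a Q (padd c a R S))"
    using S add[OF R S(1)] by (auto simp: Bad_def N_def)
  also have "padd c a Q (padd c a R S) = padd c a (padd c a Q R) S"
    using S by (auto simp: Bad_def N_def)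
  also have "padd c a P (padd c a (padd c a Q R) S) = padd c a V S"
    using S by (auto simp: V_def Bad_def N_def)
  finally have eq: "padd c a U S = padd c a V S" .
  have can: "padd c a (padd c a T S) (pneg S) = T"
    if "on_curve c a b T" "x \<notin> xs T" for T
    using padd_cancel_generic[OF c0 two disc, of _ _ y x] that S SA by (cases T) (auto simp: xs_def)
  have "x \<notin> xs U" "x \<notin> xs V" using S SA by (auto simp: Bad_def)
  then have "U = V" using can[OF U] can[OF V] eq by metis
  then show ?thesis by (simp add: U_def V_def)
qed

text \<open>The intended field consists of rational functions and is not algebraically closed. The
  embedding \<open>to_ac\<close> commutes with every formula of the law, so the identity
  descends.\<close>

lemma padd_assoc:
  fixes c a b :: "'a::field"
  assumes c0: "c \<noteq> 0" and two: "(2::'a) \<noteq> 0" and disc: "4 * a^3 + 27 * b^2 \<noteq> 0"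
    and P: "on_curve c a b P" and Q: "on_curve c a b Q" and R: "on_curve c a b R"
  shows "padd c a (padd c a P Q) R = padd c a P (padd c a Q R)"
proof -
  let ?m = "map_point (to_ac :: 'a \<Rightarrow> 'a alg_closure)"
  have inj: "?m A = ?m B \<longleftrightarrow> A = B" for A B
    using point.inj_map[OF inj_to_ac[where 'a='a]] by (auto dest: injD)
  have onc: "on_curve (to_ac c) (to_ac a) (to_ac b) (?m A)" if "on_curve c a b A" for A
    using that by (cases A) (auto simp flip: to_ac_power to_ac_mult to_ac_add)
  have sl: "slope (to_ac c) (to_ac a) (to_ac x) (to_ac y) (to_ac z) (to_ac w) = to_ac (slope c a x y z w)"
    for x y z w by (auto simp: slope_def)
  have hom: "?m (padd c a A B) = padd (to_ac c) (to_ac a) (?m A) (?m B)" for A B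
  proof (cases A; cases B)
    fix x1 y1 x2 y2 assume "A = Aff x1 y1" "B = Aff x2 y2"
    then show ?thesis by (simp add: sl Let_def flip: to_ac_minus)
  qed auto
  have t: "(2::'a alg_closure) \<noteq> 0"
    using two by (metis to_ac_eq_0_iff to_ac_numeral)
  have d: "4 * to_ac a ^ 3 + 27 * to_ac b ^ 2 \<noteq> 0"
    using disc by (metis to_ac_add to_ac_eq_0_iff to_ac_mult to_ac_numeral to_ac_power)
  have "?m (padd c a (padd c a P Q) R) = ?m (padd c a P (padd c a Q R))"
    unfolding hom by (rule padd_assoc_alg_closed[OF _ t d onc[OF P] onc[OF Q] onc[OF R]]) (use c0 in simp)
  then show ?thesis by (simp add: inj)
qed

section \<open>Degrees of points\<close>

definition rf :: "'a::field poly \<Rightarrow> 'a poly fract" where "rf p = Fract p 1"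

lemma rf_0 [simp]: "rf 0 = 0" and rf_1 [simp]: "rf 1 = 1"
  by (simp_all add: rf_def Zero_fract_def One_fract_def)
lemma rf_add: "rf (p + q) = rf p + rf q"
  and rf_diff: "rf (p - q) = rf p - rf q"
  and rf_mult: "rf (p * q) = rf p * rf q"
  and rf_minus: "rf (- p) = - rf p"
  by (simp_all add: rf_def)
lemma rf_power: "rf (p ^ n) = rf p ^ n"
  by (induction n) (simp_all add: rf_mult)
lemma rf_eq_iff [simp]: "rf p = rf q \<longleftrightarrow> p = q"
  by (simp add: rf_def eq_fract)
lemma rf_eq_0_iff [simp]: "rf p = 0 \<longleftrightarrow> p = 0"
  by (metis rf_0 rf_eq_iff)
lemma rf_of_nat: "rf (of_nat n) = of_nat n"
  by (induction n) (simp_all add: rf_add)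
lemma rf_numeral [simp]: "rf (numeral n) = numeral n"
  by (metis of_nat_numeral rf_of_nat)
lemmas rf_hom = rf_add rf_diff rf_mult rf_minus rf_power

lemma Fract_eq_rf: "q \<noteq> 0 \<Longrightarrow> Fract p q = rf p / rf q"
  by (simp add: rf_def)

lemma reduced_fraction:
  fixes t :: "'a::field poly fract"
  obtains p q where "t = rf p / rf q" "q \<noteq> 0" "\<And>z. \<not> (poly p z = 0 \<and> poly q z = 0)"
proof -
  obtain p0 q0 where 0: "t = Fract p0 q0" "q0 \<noteq> 0" by (cases t) auto
  have "\<exists>p q. t = rf p / rf q \<and> q \<noteq> 0 \<and> (\<forall>z. \<not> (poly p z = 0 \<and> poly q z = 0))"
    if "t = rf p / rf q" "q \<noteq> 0" for p q using that
  proof (induction "degree q" arbitrary: p q rule: less_induct)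
    case less
    show ?case
    proof (cases "\<exists>z. poly p z = 0 \<and> poly q z = 0")
      case True
      then obtain z where "poly p z = 0" "poly q z = 0" by auto
      then obtain p' q' where pq: "p = [:- z, 1:] * p'" "q = [:- z, 1:] * q'"
        by (meson poly_eq_0_iff_dvd dvdE)
      have q': "q' \<noteq> 0" using less pq by auto
      have "degree q = Suc (degree q')" using q' unfolding pq by (subst degree_mult_eq) auto
      moreover have "t = rf p' / rf q'" using less.prems q' unfolding pq rf_mult by simp
      ultimately show ?thesis using less.hyps[of q' p'] q' by simp
    qed (use less in blast)
  qed
  from this[of p0 q0] show ?thesis using 0 that by (auto simp: Fract_eq_rf)
qed

text \<open>Both triples represent the same projective point. A root of \<open>w\<close> is a root
  of \<open>v\<close> because the \<open>v\<close>-triple has no common zero, so the linear factor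
  cancels from both; once \<open>w\<close> is constant, the other triple forces \<open>v\<close> to
  be constant too.\<close>

lemma primitive_triple:
  fixes u1 u2 u3 v1 v2 v3 w v :: "'a::alg_closed_field poly"
  assumes "u1 * w = v1 * v" "u2 * w = v2 * v" "u3 * w = v3 * v" "w \<noteq> 0" "v \<noteq> 0"
    and u: "\<And>z. \<not> (poly u1 z = 0 \<and> poly u2 z = 0 \<and> poly u3 z = 0)"
    and v: "\<And>z. \<not> (poly v1 z = 0 \<and> poly v2 z = 0 \<and> poly v3 z = 0)"
  shows "\<exists>\<kappa>. \<kappa> \<noteq> 0 \<and> u1 = smult \<kappa> v1 \<and> u2 = smult \<kappa> v2 \<and> u3 = smult \<kappa> v3"
  using assms(1-5)
proof (induction "degree w" arbitrary: w v rule: less_induct)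
  case less
  show ?case
  proof (cases "degree w = 0")
    case True
    then obtain w0 where w0: "w = [:w0:]" by (meson degree_eq_zeroE)
    have "degree v = 0"
    proof (rule ccontr)
      assume "degree v \<noteq> 0"
      then obtain z where "poly v z = 0" using alg_closed_imp_poly_has_root by blast
      then have "poly (u1 * w) z = 0" "poly (u2 * w) z = 0" "poly (u3 * w) z = 0"
        using less.prems by simp_all
      then show False using u w0 less.prems(4) by auto
    qed
    then obtain v0 where v0: "v = [:v0:]" by (meson degree_eq_zeroE)
    have ne: "v0 \<noteq> 0" "w0 \<noteq> 0" using v0 w0 less.prems by auto
    have "u = smult (v0 / w0) v'" if "u * w = v' * v" for u v'
    proof -
      have "smult w0 u = smult v0 v'" using that by (simp add: v0 w0 mult.commute)
      then have "smult (inverse w0) (smult w0 u) = smult (inverse w0) (smult v0 v')" by simp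
      then show ?thesis using ne by (simp add: field_simps)
    qed
    then show ?thesis using less.prems ne by (intro exI[of _ "v0 / w0"]) auto
  next
    case False
    then obtain z where z: "poly w z = 0" using alg_closed_imp_poly_has_root by blast
    then have "poly (v1 * v) z = 0" "poly (v2 * v) z = 0" "poly (v3 * v) z = 0"
      using less.prems(1-3)[symmetric] by simp_all
    then have "poly v z = 0" using v by auto
    then obtain w' v' where wv: "w = [:- z, 1:] * w'" "v = [:- z, 1:] * v'"
      using z by (meson poly_eq_0_iff_dvd dvdE)
    have ne: "w' \<noteq> 0" "v' \<noteq> 0" using wv less.prems by auto
    have d: "degree w = Suc (degree w')" using ne unfolding wv by (subst degree_mult_eq) auto
    have c: "u * w' = v'' * v'" if "u * w = v'' * v" for u v''
    proof -
      have "[:- z, 1:] * (u * w') = [:- z, 1:] * (v'' * v')"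
        using that unfolding wv by (simp only: mult_ac)
      moreover have "[:- z, 1:] \<noteq> 0" by simp
      ultimately show ?thesis using mult_left_cancel by blast
    qed
    show ?thesis using less.hyps[of w' v'] c less.prems ne d by simp
  qed
qed

section \<open>Abscissas of sums, differences and doubles\<close>

context
  fixes c a b :: "'a::field"
  assumes c0: "c \<noteq> 0"
begin

text \<open>\<open>u\<close> and \<open>v\<close> are the abscissas of the sum and of the
  difference. Each involves \<open>y1 * y2\<close>, but their sum and product are invariant under
  \<open>y2\<close> to \<open>- y2\<close>, so the curve equations remove the ordinates and with
  them \<open>c\<close>.\<close>

lemma x_padd_sum_prod:
  assumes P: "c * y1^2 = x1^3 + a * x1 + b" and Q: "c * y2^2 = x2^3 + a * x2 + b"
    and ne: "x1 \<noteq> x2"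
  defines "l \<equiv> (y2 - y1) / (x2 - x1)" and "l' \<equiv> (- y2 - y1) / (x2 - x1)"
  defines "u \<equiv> c * l^2 - x1 - x2" and "v \<equiv> c * l'^2 - x1 - x2"
  shows "(x2 - x1)^2 * (u + v) = 2 * ((x1 * x2 + a) * (x1 + x2) + 2 * b)"
    and "(x2 - x1)^2 * (u * v) = (x1 * x2 - a)^2 - 4 * b * (x1 + x2)"
proof -
  define d where "d = x2 - x1"
  have d: "d \<noteq> 0" using ne by (simp add: d_def)
  have l: "l * d = y2 - y1" "l' * d = - y2 - y1" using d by (simp_all add: l_def l'_def d_def)
  have u: "d^2 * u = c * (y2 - y1)^2 - (x1 + x2) * d^2"
    unfolding u_def l(1)[symmetric] by Groebner_Basis.algebra
  have v: "d^2 * v = c * (y2 + y1)^2 - (x1 + x2) * d^2"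
  proof -
    have "d^2 * v = c * (l' * d)^2 - (x1 + x2) * d^2"
      unfolding v_def by Groebner_Basis.algebra
    then show ?thesis unfolding l by Groebner_Basis.algebra
  qed
  have "d^2 * (u + v) = 2 * (c * y1^2) + 2 * (c * y2^2) - 2 * (x1 + x2) * d^2"
    unfolding distrib_left u v by Groebner_Basis.algebra
  also have "\<dots> = 2 * ((x1 * x2 + a) * (x1 + x2) + 2 * b)"
    unfolding P Q d_def by Groebner_Basis.algebra
  finally show "(x2 - x1)^2 * (u + v) = 2 * ((x1 * x2 + a) * (x1 + x2) + 2 * b)"
    by (simp add: d_def)
  have "d^2 * (d^2 * (u * v)) = (d^2 * u) * (d^2 * v)" by simp
  also have "\<dots> = (c * y2^2 - c * y1^2)^2 - (x1 + x2) * d^2 * (2 * (c * y1^2) + 2 * (c * y2^2))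
     + (x1 + x2)^2 * d^4" unfolding u v by Groebner_Basis.algebra
  also have "\<dots> = d^2 * ((x1 * x2 - a)^2 - 4 * b * (x1 + x2))"
    unfolding P Q d_def by Groebner_Basis.algebra
  finally have "d^2 * (u * v) = (x1 * x2 - a)^2 - 4 * b * (x1 + x2)"
    using d by (metis mult_left_cancel power_not_zero)
  then show "(x2 - x1)^2 * (u * v) = (x1 * x2 - a)^2 - 4 * b * (x1 + x2)"
    by (simp add: d_def)
qed

lemma x_double:
  assumes P: "c * y^2 = x^3 + a * x + b" and y: "2 * y \<noteq> 0"
  defines "l \<equiv> (3 * x^2 + a) / (2 * c * y)"
  shows "4 * (x^3 + a * x + b) * (c * l^2 - x - x) = (x^2 - a)^2 - 8 * b * x"
proof -
  have l: "l * (2 * c * y) = 3 * x^2 + a" using y c0 by (simp add: l_def)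
  have "4 * (x^3 + a * x + b) * (c * l^2 - x - x) = (l * (2 * c * y))^2 - 8 * x * (c * y^2)"
    unfolding P[symmetric] by Groebner_Basis.algebra
  then show ?thesis unfolding l P by Groebner_Basis.algebra
qed

end

lemma degree_add_left: "degree q < n \<Longrightarrow> degree p = n \<Longrightarrow> degree (p + q) = n"
  by (simp add: degree_add_eq_left)

lemma degree_diff_left: "degree q < n \<Longrightarrow> degree p = n \<Longrightarrow> degree (p - q) = n"
  for p q :: "'a::ring poly"
  using degree_add_left[of "- q" n p] by simp

lemma degree_mult_less:
  fixes p q :: "'a::idom poly"
  assumes "degree p \<le> m" "degree q < n"
  shows "degree (p * q) < m + n"
  using degree_mult_le[of p q] assms by linarith

lemma degree_power_idom:
  fixes p :: "'a::idom poly"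
  shows "0 < n \<Longrightarrow> degree (p ^ n) = n * degree p"
  by (cases "p = 0") (simp_all add: degree_power_eq zero_power)

text \<open>The inequality of degrees says that the map fixes infinity.\<close>

definition ratdeg :: "'a::field poly fract \<Rightarrow> nat \<Rightarrow> bool" where
  "ratdeg t n \<longleftrightarrow> (\<exists>p q. t = rf p / rf q \<and> q \<noteq> 0 \<and> degree p = n \<and> degree q < n \<and>
     (\<forall>z. \<not> (poly p z = 0 \<and> poly q z = 0)))"

definition pdeg :: "'a::field poly fract point \<Rightarrow> nat \<Rightarrow> bool" where
  "pdeg P n = (case P of Infty \<Rightarrow> n = 0 | Aff x y \<Rightarrow> ratdeg x n)"

lemma pdeg_pneg [simp]: "pdeg (pneg P) n = pdeg P n"
  by (cases P) (auto simp: pdeg_def)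

lemma pdeg_Infty [simp]: "pdeg Infty n \<longleftrightarrow> n = 0"
  by (simp add: pdeg_def)

lemma ratdeg_unique:
  fixes x :: "'a::alg_closed_field poly fract"
  assumes "ratdeg x n" "ratdeg x m"
  shows "n = m"
proof -
  from assms obtain p q p' q' where 1: "x = rf p / rf q" "q \<noteq> 0" "degree p = n"
      "\<And>z. \<not> (poly p z = 0 \<and> poly q z = 0)"
    and 2: "x = rf p' / rf q'" "q' \<noteq> 0" "degree p' = m" "\<And>z. \<not> (poly p' z = 0 \<and> poly q' z = 0)"
    unfolding ratdeg_def by blast
  have "rf p * rf q' = rf p' * rf q" using 1 2 by (simp add: field_simps)
  then have "p * q' = p' * q" by (simp flip: rf_mult)
  then have "\<exists>\<kappa>. \<kappa> \<noteq> 0 \<and> p = smult \<kappa> p' \<and> q = smult \<kappa> q' \<and> q = smult \<kappa> q'"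
    using 1 2 by (intro primitive_triple[of p q' p' q q q' q q']) auto
  then show ?thesis using 1 2 by auto
qed

lemma pdeg_unique:
  fixes P :: "'a::alg_closed_field poly fract point"
  shows "pdeg P n \<Longrightarrow> pdeg P m \<Longrightarrow> n = m"
  by (cases P) (auto simp: pdeg_def ratdeg_unique)

text \<open>For \<open>c = x\<^sup>3 + a x + b\<close>, points of this twist over the field of rational functions are the
  maps from the curve \<open>y\<^sup>2 = x\<^sup>3 + a x + b\<close> to itself that commute with negation: \<open>Aff s t\<close> is the
  map \<open>(x, y) \<mapsto> (s, t y)\<close>, and the degree of \<open>s\<close> is the degree of the map.\<close>

locale const_curve =
  fixes a b :: "'a::alg_closed_field" and c :: "'a poly fract"
  assumes two: "(2::'a) \<noteq> 0" and disc: "4 * a^3 + 27 * b^2 \<noteq> 0" and c0: "c \<noteq> 0"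
begin

abbreviation "ka \<equiv> rf [:a:]"
abbreviation "kb \<equiv> rf [:b:]"
abbreviation "onc \<equiv> on_curve c ka kb"
abbreviation plus_pt (infixl "\<oplus>\<oplus>" 65) where "P \<oplus>\<oplus> Q \<equiv> padd c ka P Q"

lemma two': "(2::'a poly fract) \<noteq> 0"
proof -
  have "rf [:2::'a:] \<noteq> 0" using two by simp
  then show ?thesis by (metis numeral_poly rf_numeral)
qed

lemma disc': "4 * ka^3 + 27 * kb^2 \<noteq> 0"
proof -
  have "4 * ka^3 + 27 * kb^2 = rf [:4 * a^3 + 27 * b^2:]"
    by (simp add: power3_eq_cube power2_eq_square numeral_poly flip: rf_hom rf_numeral)
  then show ?thesis using disc by simp
qed

lemmas commute = padd_commute[OF c0 two', of ka kb]
lemmas assoc = padd_assoc[OF c0 two' disc']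
lemmas onc_add = on_curve_padd[OF c0 two', of ka kb]

text \<open>\<open>(s1, t1)\<close> and \<open>(s2, t2)\<close> are homogeneous coordinates of two
  abscissas. Assumption \<open>w\<close> makes them the same point of the projective line, where the
  two other equations say that numerator and denominator of the duplication formula vanish; a common
  zero would be a double root of the cubic.\<close>

lemma no_common_zero:
  fixes s1 t1 s2 t2 :: 'a
  assumes 1: "\<not> (s1 = 0 \<and> t1 = 0)" and 2: "\<not> (s2 = 0 \<and> t2 = 0)" and w: "s2 * t1 = s1 * t2"
    and p: "(s1 * s2 - a * (t1 * t2))^2 = 4 * b * (s1 * t2 + s2 * t1) * (t1 * t2)"
    and s: "(s1 * s2 + a * (t1 * t2)) * (s1 * t2 + s2 * t1) + 2 * b * (t1 * t2)^2 = 0"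
  shows False
proof -
  have "\<exists>l. l \<noteq> 0 \<and> s2 = l * s1 \<and> t2 = l * t1"
  proof (cases "t1 = 0")
    case True
    then have "s1 \<noteq> 0" "t2 = 0" using 1 w by auto
    then show ?thesis using True 2 by (intro exI[of _ "s2 / s1"]) auto
  next
    case False
    then have "t2 \<noteq> 0" using 2 w by auto
    then show ?thesis using False w by (intro exI[of _ "t2 / t1"]) (auto simp: field_simps)
  qed
  then obtain l where l: "l \<noteq> 0" "s2 = l * s1" "t2 = l * t1" by auto
  have "l^2 * ((s1^2 - a * t1^2)^2 - 8 * b * s1 * t1^3) =
    (s1 * s2 - a * (t1 * t2))^2 - 4 * b * (s1 * t2 + s2 * t1) * (t1 * t2)"
    unfolding l(2,3) by Groebner_Basis.algebra
  then have p': "(s1^2 - a * t1^2)^2 - 8 * b * s1 * t1^3 = 0" using p l by simp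
  have "l^2 * (2 * (t1 * (s1^3 + a * s1 * t1^2 + b * t1^3))) =
    (s1 * s2 + a * (t1 * t2)) * (s1 * t2 + s2 * t1) + 2 * b * (t1 * t2)^2"
    unfolding l(2,3) by Groebner_Basis.algebra
  then have s': "t1 = 0 \<or> s1^3 + a * s1 * t1^2 + b * t1^3 = 0" using s l two by simp
  show False
  proof (cases "t1 = 0")
    case True
    then show False using p' 1 by simp
  next
    case False
    define z where "z = s1 / t1"
    have s1: "s1 = z * t1" using False by (simp add: z_def)
    have "t1^3 * (z^3 + a * z + b) = s1^3 + a * s1 * t1^2 + b * t1^3"
      unfolding s1 by Groebner_Basis.algebra
    then have f: "z^3 + a * z + b = 0" using s' False by simp
    have "t1^4 * ((z^2 - a)^2 - 8 * b * z) = (s1^2 - a * t1^2)^2 - 8 * b * s1 * t1^3"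
      unfolding s1 by Groebner_Basis.algebra
    then have "(z^2 - a)^2 - 8 * b * z = 0" using p' False by simp
    moreover have "(3 * z^2 + a)^2 = (z^2 - a)^2 - 8 * b * z + 8 * z * (z^3 + a * z + b)"
      by Groebner_Basis.algebra
    ultimately have "3 * z^2 + a = 0" using f by simp
    then show False using no_double_root[OF one_neq_zero two disc f] by simp
  qed
qed

text \<open>As \<open>degree q < degree p\<close>, the term \<open>p^3\<close> dominates the cubic
  once denominators are cleared. This rules out points of order two, at which the later calculus
  with differentials would divide by zero.\<close>

lemma ratdeg_y_nonzero:
  assumes P: "onc (Aff x y)" and d: "ratdeg x n"
  shows "y \<noteq> 0"
proof
  assume y: "y = 0"
  from d obtain p q where pq: "x = rf p / rf q" "q \<noteq> 0" "degree p = n" "degree q < n"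
    unfolding ratdeg_def by auto
  have "x^3 + ka * x + kb = 0" using P y by simp
  then have "rf q^3 * (x^3 + ka * x + kb) = 0" by simp
  also have "rf q^3 * (x^3 + ka * x + kb) = rf (p^3 + ([:a:] * (p * q^2) + [:b:] * q^3))"
  proof -
    have e: "rf p = x * rf q" using pq by simp
    show ?thesis unfolding rf_hom e by Groebner_Basis.algebra
  qed
  finally have 0: "p^3 + ([:a:] * (p * q^2) + [:b:] * q^3) = 0" by (simp only: rf_eq_0_iff)
  have dp: "degree (p^3) = 3 * n" using pq by (simp add: degree_power_idom)
  have "degree (smult a (p * q^2)) \<le> degree p + 2 * degree q"
    by (intro order.trans[OF degree_smult_le] order.trans[OF degree_mult_le])
       (simp add: degree_power_idom)
  moreover have "degree (smult b (q^3)) \<le> 3 * degree q"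
    by (intro order.trans[OF degree_smult_le] order.trans[OF degree_power_le]) simp
  ultimately have "degree ([:a:] * (p * q^2) + [:b:] * q^3) < 3 * n"
    using pq by (intro degree_add_less) auto
  then have "degree (p^3 + ([:a:] * (p * q^2) + [:b:] * q^3)) = 3 * n"
    using dp by (rule degree_add_left)
  then show False using 0 pq by simp
qed

lemma pdeg_double:
  assumes P: "onc (Aff x y)" and d: "ratdeg x n"
  shows "pdeg (Aff x y \<oplus>\<oplus> Aff x y) (4 * n)"
proof -
  have y0: "y \<noteq> 0" using ratdeg_y_nonzero[OF P d] .
  then have y2: "2 * y \<noteq> 0" using two' by (simp only: mult_eq_0_iff) auto
  then have yn: "y \<noteq> - y" by (metis add.right_inverse mult_2)
  from d obtain p q where pq: "x = rf p / rf q" "q \<noteq> 0" "degree p = n" "degree q < n"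
      "\<And>z. \<not> (poly p z = 0 \<and> poly q z = 0)"
    unfolding ratdeg_def by auto
  define l where "l = (3 * x^2 + ka) / (2 * c * y)"
  have P': "c * y^2 = x^3 + ka * x + kb" using P by simp
  have X: "4 * (x^3 + ka * x + kb) * (c * l^2 - x - x) = (x^2 - ka)^2 - 8 * kb * x"
    unfolding l_def by (rule x_double[OF c0 P' y2])
  have c3: "x^3 + ka * x + kb \<noteq> 0" using P' c0 y0 by auto
  have r0: "rf q \<noteq> 0" using pq by simp
  define D where "D = p^3 + ([:a:] * (p * q^2) + [:b:] * q^3)"
  define A where "A = (p^2 - [:a:] * q^2)^2 - [:8 * b:] * (p * q^3)"
  define B where "B = [:4:] * (q * D)"
  have e: "rf p = x * rf q" using pq by simp
  have e8: "rf [:8 * b:] = 8 * kb" and e4: "rf [:4::'a:] = 4"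
    by (simp_all add: numeral_poly flip: rf_mult rf_numeral)
  have rD: "rf D = rf q^3 * (x^3 + ka * x + kb)"
    unfolding D_def rf_hom e by Groebner_Basis.algebra
  have rA: "rf A = rf q^4 * ((x^2 - ka)^2 - 8 * kb * x)"
    unfolding A_def rf_hom e e8 by Groebner_Basis.algebra
  have rB: "rf B = rf q^4 * (4 * (x^3 + ka * x + kb))"
    unfolding B_def rf_mult rD e4 by Groebner_Basis.algebra
  have four: "(4::'a) \<noteq> 0" using two by (metis mult_2_right mult_eq_0_iff numeral_Bit0)
  have "rf D \<noteq> 0" unfolding rD using r0 c3 by simp
  then have D0: "D \<noteq> 0" by simp
  then have B0: "B \<noteq> 0" unfolding B_def using pq four by simp
  have val: "c * l^2 - x - x = rf A / rf B"
  proof -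
    have "rf B * (c * l^2 - x - x) = rf A" unfolding rA rB X[symmetric] by (simp only: mult_ac)
    then show ?thesis using B0 by (simp add: field_simps)
  qed
  have dD: "degree D \<le> 3 * n" unfolding D_def
  proof (intro degree_add_le)
    show "degree (p^3) \<le> 3 * n" using degree_power_le[of p 3] pq by simp
    have "degree (p * q^2) \<le> degree p + 2 * degree q"
      by (intro order.trans[OF degree_mult_le]) (simp add: degree_power_idom)
    then show "degree ([:a:] * (p * q^2)) \<le> 3 * n" using pq
      by (simp add: order.trans[OF degree_smult_le])
    show "degree ([:b:] * q^3) \<le> 3 * n" using pq degree_power_le[of q 3]
      by (simp add: order.trans[OF degree_smult_le])
  qed
  have dB: "degree B < 4 * n"
    using degree_mult_le[of q D] dD pq by (simp add: B_def four)
  have d1: "degree (p^2 - [:a:] * q^2) = 2 * n"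
  proof (rule degree_diff_left)
    show "degree ([:a:] * q^2) < 2 * n" using degree_power_le[of q 2] pq degree_smult_le[of a "q^2"]
      by simp
    show "degree (p^2) = 2 * n" using pq by (simp add: degree_power_idom)
  qed
  have dA: "degree A = 4 * n" unfolding A_def
  proof (rule degree_diff_left)
    show "degree ((p^2 - [:a:] * q^2)^2) = 4 * n" using d1 by (simp add: degree_power_idom)
    have "degree (p * q^3) \<le> degree p + 3 * degree q"
      by (intro order.trans[OF degree_mult_le]) (simp add: degree_power_idom)
    then show "degree ([:8 * b:] * (p * q^3)) < 4 * n"
      using pq degree_smult_le[of "8 * b" "p * q^3"] by simp
  qed
  have nc: "\<not> (poly A z = 0 \<and> poly B z = 0)" for z
  proof
    assume h: "poly A z = 0 \<and> poly B z = 0"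
    define s where "s = poly p z"
    define t where "t = poly q z"
    have st: "\<not> (s = 0 \<and> t = 0)" using pq by (simp add: s_def t_def)
    have 1: "(s^2 - a * t^2)^2 - 8 * b * (s * t^3) = 0"
      using h by (simp add: A_def s_def t_def)
    have "4 * (t * (s^3 + (a * (s * t^2) + b * t^3))) = 0"
      using h by (simp add: B_def D_def s_def t_def)
    then have 2: "t * (s^3 + (a * (s * t^2) + b * t^3)) = 0" using four by (metis mult_eq_0_iff)
    have 3: "(s * s - a * (t * t))^2 = 4 * b * (s * t + s * t) * (t * t)"
    proof -
      have "(s * s - a * (t * t))^2 - 4 * b * (s * t + s * t) * (t * t) = (s^2 - a * t^2)^2 - 8 * b * (s * t^3)"
        by Groebner_Basis.algebra
      then show ?thesis using 1 by simp
    qed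
    have 4: "(s * s + a * (t * t)) * (s * t + s * t) + 2 * b * (t * t)^2 = 0"
    proof -
      have "(s * s + a * (t * t)) * (s * t + s * t) + 2 * b * (t * t)^2 =
        2 * (t * (s^3 + (a * (s * t^2) + b * t^3)))" by Groebner_Basis.algebra
      then show ?thesis using 2 by simp
    qed
    show False by (rule no_common_zero[OF st st refl 3 4])
  qed
  have "ratdeg (c * l^2 - x - x) (4 * n)"
    unfolding ratdeg_def using val B0 dA dB nc by blast
  then show ?thesis using yn by (simp add: pdeg_def Let_def slope_def flip: l_def)
qed

text \<open>By \<open>x_padd_sum_prod\<close> the triples
  \<open>(pu * pv, pu * qv + pv * qu, qu * qv)\<close> and \<open>(T, S, W)\<close> are
  proportional. Neither has a common zero, the second by \<open>no_common_zero\<close>, so they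
  agree up to a constant and no degree is lost: the sum of the two degrees is that of
  \<open>T\<close>.\<close>

lemma parallelogram_chord:
  assumes P: "onc (Aff x1 y1)" and Q: "onc (Aff x2 y2)" and ne: "x1 \<noteq> x2"
    and d1: "ratdeg x1 n" and d2: "ratdeg x2 m"
  obtains r s where "pdeg (Aff x1 y1 \<oplus>\<oplus> Aff x2 y2) r" "pdeg (Aff x1 y1 \<oplus>\<oplus> Aff x2 (- y2)) s"
    "r + s = 2 * n + 2 * m"
proof -
  from d1 obtain p1 q1 where 1: "x1 = rf p1 / rf q1" "q1 \<noteq> 0" "degree p1 = n" "degree q1 < n"
      "\<And>z. \<not> (poly p1 z = 0 \<and> poly q1 z = 0)"
    unfolding ratdeg_def by auto
  from d2 obtain p2 q2 where 2: "x2 = rf p2 / rf q2" "q2 \<noteq> 0" "degree p2 = m" "degree q2 < m"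
      "\<And>z. \<not> (poly p2 z = 0 \<and> poly q2 z = 0)"
    unfolding ratdeg_def by auto
  define l where "l = (y2 - y1) / (x2 - x1)"
  define l' where "l' = (- y2 - y1) / (x2 - x1)"
  define u where "u = c * l^2 - x1 - x2"
  define v where "v = c * l'^2 - x1 - x2"
  have P': "c * y1^2 = x1^3 + ka * x1 + kb" and Q': "c * y2^2 = x2^3 + ka * x2 + kb"
    using P Q by simp_all
  note sp = x_padd_sum_prod[OF c0 P' Q' ne, folded l_def l'_def, folded u_def v_def]
  obtain pu qu where u: "u = rf pu / rf qu" "qu \<noteq> 0" "\<And>z. \<not> (poly pu z = 0 \<and> poly qu z = 0)"
    by (rule reduced_fraction[of u]) auto
  obtain pv qv where v: "v = rf pv / rf qv" "qv \<noteq> 0" "\<And>z. \<not> (poly pv z = 0 \<and> poly qv z = 0)"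
    by (rule reduced_fraction[of v]) auto
  have r0: "rf q1 \<noteq> 0" "rf q2 \<noteq> 0" "rf qu \<noteq> 0" "rf qv \<noteq> 0" using 1 2 u v by simp_all
  have e1: "rf p1 = x1 * rf q1" and e2: "rf p2 = x2 * rf q2"
    and eu: "rf pu = u * rf qu" and ev: "rf pv = v * rf qv"
    using r0 1 2 u v by simp_all
  define W where "W = (p2 * q1 - p1 * q2)^2"
  define S where "S = [:2:] * ((p1 * p2 + [:a:] * (q1 * q2)) * (p1 * q2 + p2 * q1) + [:2 * b:] * (q1 * q2)^2)"
  define T where "T = (p1 * p2 - [:a:] * (q1 * q2))^2 - [:4 * b:] * ((p1 * q2 + p2 * q1) * (q1 * q2))"
  define g where "g = rf q1 * rf q2"
  have g0: "g \<noteq> 0" using r0 by (simp add: g_def)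
  have k2: "rf [:2::'a:] = 2" "rf [:2 * b:] = 2 * kb" "rf [:4 * b:] = 4 * kb"
    by (simp_all add: numeral_poly flip: rf_mult rf_numeral)
  have rW: "rf W = g^2 * (x2 - x1)^2"
    unfolding W_def rf_hom e1 e2 g_def by Groebner_Basis.algebra
  have rS: "rf S = g^2 * (2 * ((x1 * x2 + ka) * (x1 + x2) + 2 * kb))"
    unfolding S_def rf_hom e1 e2 g_def k2 by Groebner_Basis.algebra
  have rT: "rf T = g^2 * ((x1 * x2 - ka)^2 - 4 * kb * (x1 + x2))"
    unfolding T_def rf_hom e1 e2 g_def k2 by Groebner_Basis.algebra
  have W0: "W \<noteq> 0"
  proof -
    have "rf W \<noteq> 0" unfolding rW using g0 ne by simp
    then show ?thesis by simp
  qed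
  have "rf ((pu * pv) * W) = rf (T * (qu * qv))"
    unfolding rf_mult rT rW sp(2)[symmetric] eu ev by Groebner_Basis.algebra
  then have f1: "(pu * pv) * W = T * (qu * qv)" by (simp only: rf_eq_iff)
  have "rf ((pu * qv + pv * qu) * W) = rf (S * (qu * qv))"
    unfolding rf_mult rf_add rS rW sp(1)[symmetric] eu ev by Groebner_Basis.algebra
  then have f2: "(pu * qv + pv * qu) * W = S * (qu * qv)" by (simp only: rf_eq_iff)
  have f3: "(qu * qv) * W = W * (qu * qv)" by simp
  have n1: "\<not> (poly (pu * pv) z = 0 \<and> poly (pu * qv + pv * qu) z = 0 \<and> poly (qu * qv) z = 0)" for z
    using u(3)[of z] v(3)[of z] by auto
  have n2: "\<not> (poly T z = 0 \<and> poly S z = 0 \<and> poly W z = 0)" for z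
  proof
    assume h: "poly T z = 0 \<and> poly S z = 0 \<and> poly W z = 0"
    show False
    proof (rule no_common_zero)
      show "\<not> (poly p1 z = 0 \<and> poly q1 z = 0)" "\<not> (poly p2 z = 0 \<and> poly q2 z = 0)"
        using 1 2 by blast+
      show "poly p2 z * poly q1 z = poly p1 z * poly q2 z" using h by (simp add: W_def)
      show "(poly p1 z * poly p2 z - a * (poly q1 z * poly q2 z))^2 =
        4 * b * (poly p1 z * poly q2 z + poly p2 z * poly q1 z) * (poly q1 z * poly q2 z)"
        using h by (simp add: T_def mult.assoc)
      have "2 * ((poly p1 z * poly p2 z + a * (poly q1 z * poly q2 z)) *
         (poly p1 z * poly q2 z + poly p2 z * poly q1 z) + 2 * b * (poly q1 z * poly q2 z)^2) = 0"
        using h by (simp add: S_def)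
      then show "(poly p1 z * poly p2 z + a * (poly q1 z * poly q2 z)) *
         (poly p1 z * poly q2 z + poly p2 z * poly q1 z) + 2 * b * (poly q1 z * poly q2 z)^2 = 0"
        using two by (metis mult_eq_0_iff)
    qed
  qed
  from primitive_triple[OF f1 f2 f3 W0 _ n1 n2] u(2) v(2)
  obtain \<kappa> where k: "\<kappa> \<noteq> 0" "pu * pv = smult \<kappa> T" "pu * qv + pv * qu = smult \<kappa> S" "qu * qv = smult \<kappa> W"
    by auto
  have b1: "degree (p1 * q2) < n + m" "degree (q1 * q2) < n + m" "degree (p2 * q1) < n + m"
    using 1 2 degree_mult_le[of p1 q2] degree_mult_le[of q1 q2] degree_mult_le[of p2 q1] by linarith+
  have pp: "degree (p1 * p2) = n + m" using 1 2 by (subst degree_mult_eq) auto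
  have dT: "degree T = 2 * n + 2 * m" unfolding T_def
  proof (rule degree_diff_left)
    have "degree (p1 * p2 - [:a:] * (q1 * q2)) = n + m"
      using b1 degree_smult_le[of a "q1 * q2"] pp by (intro degree_diff_left) auto
    then show "degree ((p1 * p2 - [:a:] * (q1 * q2))^2) = 2 * n + 2 * m"
      by (simp add: degree_power_idom)
    have "degree ((p1 * q2 + p2 * q1) * (q1 * q2)) < (n + m) + (n + m)"
    proof (rule degree_mult_less)
      show "degree (p1 * q2 + p2 * q1) \<le> n + m" using b1 by (intro degree_add_le) auto
    qed (rule b1)
    then show "degree ([:4 * b:] * ((p1 * q2 + p2 * q1) * (q1 * q2))) < 2 * n + 2 * m"
      using degree_smult_le[of "4 * b" "(p1 * q2 + p2 * q1) * (q1 * q2)"] by simp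
  qed
  have dW: "degree W < 2 * n + 2 * m"
  proof -
    have "degree (p2 * q1 - p1 * q2) < n + m" using b1 by (intro degree_diff_less) auto
    then show ?thesis using degree_power_le[of "p2 * q1 - p1 * q2" 2] by (simp add: W_def)
  qed
  have dS: "degree S < 2 * n + 2 * m"
  proof -
    have "degree (p1 * p2 + [:a:] * (q1 * q2)) \<le> n + m"
      using b1 degree_smult_le[of a "q1 * q2"] pp by (intro degree_add_le) auto
    moreover have "degree (p1 * q2 + p2 * q1) < n + m" using b1 by (intro degree_add_less) auto
    ultimately have "degree ((p1 * p2 + [:a:] * (q1 * q2)) * (p1 * q2 + p2 * q1)) < (n + m) + (n + m)"
      by (rule degree_mult_less)
    moreover have "degree ([:2 * b:] * (q1 * q2)^2) < (n + m) + (n + m)"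
      using b1 degree_smult_le[of "2 * b" "(q1 * q2)^2"] degree_power_le[of "q1 * q2" 2] by simp
    ultimately have "degree ((p1 * p2 + [:a:] * (q1 * q2)) * (p1 * q2 + p2 * q1)
       + [:2 * b:] * (q1 * q2)^2) < (n + m) + (n + m)" by (rule degree_add_less)
    then show ?thesis using degree_smult_le[of 2] by (simp add: S_def two)
  qed
  have T0: "T \<noteq> 0" using dT 1 by auto
  have puv: "pu \<noteq> 0" "pv \<noteq> 0" using k T0 by auto
  have D1: "degree pu + degree pv = 2 * n + 2 * m"
    using k(1,2) dT puv by (metis degree_mult_eq degree_smult_eq)
  have D2: "degree qu + degree qv < 2 * n + 2 * m"
    using k(1,4) dW u(2) v(2) by (metis degree_mult_eq degree_smult_eq)
  have D3: "degree (pu * qv + pv * qu) < 2 * n + 2 * m" using k(1,3) dS by simp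
  have D4: "degree (pu * qv) = degree pu + degree qv" "degree (pv * qu) = degree pv + degree qu"
    using puv u(2) v(2) by (auto simp: degree_mult_eq)
  \<comment> \<open>The product of \<open>u\<close> and \<open>v\<close> has a pole at infinity, but
    a single factor might have none. If \<open>u\<close> had none, \<open>pv * qu\<close> would
    dominate the mixed sum, whose degree would then be at least \<open>2 * n + 2 * m\<close>,
    against \<open>D3\<close>.\<close>
  have Du: "degree qu < degree pu"
  proof (rule ccontr)
    assume h: "\<not> degree qu < degree pu"
    then have "degree (pu * qv) < degree (pv * qu)" using D1 D2 D4 by linarith
    then have "degree (pu * qv + pv * qu) = degree (pv * qu)" by (rule degree_add_eq_right)
    then show False using D1 D3 D4 h by linarith
  qed
  have Dv: "degree qv < degree pv"
  proof (rule ccontr)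
    assume h: "\<not> degree qv < degree pv"
    then have "degree (pv * qu) < degree (pu * qv)" using D1 D2 D4 by linarith
    then have "degree (pu * qv + pv * qu) = degree (pu * qv)" by (rule degree_add_eq_left)
    then show False using D1 D3 D4 h by linarith
  qed
  have "ratdeg u (degree pu)" "ratdeg v (degree pv)"
    unfolding ratdeg_def using u v Du Dv by blast+
  then have "pdeg (Aff x1 y1 \<oplus>\<oplus> Aff x2 y2) (degree pu)" "pdeg (Aff x1 y1 \<oplus>\<oplus> Aff x2 (- y2)) (degree pv)"
    using ne by (simp_all add: pdeg_def Let_def slope_def u_def v_def l_def l'_def)
  then show ?thesis using that D1 by blast
qed

lemma parallelogram:
  assumes P: "onc P" and Q: "onc Q" and n: "pdeg P n" and m: "pdeg Q m"
  obtains r s where "pdeg (P \<oplus>\<oplus> Q) r" "pdeg (P \<oplus>\<oplus> pneg Q) s" "r + s = 2 * n + 2 * m"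
proof (cases P)
  case Infty
  then show ?thesis using that[of m m] n m by simp
next
  case PA: (Aff x1 y1)
  show ?thesis
  proof (cases Q)
    case Infty
    then show ?thesis using that[of n n] n m by simp
  next
    case QA: (Aff x2 y2)
    have d: "ratdeg x1 n" "ratdeg x2 m" using n m PA QA by (auto simp: pdeg_def)
    show ?thesis
    proof (cases "x1 = x2")
      case False
      from parallelogram_chord[OF _ _ False d, of y1 y2] P Q PA QA that
      show ?thesis by (metis pneg.simps(2))
    next
      case True
      have nm: "n = m" using ratdeg_unique d True by blast
      have "y1 = y2 \<or> y1 = - y2"
        by (rule same_x[OF c0, of _ x1 ka kb]) (use P Q PA QA True in auto)
      then show ?thesis
      proof
        assume y: "y1 = y2"
        then have "P = Q" using PA QA True by simp
        then show ?thesis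
          using that[of "4 * n" 0] pdeg_double[of x1 y1 n] P PA d nm by simp
      next
        assume y: "y1 = - y2"
        then have QP: "Q = pneg P" using PA QA True by simp
        show ?thesis unfolding QP
          using that[of 0 "4 * n"] pdeg_double[of x1 y1 n] P PA d nm unfolding QP by simp
      qed
    qed
  qed
qed

end

section \<open>The invariant differential\<close>

text \<open>The quotient rule on an arbitrarily chosen representing pair;
  \<open>fderiv_Fract\<close> shows that the choice does not matter.\<close>

definition fderiv :: "'a::field poly fract \<Rightarrow> 'a poly fract" where
  "fderiv t = (case SOME z. snd z \<noteq> 0 \<and> t = Fract (fst z) (snd z) of
     (p, q) \<Rightarrow> Fract (pderiv p * q - p * pderiv q) (q * q))"

lemma fderiv_Fract:
  fixes p q :: "'a::field poly"
  assumes q: "q \<noteq> 0"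
  shows "fderiv (Fract p q) = Fract (pderiv p * q - p * pderiv q) (q * q)"
proof -
  define z where "z = (SOME z. snd z \<noteq> 0 \<and> Fract p q = Fract (fst z) (snd z))"
  have z: "snd z \<noteq> 0 \<and> Fract p q = Fract (fst z) (snd z)"
    unfolding z_def by (rule someI[of _ "(p, q)"]) (use q in simp)
  obtain p' q' where zz: "z = (p', q')" by (cases z)
  have h: "q' \<noteq> 0" "p * q' = p' * q" using z q by (auto simp: zz eq_fract)
  have d: "pderiv p * q' + p * pderiv q' = pderiv p' * q + p' * pderiv q"
    using arg_cong[OF h(2), of pderiv] by (simp add: pderiv_mult algebra_simps)
  have "(pderiv p * q - p * pderiv q) * (q' * q') - (pderiv p' * q' - p' * pderiv q') * (q * q) =
     q * q' * (pderiv p * q' + p * pderiv q' - (pderiv p' * q + p' * pderiv q))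
     - (pderiv q * q' + pderiv q' * q) * (p * q' - p' * q)"
    by Groebner_Basis.algebra
  then have "(pderiv p * q - p * pderiv q) * (q' * q') = (pderiv p' * q' - p' * pderiv q') * (q * q)"
    using d h by simp
  then show ?thesis using h q by (simp add: fderiv_def zz eq_fract flip: z_def)
qed

lemma fderiv_rf: "fderiv (rf p) = rf (pderiv p)"
  by (simp add: rf_def fderiv_Fract)

lemma fderiv_add: "fderiv (s + t) = fderiv s + fderiv t"
  by (cases s; cases t) (simp add: fderiv_Fract eq_fract pderiv_mult pderiv_add algebra_simps)

lemma fderiv_mult: "fderiv (s * t) = fderiv s * t + s * fderiv t"
  by (cases s; cases t) (simp add: fderiv_Fract eq_fract pderiv_mult pderiv_add algebra_simps)

text \<open>\<open>tangent d P k\<close> says that the invariant differential pulls back along \<open>P\<close> to \<open>k\<close> times itself.\<close>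

definition tangent :: "('k::field \<Rightarrow> 'k) \<Rightarrow> 'k point \<Rightarrow> 'k \<Rightarrow> bool" where
  "tangent d P k = (case P of Infty \<Rightarrow> k = 0 | Aff x y \<Rightarrow> d x = k * y)"

locale derivation_curve =
  fixes d :: "'k::field \<Rightarrow> 'k" and c a b :: 'k
  assumes d_add: "d (s + t) = d s + d t" and d_mult: "d (s * t) = d s * t + s * d t"
    and da: "d a = 0" and db: "d b = 0" and c0: "c \<noteq> 0" and two: "(2::'k) \<noteq> 0"
begin

lemma d_0 [simp]: "d 0 = 0" by (metis add.right_neutral add_left_cancel d_add)
lemma d_minus: "d (- t) = - d t"
  using d_add[of t "- t"] by (simp add: add_eq_0_iff)
lemma d_diff: "d (s - t) = d s - d t"
  using d_add[of s "- t"] by (simp add: d_minus)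
lemma d_power2: "d (t^2) = 2 * t * d t"
  by (simp add: power2_eq_square d_mult algebra_simps)
lemma d_power3: "d (t^3) = 3 * t^2 * d t"
proof -
  have "t^3 = t * t^2" by Groebner_Basis.algebra
  then have "d (t^3) = d t * t^2 + t * (2 * t * d t)"
    by (simp only: d_mult d_power2)
  then show ?thesis by Groebner_Basis.algebra
qed

lemma tangent_pneg: "tangent d P k \<Longrightarrow> tangent d (pneg P) (- k)"
  by (cases P) (auto simp: tangent_def)

lemma d_y:
  assumes P: "c * y^2 = x^3 + a * x + b" and t: "d x = k * y" and y: "y \<noteq> 0"
  shows "2 * c * d y = (3 * x^2 + a) * k - d c * y"
proof -
  have "d (c * y^2) = d (x^3 + a * x + b)" using P by simp
  then have "d c * y^2 + c * (2 * y * d y) = 3 * x^2 * (k * y) + a * (k * y)"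
    by (simp add: d_mult d_add d_power2 d_power3 da db t)
  moreover have "y * (2 * c * d y) - y * ((3 * x^2 + a) * k - d c * y) =
      (d c * y^2 + c * (2 * y * d y)) - (3 * x^2 * (k * y) + a * (k * y))"
    by Groebner_Basis.algebra
  ultimately have "y * (2 * c * d y) = y * ((3 * x^2 + a) * k - d c * y)" by simp
  then show ?thesis using y by simp
qed

text \<open>Differentiating the curve equations (\<open>d_y\<close>) and the relation that defines
  the slope expresses \<open>d x3\<close> through \<open>k1\<close>, \<open>k2\<close> and the
  coordinates; the terms with \<open>d c\<close> cancel. The ordinates are assumed nonzero because
  \<open>d_y\<close> divides by them.\<close>

lemma tangent_padd:
  assumes P: "on_curve c a b P" and Q: "on_curve c a b Q"
    and t1: "tangent d P k1" and t2: "tangent d Q k2"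
    and nz: "\<And>x. P \<noteq> Aff x 0" "\<And>x. Q \<noteq> Aff x 0"
  shows "tangent d (padd c a P Q) (k1 + k2)"
proof (cases P; cases Q)
  fix x1 y1 x2 y2 assume PQ: "P = Aff x1 y1" "Q = Aff x2 y2"
  have e: "c * y1^2 = x1^3 + a * x1 + b" "c * y2^2 = x2^3 + a * x2 + b" "y1 \<noteq> 0" "y2 \<noteq> 0"
    using P Q nz PQ by auto
  have dx: "d x1 = k1 * y1" "d x2 = k2 * y2" using t1 t2 PQ by (auto simp: tangent_def)
  note dy = d_y[OF e(1) dx(1) e(3)] d_y[OF e(2) dx(2) e(4)]
  show ?thesis
  proof (cases "x1 = x2 \<and> y1 = - y2")
    case True
    then have "k2 * y2 = - k1 * y2" using dx by simp
    then have "k2 = - k1" using e(4) by (simp only: mult_cancel_right) simp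
    then show ?thesis using True PQ by (simp add: tangent_def)
  next
    case False
    define l where "l = slope c a x1 y1 x2 y2"
    define k where "k = y1 - l * x1"
    define x3 where "x3 = c * l^2 - x1 - x2"
    note line = slope_line[OF c0 two e(1,2) False, folded l_def, folded k_def, folded x3_def]
    have y1: "y1 = l * x1 + k" by (simp add: k_def)
    have cl: "c * l^2 = x1 + x2 + x3" by (simp add: x3_def)
    have dx3: "d x3 = d c * l^2 + l * (2 * c * d l) - d x1 - d x2"
      unfolding x3_def d_diff d_mult d_power2 by Groebner_Basis.algebra
    have goal: "d x3 = (k1 + k2) * (l * (x1 - x3) - y1)"
    proof (cases "x1 = x2")
      case True
      have yy: "y2 = y1" using line(1) True y1 by simp
      have "k2 * y1 = d x2" by (simp only: dx(2) yy)
      also have "\<dots> = k1 * y1" by (simp only: True[symmetric] dx(1))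
      finally have "k2 * y1 = k1 * y1" .
      then have kk: "k2 = k1" using e by simp
      have L: "2 * c * y1 * l = 3 * x1^2 + a" by (rule line(3)[OF True])
      have "y1 * (2 * c * l) = 3 * x1^2 + a" unfolding L[symmetric] by (simp only: mult_ac)
      then have "d (y1 * (2 * c * l)) = d (3 * x1^2 + a)" by (rule arg_cong)
      also have "d (3 * x1^2 + a) = 6 * x1 * d x1"
      proof -
        have "3 * x1^2 + a = x1^2 + x1^2 + x1^2 + a" by Groebner_Basis.algebra
        then have "d (3 * x1^2 + a) = 2 * x1 * d x1 + 2 * x1 * d x1 + 2 * x1 * d x1"
          by (simp only: d_add d_power2 da add_0_right)
        also have "\<dots> = 6 * x1 * d x1" by Groebner_Basis.algebra
        finally show ?thesis .
      qed
      finally have h2: "d (y1 * (2 * c * l)) = 6 * x1 * d x1" .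
      have h1: "d (y1 * (2 * c * l)) = 2 * c * d y1 * l + y1 * (2 * d c * l + 2 * c * d l)"
      proof -
        have "d (2 * c) = 2 * d c" by (simp only: mult_2 d_add)
        have "d (y1 * (2 * c * l)) = d y1 * (2 * c * l) + y1 * d (2 * c * l)" by (rule d_mult)
        also have "d (2 * c * l) = d (2 * c) * l + 2 * c * d l" by (rule d_mult)
        also have "d (2 * c) = 2 * d c" by fact
        finally have "d (y1 * (2 * c * l)) = d y1 * (2 * c * l) + y1 * (2 * d c * l + 2 * c * d l)" .
        then show ?thesis by (simp only: mult_ac)
      qed
      have h: "2 * c * d y1 * l + y1 * (2 * d c * l + 2 * c * d l) = 6 * x1 * d x1"
        using h1 h2 by (rule trans[OF sym])
      have "y1 * (2 * c * d l) - y1 * (6 * x1 * k1 - l * d c - 2 * c * l^2 * k1) =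
        (((2 * c * y1 * l) * k1 - d c * y1) * l + y1 * (2 * d c * l + 2 * c * d l)) - 6 * x1 * (k1 * y1)"
        by Groebner_Basis.algebra
      also have "\<dots> = 0" using h[unfolded dy(1) dx(1) L[symmetric]] by simp
      finally have "y1 * (2 * c * d l) = y1 * (6 * x1 * k1 - l * d c - 2 * c * l^2 * k1)" by simp
      then have dl: "2 * c * d l = 6 * x1 * k1 - l * d c - 2 * c * l^2 * k1" using e by simp
      show ?thesis unfolding dx3 dl dx yy kk unfolding x3_def True[symmetric] by Groebner_Basis.algebra
    next
      case False
      define u where "u = x2 - x1"
      have u0: "u \<noteq> 0" using False by (simp add: u_def)
      have lu: "l * u = y2 - y1" using False by (simp add: l_def slope_def u_def)
      have "d (l * u) = d (y2 - y1)" using lu by simp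
      then have "d l * u + l * (d x2 - d x1) = d y2 - d y1"
        by (simp add: d_mult d_diff u_def)
      then have "d l * u = d y2 - d y1 - l * (d x2 - d x1)"
        by (simp only: eq_diff_eq)
      then have dl: "u * (2 * c * d l) = 2 * c * d y2 - 2 * c * d y1 - 2 * c * l * (d x2 - d x1)"
      proof -
        have "u * (2 * c * d l) = 2 * c * (d l * u)" by (simp only: mult_ac)
        also have "\<dots> = 2 * c * (d y2 - d y1 - l * (d x2 - d x1))"
          by (simp only: \<open>d l * u = d y2 - d y1 - l * (d x2 - d x1)\<close>)
        finally show ?thesis by (simp only: right_diff_distrib mult.assoc)
      qed
      \<comment> \<open>\<open>f1\<close> and \<open>f2\<close> are the derivatives, at the roots
        \<open>x1\<close> and \<open>x2\<close>, of the factorisation in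
        \<open>slope_line\<close>.\<close>
      have f1: "3 * x1^2 + a = 2 * c * l * y1 + (x1 - x2) * (x1 - x3)"
      proof -
        have "3 * x1^2 + a - 2 * c * l * (l * x1 + k) =
          3 * x1^2 + (a - 2 * c * l * k) - 2 * (c * l^2) * x1" by Groebner_Basis.algebra
        also have "\<dots> = (x1 - x2) * (x1 - x3)" unfolding line(4) cl by Groebner_Basis.algebra
        finally show ?thesis unfolding y1[symmetric] by (simp only: diff_eq_eq add.commute)
      qed
      have f2: "3 * x2^2 + a = 2 * c * l * y2 + (x2 - x1) * (x2 - x3)"
      proof -
        have "3 * x2^2 + a - 2 * c * l * (l * x2 + k) =
          3 * x2^2 + (a - 2 * c * l * k) - 2 * (c * l^2) * x2" by Groebner_Basis.algebra
        also have "\<dots> = (x2 - x1) * (x2 - x3)" unfolding line(4) cl by Groebner_Basis.algebra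
        finally show ?thesis unfolding line(1)[symmetric] by (simp only: diff_eq_eq add.commute)
      qed
      have y2: "y2 = y1 + l * u" using lu by simp
      have "u * d x3 = u * (d c * l^2) + l * (u * (2 * c * d l)) - u * (d x1 + d x2)"
        unfolding dx3 by Groebner_Basis.algebra
      also have "\<dots> = u * ((k1 + k2) * (l * (x1 - x3) - y1))"
        unfolding dl dy dx f1 f2 unfolding y2 u_def by Groebner_Basis.algebra
      finally show ?thesis using u0 by simp
    qed
    have "padd c a P Q = Aff x3 (l * (x1 - x3) - y1)"
      unfolding PQ using False by (auto simp: Let_def l_def x3_def)
    then show ?thesis using goal by (simp add: tangent_def)
  qed
qed (use t1 t2 in \<open>auto simp: tangent_def\<close>)

end

section \<open>The degree as a quadratic form\<close>

lemma second_difference: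
  fixes r :: "int \<Rightarrow> int"
  assumes "\<And>k. r (k + 1) + r (k - 1) = 2 * r k + 2 * g"
  shows "r k = r 0 + (r 1 - r 0 - g) * k + g * k^2"
proof -
  define f where "f = (\<lambda>k. r 0 + (r 1 - r 0 - g) * k + g * k^2)"
  have f: "f (k + 1) + f (k - 1) = 2 * f k + 2 * g" for k
    by (simp add: f_def algebra_simps power2_eq_square)
  have f01: "f 0 = r 0" "f 1 = r 1" by (simp_all add: f_def)
  have up: "r (int n) = f (int n) \<and> r (int n + 1) = f (int n + 1)" for n
  proof (induction n)
    case (Suc n)
    have "int (Suc n) = int n + 1" by simp
    then show ?case using Suc assms[of "int n + 1"] f[of "int n + 1"] by (simp add: algebra_simps)
  qed (simp add: f01)
  have down: "r (- int n) = f (- int n) \<and> r (- int n + 1) = f (- int n + 1)" for n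
  proof (induction n)
    case (Suc n)
    have e: "- int (Suc n) = - int n - 1" "- int n - 1 + 1 = - int n" by simp_all
    show ?case unfolding e using Suc assms[of "- int n"] f[of "- int n"] by linarith
  qed (simp add: f01)
  have "r k = f k"
  proof (cases "k \<ge> 0")
    case True
    then show ?thesis using up[of "nat k"] by simp
  next
    case False
    then show ?thesis using down[of "nat (- k)"] by simp
  qed
  then show ?thesis by (simp add: f_def)
qed

text \<open>The parallelogram law fixes the second differences in both directions, so the values at
  \<open>(1, 0)\<close>, \<open>(0, 1)\<close> and \<open>(1, 1)\<close> determine
  everything.\<close>

lemma quadratic_form:
  fixes q :: "int \<Rightarrow> int \<Rightarrow> int"
  assumes A: "\<And>m n. q (m + 1) n + q (m - 1) n = 2 * q m n + 2 * g"
    and B: "\<And>m n. q m (n + 1) + q m (n - 1) = 2 * q m n + 2 * h"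
    and "q 0 0 = 0" "q 1 0 = g" "q 0 1 = h"
  shows "q m n = g * m^2 + h * n^2 + (q 1 1 - g - h) * m * n"
proof -
  have "q m n = q m 0 + (q m 1 - q m 0 - h) * n + h * n^2"
    by (rule second_difference) (rule B)
  moreover have "q m 0 = q 0 0 + (q 1 0 - q 0 0 - g) * m + g * m^2"
    by (rule second_difference[of "\<lambda>m. q m 0"]) (rule A)
  moreover have "q m 1 = q 0 1 + (q 1 1 - q 0 1 - g) * m + g * m^2"
    by (rule second_difference[of "\<lambda>m. q m 1"]) (rule A)
  ultimately show ?thesis using assms(3-) by (simp add: algebra_simps)
qed

context const_curve
begin

text \<open>The points that have a degree are the endomorphisms of the curve; as a group record they
  acquire integer multiples \<open>[^]\<close>.\<close>

definition grp :: "'a poly fract point monoid" where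
  "grp = \<lparr>carrier = {P. onc P \<and> (\<exists>n. pdeg P n)}, monoid.mult = (\<lambda>P Q. P \<oplus>\<oplus> Q), one = Infty\<rparr>"

definition deg_pt :: "'a poly fract point \<Rightarrow> nat" where
  "deg_pt P = (THE n. pdeg P n)"

lemma deg_ptI: "pdeg P n \<Longrightarrow> deg_pt P = n"
  unfolding deg_pt_def by (rule the_equality) (auto intro: pdeg_unique)

lemma grp_simps [simp]: "P \<in> carrier grp \<longleftrightarrow> onc P \<and> (\<exists>n. pdeg P n)"
    "P \<otimes>\<^bsub>grp\<^esub> Q = P \<oplus>\<oplus> Q" "\<one>\<^bsub>grp\<^esub> = Infty"
  by (auto simp: grp_def)

lemma pdeg_deg_pt: "P \<in> carrier grp \<Longrightarrow> pdeg P (deg_pt P)"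
  using deg_ptI by (metis grp_simps(1))

sublocale comm_group grp
proof (rule comm_groupI)
  fix P Q assume PQ: "P \<in> carrier grp" "Q \<in> carrier grp"
  obtain r s where "pdeg (P \<oplus>\<oplus> Q) r"
    using parallelogram[OF _ _ pdeg_deg_pt[OF PQ(1)] pdeg_deg_pt[OF PQ(2)]] PQ by auto
  then show "P \<otimes>\<^bsub>grp\<^esub> Q \<in> carrier grp" using PQ onc_add by auto
next
  fix P assume "P \<in> carrier grp"
  then show "\<exists>Q\<in>carrier grp. Q \<otimes>\<^bsub>grp\<^esub> P = \<one>\<^bsub>grp\<^esub>"
    by (intro bexI[of _ "pneg P"]) auto
next
  fix P Q R assume "P \<in> carrier grp" "Q \<in> carrier grp" "R \<in> carrier grp"
  then show "(P \<otimes>\<^bsub>grp\<^esub> Q) \<otimes>\<^bsub>grp\<^esub> R = P \<otimes>\<^bsub>grp\<^esub> (Q \<otimes>\<^bsub>grp\<^esub> R)"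
    by (simp add: assoc)
next
  fix P Q assume "P \<in> carrier grp" "Q \<in> carrier grp"
  then show "P \<otimes>\<^bsub>grp\<^esub> Q = Q \<otimes>\<^bsub>grp\<^esub> P"
    using commute by simp
qed auto

lemma inv_grp: "P \<in> carrier grp \<Longrightarrow> inv\<^bsub>grp\<^esub> P = pneg P"
  by (intro inv_equality) auto

lemma deg_parallelogram:
  assumes P: "P \<in> carrier grp" and Q: "Q \<in> carrier grp"
  shows "deg_pt (P \<otimes>\<^bsub>grp\<^esub> Q) + deg_pt (P \<otimes>\<^bsub>grp\<^esub> inv\<^bsub>grp\<^esub> Q) = 2 * deg_pt P + 2 * deg_pt Q"
proof -
  obtain r s where "pdeg (P \<oplus>\<oplus> Q) r" "pdeg (P \<oplus>\<oplus> pneg Q) s" "r + s = 2 * deg_pt P + 2 * deg_pt Q"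
    using parallelogram[OF _ _ pdeg_deg_pt[OF P] pdeg_deg_pt[OF Q]] P Q by auto
  then show ?thesis using deg_ptI by (simp add: inv_grp[OF Q])
qed

lemma deg_Infty [simp]: "deg_pt Infty = 0"
  by (rule deg_ptI) simp

lemma deg_lattice:
  fixes m n :: int
  assumes P: "P \<in> carrier grp" and Q: "Q \<in> carrier grp"
  shows "int (deg_pt (P [^]\<^bsub>grp\<^esub> m \<otimes>\<^bsub>grp\<^esub> Q [^]\<^bsub>grp\<^esub> n)) =
    deg_pt P * m^2 + deg_pt Q * n^2 + (int (deg_pt (P \<otimes>\<^bsub>grp\<^esub> Q)) - deg_pt P - deg_pt Q) * m * n"
proof -
  note grp_simps [simp del]
  let ?L = "\<lambda>(m::int) (n::int). P [^]\<^bsub>grp\<^esub> m \<otimes>\<^bsub>grp\<^esub> Q [^]\<^bsub>grp\<^esub> n"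
  have L: "?L m n \<in> carrier grp" for m n by (intro m_closed int_pow_closed P Q)
  have 1: "?L (m + 1) n = ?L m n \<otimes>\<^bsub>grp\<^esub> P" "?L m (n + 1) = ?L m n \<otimes>\<^bsub>grp\<^esub> Q" for m n
    using P Q by (simp_all add: int_pow_mult m_ac)
  have 2: "?L (m - 1) n = ?L m n \<otimes>\<^bsub>grp\<^esub> inv\<^bsub>grp\<^esub> P" "?L m (n - 1) = ?L m n \<otimes>\<^bsub>grp\<^esub> inv\<^bsub>grp\<^esub> Q" for m n
    by (rule iffD2[OF inv_solve_right[OF L L]], rule P Q, use 1(1)[of "m - 1" n] 1(2)[of m "n - 1"] in simp)+
  have "int (deg_pt (?L m n)) = int (deg_pt P) * m^2 + int (deg_pt Q) * n^2 +
     (int (deg_pt (?L 1 1)) - int (deg_pt P) - int (deg_pt Q)) * m * n"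
  proof (rule quadratic_form[of "\<lambda>m n. int (deg_pt (?L m n))"])
    show "int (deg_pt (?L (m + 1) n)) + int (deg_pt (?L (m - 1) n)) =
      2 * int (deg_pt (?L m n)) + 2 * int (deg_pt P)" for m n
      unfolding 1 2 using deg_parallelogram[OF L[of m n] P] by linarith
    show "int (deg_pt (?L m (n + 1))) + int (deg_pt (?L m (n - 1))) =
      2 * int (deg_pt (?L m n)) + 2 * int (deg_pt Q)" for m n
      unfolding 1 2 using deg_parallelogram[OF L[of m n] Q] by linarith
    have "deg_pt \<one>\<^bsub>grp\<^esub> = 0" by (simp add: grp_simps)
    then show "int (deg_pt (?L 0 0)) = 0" by simp
  qed (use P Q in simp_all)
  then show ?thesis using P Q by simp
qed

lemma carrier_y_nonzero: "P \<in> carrier grp \<Longrightarrow> P \<noteq> Aff x 0"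
  using ratdeg_y_nonzero[of _ 0] by (auto simp: pdeg_def)

lemma derivation_curve_fderiv: "derivation_curve fderiv c ka kb"
  by unfold_locales (simp_all add: fderiv_add fderiv_mult fderiv_rf c0 two' pderiv_pCons)

lemma tangent_mult:
  assumes "P \<in> carrier grp" "Q \<in> carrier grp" "tangent fderiv P k" "tangent fderiv Q l"
  shows "tangent fderiv (P \<otimes>\<^bsub>grp\<^esub> Q) (k + l)"
proof -
  interpret D: derivation_curve fderiv c ka kb by (rule derivation_curve_fderiv)
  show ?thesis using D.tangent_padd[OF _ _ assms(3,4)] assms(1,2) carrier_y_nonzero by auto
qed

lemma tangent_int_pow:
  assumes P: "P \<in> carrier grp" and t: "tangent fderiv P k"
  shows "tangent fderiv (P [^]\<^bsub>grp\<^esub> (n::int)) (of_int n * k)"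
proof -
  interpret D: derivation_curve fderiv c ka kb by (rule derivation_curve_fderiv)
  note grp_simps [simp del]
  have nat: "tangent fderiv (P [^]\<^bsub>grp\<^esub> (int j)) (of_nat j * k)" for j
  proof (induction j)
    case 0
    then show ?case by (simp add: grp_simps tangent_def)
  next
    case (Suc j)
    have "int (Suc j) = int j + 1" by simp
    then have "P [^]\<^bsub>grp\<^esub> int (Suc j) = P [^]\<^bsub>grp\<^esub> int j \<otimes>\<^bsub>grp\<^esub> P"
      using P by (simp only: int_pow_mult int_pow_1)
    then show ?case using tangent_mult[OF _ P Suc t] P by (simp add: algebra_simps)
  qed
  show ?thesis
  proof (cases "n \<ge> 0")
    case True
    then show ?thesis using nat[of "nat n"] by simp
  next
    case False
    have "P [^]\<^bsub>grp\<^esub> n = inv\<^bsub>grp\<^esub> (P [^]\<^bsub>grp\<^esub> (- n))" using P by (simp add: int_pow_neg)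
    also have "\<dots> = pneg (P [^]\<^bsub>grp\<^esub> (- n))" using P by (intro inv_grp) simp
    finally show ?thesis using D.tangent_pneg[OF nat[of "nat (- n)"]] False by simp
  qed
qed

end

section \<open>Polynomials in positive characteristic\<close>

lemma dvd_mult_no_common_root:
  fixes p q r :: "'a::alg_closed_field poly"
  assumes "\<And>z. \<not> (poly p z = 0 \<and> poly q z = 0)" "q dvd p * r"
  shows "q dvd r"
  using assms
proof (induction "degree q" arbitrary: q r rule: less_induct)
  case less
  show ?case
  proof (cases "degree q = 0")
    case True
    then obtain q0 where q0: "q = [:q0:]" by (meson degree_eq_zeroE)
    show ?thesis
    proof (cases "q0 = 0")
      case True
      then have "degree p = 0"
        using less.prems(1) alg_closed_imp_poly_has_root[of p] q0 by auto
      then obtain p0 where p0: "p = [:p0:]" by (meson degree_eq_zeroE)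
      have "p0 \<noteq> 0" using less.prems(1) q0 True p0 by auto
      then show ?thesis using less.prems(2) q0 True p0 by simp
    next
      case False
      then show ?thesis using q0 by (simp add: dvd_field_iff is_unit_const_poly_iff unit_imp_dvd)
    qed
  next
    case False
    then obtain z where z: "poly q z = 0" using alg_closed_imp_poly_has_root by blast
    obtain k where k: "p * r = q * k" using less.prems(2) by (rule dvdE)
    have "poly p z * poly r z = 0" using z arg_cong[OF k, of "\<lambda>t. poly t z"] by simp
    then have "poly r z = 0" using less.prems(1) z by auto
    then obtain q' r' where qr: "q = [:- z, 1:] * q'" "r = [:- z, 1:] * r'"
      using z by (meson poly_eq_0_iff_dvd dvdE)
    have "q' \<noteq> 0" using False qr by auto
    then have d: "degree q = Suc (degree q')" unfolding qr by (subst degree_mult_eq) auto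
    have "[:- z, 1:] * (p * r') = [:- z, 1:] * (q' * k)"
      using k unfolding qr by (simp only: mult_ac)
    moreover have "[:- z, 1:] \<noteq> 0" by simp
    ultimately have "p * r' = q' * k" using mult_left_cancel by blast
    then have "q' dvd r'" using less.hyps[of q' r'] d less.prems(1) qr by auto
    then show ?thesis unfolding qr by (rule mult_dvd_mono[OF dvd_refl])
  qed
qed

lemma prod_linear_powers_dvd:
  fixes h :: "'a::alg_closed_field poly"
  assumes "finite A" "\<And>z. z \<in> A \<Longrightarrow> [:- z, 1:] ^ e z dvd h"
  shows "(\<Prod>z\<in>A. [:- z, 1:] ^ e z) dvd h"
  using assms
proof (induction A rule: finite_induct)
  case (insert z A)
  obtain k where k: "h = [:- z, 1:] ^ e z * k" using insert.prems[of z] by (auto elim: dvdE)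
  have "(\<Prod>z\<in>A. [:- z, 1:] ^ e z) dvd k"
  proof (rule dvd_mult_no_common_root)
    show "\<not> (poly ([:- z, 1:] ^ e z) w = 0 \<and> poly (\<Prod>z\<in>A. [:- z, 1:] ^ e z) w = 0)" for w
      using insert.hyps by (auto simp: poly_prod)
    show "(\<Prod>z\<in>A. [:- z, 1:] ^ e z) dvd [:- z, 1:] ^ e z * k"
      using insert unfolding k by auto
  qed
  then show ?case unfolding k prod.insert[OF insert.hyps] by (rule mult_dvd_mono[OF dvd_refl])
qed simp

lemma separable_dvd_power2:
  fixes q r :: "'a::alg_closed_field poly"
  assumes "\<And>z. poly q z = 0 \<Longrightarrow> poly (pderiv q) z \<noteq> 0" "q dvd r^2"
  shows "q dvd r"
  using assms
proof (induction "degree q" arbitrary: q r rule: less_induct)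
  case less
  show ?case
  proof (cases "degree q = 0")
    case True
    then obtain q0 where q0: "q = [:q0:]" by (meson degree_eq_zeroE)
    have "q0 \<noteq> 0" using less.prems(1)[of 0] q0 by auto
    then show ?thesis using q0 by (simp add: dvd_field_iff is_unit_const_poly_iff unit_imp_dvd)
  next
    case False
    then obtain z where z: "poly q z = 0" using alg_closed_imp_poly_has_root by blast
    then have "poly (r^2) z = 0" using less.prems(2) by (metis dvd_trans poly_eq_0_iff_dvd)
    then have "poly r z = 0" by simp
    then obtain q' r' where qr: "q = [:- z, 1:] * q'" "r = [:- z, 1:] * r'"
      using z by (meson poly_eq_0_iff_dvd dvdE)
    have "q' \<noteq> 0" using False qr by auto
    then have d: "degree q = Suc (degree q')" unfolding qr by (subst degree_mult_eq) auto
    have pd: "pderiv q = q' + [:- z, 1:] * pderiv q'"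
      unfolding qr pderiv_mult by (simp add: pderiv_pCons)
    have z': "poly q' z \<noteq> 0" using less.prems(1)[OF z] by (auto simp: pd)
    have "[:- z, 1:] * q' dvd [:- z, 1:] * ([:- z, 1:] * r'^2)"
      using less.prems(2) unfolding qr by (simp only: power2_eq_square mult_ac)
    then have "q' dvd [:- z, 1:] * r'^2" by (subst (asm) dvd_times_left_cancel_iff) auto
    then have "q' dvd r'^2"
      by (rule dvd_mult_no_common_root[rotated]) (use z' in auto)
    moreover have "poly (pderiv q') w \<noteq> 0" if "poly q' w = 0" for w
    proof
      assume h: "poly (pderiv q') w = 0"
      have "poly q w = 0" using that qr by simp
      then show False using less.prems(1)[of w] h that by (simp add: pd)
    qed
    ultimately have "q' dvd r'" using less.hyps[of q' r'] d by auto
    then show ?thesis unfolding qr by (rule mult_dvd_mono[OF dvd_refl])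
  qed
qed

locale char_field =
  fixes ty :: "'a::alg_closed_field itself" and p :: nat
  assumes char: "CHAR('a) = p" and prime: "prime p"
begin

lemma of_nat_0_iff: "of_nat n = (0::'a) \<longleftrightarrow> p dvd n"
  by (simp add: of_nat_eq_0_iff_char_dvd char)

lemma of_nat_nz: "0 < n \<Longrightarrow> n < p \<Longrightarrow> of_nat n \<noteq> (0::'a)"
  by (simp add: of_nat_0_iff nat_dvd_not_less)

lemma of_nat_power_p: "(of_nat n :: 'a) ^ p = of_nat n"
proof (induction n)
  case 0
  then show ?case using prime prime_gt_0_nat[of p] by (simp add: power_0_left)
next
  case (Suc n)
  have "(1 + of_nat n :: 'a) ^ p = 1 ^ p + of_nat n ^ p"
    by (rule freshmans_dream) (simp_all add: char prime)
  then show ?case using Suc by simp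
qed

lemma poly_freshman: "(u + v :: 'a poly) ^ p = u ^ p + v ^ p"
  by (rule freshmans_dream) (simp_all add: char prime)

definition Fp :: "'a set" where "Fp = of_nat ` {..<p}"

lemma inj_Fp: "inj_on (of_nat :: nat \<Rightarrow> 'a) {..<p}"
  by (auto simp: inj_on_def of_nat_eq_iff_cong_CHAR char cong_def)

lemma card_Fp: "card Fp = p" by (simp add: Fp_def card_image inj_Fp)
lemma finite_Fp [simp]: "finite Fp" by (simp add: Fp_def)
lemma Fp_power: "z \<in> Fp \<Longrightarrow> z ^ p = z" by (auto simp: Fp_def of_nat_power_p)
lemma of_int_Fp: "of_int k \<in> Fp"
proof -
  have p0: "0 < p" using prime prime_gt_0_nat by blast
  have "(of_int k :: 'a) = of_int (k mod int CHAR('a))" by simp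
  also have "\<dots> = of_nat (nat (k mod int p))" using p0 by (simp add: char)
  finally have "of_int k = (of_nat (nat (k mod int p)) :: 'a)" .
  moreover have "nat (k mod int p) < p" using p0 by (simp add: nat_less_iff)
  ultimately show ?thesis unfolding Fp_def by blast
qed

lemma of_int_power_p: "(of_int k :: 'a) ^ p = of_int k"
  by (rule Fp_power[OF of_int_Fp])

lemma sum_Fp: "sum g Fp = (\<Sum>n<p. g (of_nat n))"
  by (simp add: Fp_def sum.reindex[OF inj_Fp] o_def)

lemma Fp_power_pred: "z \<in> Fp \<Longrightarrow> z \<noteq> 0 \<Longrightarrow> z ^ (p - 1) = 1"
proof -
  assume z: "z \<in> Fp" "z \<noteq> 0"
  have "z * z ^ (p - 1) = z ^ p" using prime prime_gt_0_nat[of p]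
    by (metis power_eq_if not_gr0)
  then show ?thesis using Fp_power[OF z(1)] z(2) by simp
qed

definition frob :: "'a poly" where "frob = monom 1 p - [:0, 1:]"

lemma poly_frob: "poly frob z = z ^ p - z" by (simp add: frob_def poly_monom)

lemma frob_prod: "frob = (\<Prod>z\<in>Fp. [:- z, 1:])"
proof -
  let ?P = "\<Prod>z\<in>Fp. [:- z, 1:] ^ 1"
  have p1: "1 < p" using prime prime_gt_1_nat by blast
  have df: "degree frob = p" unfolding frob_def
    by (rule degree_diff_left) (use p1 in \<open>simp_all add: degree_monom_eq\<close>)
  have "?P dvd frob"
    by (rule prod_linear_powers_dvd)
       (auto simp: poly_frob Fp_power simp flip: poly_eq_0_iff_dvd)
  then obtain k where k: "frob = ?P * k" by (rule dvdE)
  have dP: "degree ?P = p" by (subst degree_prod_eq_sum_degree) (auto simp: card_Fp)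
  have "frob \<noteq> 0" using df p1 by auto
  then have "k \<noteq> 0" "?P \<noteq> 0" using k by auto
  then have "degree k = 0" using df dP k by (metis add_cancel_left_right degree_mult_eq)
  then obtain k0 where k0: "k = [:k0:]" by (meson degree_eq_zeroE)
  have "lead_coeff frob = 1" unfolding df using p1 by (simp add: frob_def coeff_pCons split: nat.split)
  moreover have "lead_coeff ?P = 1" by (simp add: lead_coeff_prod)
  moreover have "lead_coeff frob = lead_coeff ?P * lead_coeff k" by (simp only: k lead_coeff_mult)
  ultimately have "k0 = 1" by (simp add: k0)
  then show ?thesis using k k0 by simp
qed

text \<open>The differences of consecutive powers with exponent \<open>Suc j\<close> telescope to
  zero over \<open>Fp\<close>. Expanded binomially they give \<open>Suc j\<close>, a unit, times
  this power sum, plus power sums of smaller exponent.\<close>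

lemma power_sum_small: "j < p - 1 \<Longrightarrow> (\<Sum>z\<in>Fp. z ^ j) = 0"
proof (induction j rule: less_induct)
  case (less j)
  have "(\<Sum>n<p. (of_nat (Suc n) ^ Suc j - of_nat n ^ Suc j :: 'a)) = of_nat p ^ Suc j - of_nat 0 ^ Suc j"
    by (rule sum_lessThan_telescope)
  also have "\<dots> = 0" using char by (simp flip: char)
  finally have 0: "(\<Sum>n<p. (of_nat (Suc n) ^ Suc j - of_nat n ^ Suc j :: 'a)) = 0" .
  have "(of_nat (Suc n) ^ Suc j - of_nat n ^ Suc j :: 'a) = (\<Sum>i\<le>j. of_nat (Suc j choose i) * of_nat n ^ i)" for n
  proof -
    have "(of_nat n + 1 :: 'a) ^ Suc j = (\<Sum>i\<le>Suc j. of_nat (Suc j choose i) * of_nat n ^ i * 1 ^ (Suc j - i))"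
      by (rule binomial_ring)
    then show ?thesis by (simp add: add.commute)
  qed
  then have "(\<Sum>n<p. (of_nat (Suc n) ^ Suc j - of_nat n ^ Suc j :: 'a)) =
      (\<Sum>n<p. \<Sum>i\<le>j. of_nat (Suc j choose i) * of_nat n ^ i)" by simp
  also have "\<dots> = (\<Sum>i\<le>j. of_nat (Suc j choose i) * (\<Sum>z\<in>Fp. z ^ i))"
    by (subst sum.swap) (simp add: sum_Fp sum_distrib_left)
  also have "\<dots> = (\<Sum>i\<in>{j}. of_nat (Suc j choose i) * (\<Sum>z\<in>Fp. z ^ i))"
    by (rule sum.mono_neutral_right) (use less in auto)
  also have "\<dots> = of_nat (Suc j) * (\<Sum>z\<in>Fp. z ^ j)" by simp
  finally have "of_nat (Suc j) * (\<Sum>z\<in>Fp. z ^ j) = 0" using 0 by simp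
  moreover have "of_nat (Suc j) \<noteq> (0::'a)" by (rule of_nat_nz) (use less in auto)
  ultimately show ?case by (metis mult_eq_0_iff)
qed

text \<open>Among the exponents below \<open>2 * (p - 1)\<close> only \<open>p - 1\<close> has a
  nonzero power sum: it counts the nonzero elements and so equals \<open>- 1\<close>.\<close>

lemma sum_poly_Fp:
  assumes "degree g < 2 * (p - 1)"
  shows "(\<Sum>z\<in>Fp. poly g z) = - coeff g (p - 1)"
proof -
  have p1: "1 < p" using prime prime_gt_1_nat by blast
  have S: "(\<Sum>z\<in>Fp. z ^ j) = (if j = p - 1 then - 1 else 0)" if j: "j < 2 * (p - 1)" for j
  proof (cases "j < p - 1")
    case True
    then show ?thesis using power_sum_small by simp
  next
    case False
    have z0: "0 \<in> Fp" using p1 by (auto simp: Fp_def intro!: image_eqI[of _ _ 0])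
    have c: "(\<Sum>z\<in>Fp. z ^ j) = (\<Sum>z\<in>Fp - {0}. z ^ (j - (p - 1)))"
    proof -
      have "(\<Sum>z\<in>Fp. z ^ j) = (\<Sum>z\<in>Fp - {0}. z ^ j)"
        by (rule sum.mono_neutral_right) (use False p1 in \<open>auto simp: power_0_left\<close>)
      also have "\<dots> = (\<Sum>z\<in>Fp - {0}. z ^ (j - (p - 1)))"
      proof (rule sum.cong)
        fix z assume z: "z \<in> Fp - {0}"
        have "z ^ j = z ^ (p - 1) * z ^ (j - (p - 1))"
          using False by (simp flip: power_add)
        then show "z ^ j = z ^ (j - (p - 1))" using z Fp_power_pred[of z] by simp
      qed simp
      finally show ?thesis .
    qed
    show ?thesis
    proof (cases "j = p - 1")
      case True
      have "of_nat (p - 1) = (of_nat p - 1 :: 'a)" using p1 by (simp add: of_nat_diff)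
      also have "\<dots> = - 1" using char by (simp flip: char)
      finally show ?thesis using True c z0 by (simp add: card_Fp)
    next
      case ne: False
      have "(\<Sum>z\<in>Fp - {0}. z ^ (j - (p - 1))) = (\<Sum>z\<in>Fp. z ^ (j - (p - 1)))"
        by (rule sum.mono_neutral_left) (use False ne in \<open>auto simp: power_0_left\<close>)
      also have "\<dots> = 0" by (rule power_sum_small) (use j False in linarith)
      finally show ?thesis using c ne by simp
    qed
  qed
  have "(\<Sum>z\<in>Fp. poly g z) = (\<Sum>j\<le>degree g. coeff g j * (\<Sum>z\<in>Fp. z ^ j))"
    unfolding poly_altdef by (subst sum.swap) (simp add: sum_distrib_left)
  also have "\<dots> = (\<Sum>j\<le>degree g. coeff g j * (if j = p - 1 then - 1 else 0))"
    using S assms by (intro sum.cong) auto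
  also have "\<dots> = (\<Sum>j\<in>{..degree g} \<inter> {p - 1}. - coeff g j)"
    by (simp add: sum.inter_restrict if_distrib cong: if_cong)
  also have "\<dots> = - coeff g (p - 1)"
    by (cases "p - 1 \<le> degree g") (simp_all add: Int_insert_right coeff_eq_0)
  finally show ?thesis .
qed

text \<open>In lowest terms a zero derivative makes \<open>Q\<close> divide its own derivative, so
  the derivatives of \<open>Q\<close> and then of \<open>P\<close> vanish and only exponents
  divisible by \<open>p\<close> survive. Degree \<open>p\<close> with a pole at infinity leaves a
  linear polynomial in the \<open>p\<close>-th power.\<close>

lemma inseparable_degree_p:
  assumes d: "fderiv t = 0" and r: "ratdeg t p"
  obtains e0 e1 :: 'a where "t = rf ([:e0:] + monom e1 p)" "e1 \<noteq> 0"
proof -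
  from r obtain P Q where t: "t = rf P / rf Q" "Q \<noteq> 0" "degree P = p" "degree Q < p"
      and nc: "\<And>z. \<not> (poly P z = 0 \<and> poly Q z = 0)"
    unfolding ratdeg_def by auto
  have "Fract (pderiv P * Q - P * pderiv Q) (Q * Q) = 0"
    using d t fderiv_Fract[of Q P] by (simp add: Fract_eq_rf)
  then have "pderiv P * Q - P * pderiv Q = 0" using t(2) by (simp add: Zero_fract_def eq_fract)
  then have e: "P * pderiv Q = pderiv P * Q" by simp
  have "Q dvd pderiv Q"
    by (rule dvd_mult_no_common_root[OF nc]) (simp add: e)
  have dQ: "pderiv Q = 0"
  proof (rule ccontr)
    assume n: "pderiv Q \<noteq> 0"
    have "degree Q \<noteq> 0"
    proof
      assume "degree Q = 0"
      then obtain q where "Q = [:q:]" by (meson degree_eq_zeroE)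
      then show False using n by (simp add: pderiv_pCons)
    qed
    moreover have "degree Q \<le> degree (pderiv Q)" using dvd_imp_degree_le[OF \<open>Q dvd pderiv Q\<close> n] .
    ultimately show False using degree_pderiv_le[of Q] by linarith
  qed
  then have dP: "pderiv P = 0" using e t by simp
  have co: "coeff R k = 0" if "pderiv R = 0" "0 < k" "k < p" for R :: "'a poly" and k
  proof -
    have "of_nat k * coeff R k = 0" using that coeff_pderiv[of R "k - 1"] by simp
    then show ?thesis using of_nat_nz[OF that(2,3)] by simp
  qed
  define q0 where "q0 = coeff Q 0"
  have Q: "Q = [:q0:]"
  proof (rule poly_eqI)
    fix k show "coeff Q k = coeff [:q0:] k"
    proof (cases "k = 0")
      case False
      have "coeff Q k = 0"
        using co[OF dQ, of k] t(4) False by (cases "k < p") (auto intro: coeff_eq_0)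
      then show ?thesis using False by (simp add: coeff_pCons split: nat.split)
    qed (simp add: q0_def)
  qed
  have q0: "q0 \<noteq> 0" using t(2) Q by auto
  define e0 where "e0 = coeff P 0 / q0"
  define e1 where "e1 = coeff P p / q0"
  have pp: "0 < p" using prime prime_gt_0_nat by blast
  have P: "P = [:q0:] * ([:e0:] + monom e1 p)"
  proof (rule poly_eqI)
    fix k show "coeff P k = coeff ([:q0:] * ([:e0:] + monom e1 p)) k"
    proof (cases "0 < k \<and> k < p \<or> p < k")
      case True
      then have "coeff P k = 0" using co[OF dP, of k] t(3) by (auto simp: coeff_eq_0)
      then show ?thesis using True by (auto simp: coeff_pCons split: nat.split)
    next
      case False
      then consider "k = 0" | "k = p" by linarith
      then show ?thesis using q0 pp by cases (auto simp: e0_def e1_def coeff_pCons split: nat.split)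
    qed
  qed
  have "rf [:q0:] \<noteq> 0" using q0 by simp
  then have "t = rf ([:e0:] + monom e1 p)" unfolding t(1) Q P rf_mult by simp
  moreover have "e1 \<noteq> 0" using t(3) pp q0 by (auto simp: e1_def)
  ultimately show ?thesis using that by blast
qed

end

lemma rf_const:
  shows "rf [:1:] = 1" "rf [:numeral k:] = numeral k" "rf [:u - v:] = rf [:u:] - rf [:v:]"
    "rf [:u + v:] = rf [:u:] + rf [:v:]" "rf [:u * v:] = rf [:u:] * rf [:v:]"
    "rf [:- u:] = - rf [:u:]" "rf [:u ^ n:] = rf [:u:] ^ n"
proof -
  show "rf [:1:] = 1" by (simp flip: one_pCons)
  show "rf [:numeral k:] = numeral k" by (simp add: numeral_poly flip: rf_numeral)
  show "rf [:u ^ n:] = rf [:u:] ^ n" by (simp add: poly_const_pow flip: rf_power)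
qed (simp_all flip: rf_hom)

lemma rf_const_of_int: "rf [:of_int k:] = of_int k"
proof -
  have n: "rf [:of_nat j:] = of_nat j" for j
    by (simp add: of_nat_poly flip: rf_of_nat)
  show ?thesis
  proof (cases "k \<ge> 0")
    case True
    then show ?thesis using n[of "nat k"] by simp
  next
    case False
    have "rf [:of_int k:] = rf [:- of_nat (nat (- k)):]" using False by simp
    also have "\<dots> = - of_nat (nat (- k))" by (simp only: rf_const n)
    also have "\<dots> = of_int k" using False by simp
    finally show ?thesis .
  qed
qed

section \<open>Complex multiplication\<close>

locale cm_field = char_field ty p for ty :: "'a::alg_closed_field itself" and p +
  assumes p2: "p \<noteq> 2" and p3: "p \<noteq> 3" and p11: "p \<noteq> 11"
begin

definition nn :: nat where "nn = (p - 1) div 2"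

lemma p_odd: "p = 2 * nn + 1"
proof -
  have "odd p" using prime p2 prime_odd_nat prime_ge_2_nat[OF prime] by fastforce
  then show ?thesis by (auto simp: nn_def elim: oddE)
qed

lemma power_p: "t ^ p = t * (t ^ nn)^2" for t :: "'b::comm_monoid_mult"
proof -
  have "t ^ p = t ^ (2 * nn + 1)" using p_odd by metis
  then show ?thesis by (simp flip: power_mult add: mult.commute)
qed

lemma power_p_pred: "t ^ (p - 1) = (t ^ nn)^2" for t :: "'b::comm_monoid_mult"
proof -
  have "p - 1 = nn * 2" using p_odd by linarith
  then show ?thesis by (simp only: power_mult)
qed

lemma p_gt_3: "3 < p" "5 \<le> p"
proof -
  have "2 \<le> p" by (rule prime_ge_2_nat[OF prime])
  then show "3 < p" using p2 p3 by linarith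
  then show "5 \<le> p" using p_odd by presburger
qed

lemma nn_ge_2: "2 \<le> nn" using p_gt_3 p_odd by linarith

lemma prime_numeral_nz: "prime q \<Longrightarrow> q \<noteq> p \<Longrightarrow> of_nat q \<noteq> (0::'a)"
  using primes_dvd_imp_eq[OF prime] by (auto simp: of_nat_0_iff)

lemma nz2: "(2::'a) \<noteq> 0" using prime_numeral_nz[of 2] p2 by simp
lemma nz3: "(3::'a) \<noteq> 0" using prime_numeral_nz[of 3] p3 by simp
lemma nz11: "(11::'a) \<noteq> 0"
proof -
  have "prime (11::nat)" by simp
  then show ?thesis using prime_numeral_nz[of 11] p11 by simp
qed

text \<open>The curve \<open>y\<^sup>2 = x\<^sup>3 - 264 x + 1694\<close> has complex multiplication by the integers of
  \<open>\<rat>(\<surd>-11)\<close>. A root \<open>w\<close> of \<open>w\<^sup>2 - w + 3\<close> acts as an isogeny of degree 3 whose kernel is given by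
  the point with \<open>x = 12 - 2 w\<close>; its formula comes from Velu's formulas.\<close>

definition cub :: "'a poly" where "cub = [:1694, -264, 0, 1:]"

lemma poly_cub: "poly cub z = z^3 - 264 * z + 1694"
  by (simp add: cub_def power3_eq_cube algebra_simps)

lemma degree_cub: "degree cub = 3" by (simp add: cub_def)

lemma disc_nz: "4 * (-264)^3 + 27 * 1694^2 \<noteq> (0::'a)"
proof -
  have "4 * (-264)^3 + 27 * 1694^2 = (2^2 * 3^6 * 11^3 :: 'a)" by simp
  then show ?thesis using nz2 nz3 nz11 by (simp only: mult_eq_0_iff power_eq_0_iff) simp
qed

sublocale E: const_curve "-264" 1694 "rf cub"
proof
  show "rf cub \<noteq> 0" by (simp add: cub_def)
qed (use nz2 disc_nz in simp_all)

lemma cub_separable: "poly cub z = 0 \<Longrightarrow> poly (pderiv cub) z \<noteq> 0"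
proof -
  assume "poly cub z = 0"
  then have "z^3 + (-264) * z + 1694 = 0" by (simp add: poly_cub)
  then have "3 * z^2 + (-264) \<noteq> 0"
    using no_double_root[OF one_neq_zero nz2, of "-264" 1694 z] disc_nz by blast
  then show ?thesis by (simp add: cub_def pderiv_pCons power2_eq_square algebra_simps)
qed

definition pt_id :: "'a poly fract point" where "pt_id = Aff (rf [:0, 1:]) 1"

lemma rf_cub: "rf cub = rf [:0, 1:]^3 + rf [:-264:] * rf [:0, 1:] + rf [:1694:]"
  by (simp add: cub_def power3_eq_cube flip: rf_hom)

lemma pt_id_curve: "E.onc pt_id"
  by (simp add: pt_id_def rf_cub)

lemma pdeg_pt_id: "pdeg pt_id 1"
  unfolding pt_id_def pdeg_def ratdeg_def point.case
  by (rule exI[of _ "[:0, 1:]"], rule exI[of _ 1]) simp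

lemma pt_id_carrier: "pt_id \<in> carrier E.grp"
  using pt_id_curve pdeg_pt_id by auto

lemma tangent_pt_id: "tangent fderiv pt_id (rf 1)"
  by (simp add: tangent_def pt_id_def fderiv_rf pderiv_pCons flip: one_pCons)

section \<open>The isogeny of degree 3\<close>

context
  fixes w :: 'a
  assumes w: "w^2 = w - 3"
begin

definition iso_z :: "'a poly" where "iso_z = [:2 * w - 12, 1:]"
text \<open>At the kernel abscissa \<open>x0 = 12 - 2 * w\<close> Velu's two numbers are
  \<open>2 * (3 * x0^2 - 264) = 264 - 264 * w\<close> and
  \<open>4 * (x0^3 - 264 * x0 + 1694) = - 616 - 704 * w\<close>. Since
  \<open>w * (1 - w) = 3\<close>, the factors \<open>(1 - w)^2 / 9\<close> and
  \<open>(1 - w)^3 / 27\<close> are the powers of \<open>w\<close> with exponents -2 and -3; they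
  carry Velu's quotient back to the original curve and make the differential pull back to
  \<open>w\<close> times itself.\<close>

definition iso_num :: "'a poly" where
  "iso_num = [:(1 - w)^2:] * ([:0, 1:] * iso_z^2 + [:264 - 264 * w:] * iso_z + [:- 616 - 704 * w:])"
definition iso_ynum :: "'a poly" where
  "iso_ynum = [:(1 - w)^3:] * (iso_z^3 - [:264 - 264 * w:] * iso_z - [:2:] * [:- 616 - 704 * w:])"
definition pt_iso :: "'a poly fract point" where
  "pt_iso = Aff (rf iso_num / rf ([:9:] * iso_z^2)) (rf iso_ynum / rf ([:27:] * iso_z^3))"

end

lemma conj_root: "w^2 = w - 3 \<Longrightarrow> (1 - w)^2 = (1 - w) - (3::'a)"
proof -
  assume w: "w^2 = w - 3"
  have "(1 - w)^2 - ((1 - w) - 3) = w^2 - (w - 3)" by Groebner_Basis.algebra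
  then show ?thesis using w by simp
qed

lemma root_nz: "w^2 = w - 3 \<Longrightarrow> w \<noteq> (0::'a)"
  using nz3 by auto

text \<open>The image point satisfies the curve equation, with denominators cleared. The identity
  lives in any integral domain because it serves rational functions here and power series in
  \<open>hasse_supersingular\<close>.\<close>

lemma cm_identity1:
  fixes x w :: "'b::idom"
  assumes "w^2 = w - 3"
  defines "z \<equiv> x - (12 - 2 * w)" and "t \<equiv> 264 - 264 * w" and "u \<equiv> - 616 - 704 * w"
  shows "(x^3 - 264 * x + 1694) * ((1 - w)^3 * (z^3 - t * z - 2 * u))^2 =
    ((1 - w)^2 * (x * z^2 + t * z + u))^3 - 264 * 81 * ((1 - w)^2 * (x * z^2 + t * z + u)) * z^4 + 1694 * 729 * z^6"
  using assms(1) unfolding t_def u_def z_def by Groebner_Basis.algebra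

text \<open>The chord through the identity and the negative of \<open>w\<close> has slope
  \<open>- (44 - 2 * x) / (3 * z * z')\<close>, where \<open>z'\<close> belongs to the conjugate
  kernel abscissa \<open>10 + 2 * w\<close>. This is invariant under \<open>w\<close> to
  \<open>1 - w\<close>, so the same line passes through the negative of \<open>1 - w\<close>;
  \<open>cm_identity3\<close> then matches the sum of the three abscissas.\<close>

lemma cm_identity2:
  fixes x w :: "'b::idom"
  assumes "w^2 = w - 3"
  defines "z \<equiv> x - (12 - 2 * w)" and "t \<equiv> 264 - 264 * w" and "u \<equiv> - 616 - 704 * w"
  shows "(x - (10 + 2 * w)) * ((1 - w)^3 * (z^3 - t * z - 2 * u) + 27 * z^3) =
    (44 - 2 * x) * ((1 - w)^2 * (x * z^2 + t * z + u) - 9 * x * z^2)"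
  using assms(1) unfolding t_def u_def z_def by Groebner_Basis.algebra

lemma cm_identity3:
  fixes x w :: "'b::idom"
  assumes "w^2 = w - 3"
  defines "z \<equiv> x - (12 - 2 * w)" and "z' \<equiv> x - (10 + 2 * w)"
  shows "(x^3 - 264 * x + 1694) * (44 - 2 * x)^2 = 9 * x * z^2 * z'^2
    + (1 - w)^2 * (x * z^2 + (264 - 264 * w) * z + (- 616 - 704 * w)) * z'^2
    + w^2 * (x * z'^2 + 264 * w * z' + (- 1320 + 704 * w)) * z^2"
  using assms(1) unfolding z_def z'_def by Groebner_Basis.algebra

lemma three_nz: "(3::'a poly fract) \<noteq> 0" "(9::'a poly fract) \<noteq> 0" "(27::'a poly fract) \<noteq> 0"
proof -
  show 3: "(3::'a poly fract) \<noteq> 0" using nz3 by (simp flip: rf_const(2))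
  have "(9::'a poly fract) = 3 * 3" "(27::'a poly fract) = 3 * 3 * 3" by simp_all
  then show "(9::'a poly fract) \<noteq> 0" "(27::'a poly fract) \<noteq> 0" using 3 by (metis mult_eq_0_iff)+
qed

lemma rf_const_root:
  assumes w: "w^2 = w - (3::'a)"
  shows "rf [:w:]^2 = rf [:w:] - 3"
proof -
  have "rf [:w:]^2 = rf [:w^2:]" by (simp only: rf_const)
  then show ?thesis unfolding w by (simp only: rf_const)
qed

lemma rf_iso_z:
  assumes w: "w^2 = w - (3::'a)"
  shows "rf (iso_z w) = rf [:0, 1:] - (12 - 2 * rf [:w:])"
proof -
  have "iso_z w = [:0, 1:] - [:12 - 2 * w:]" by (simp add: iso_z_def[OF w])
  then have "rf (iso_z w) = rf [:0, 1:] - rf [:12 - 2 * w:]" by (simp only: rf_diff)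
  then show ?thesis by (simp only: rf_const)
qed

lemma pt_iso_coords:
  assumes w: "w^2 = w - (3::'a)"
  defines "x \<equiv> rf [:0, 1:]" and "v \<equiv> rf [:w:]"
  defines "z \<equiv> x - (12 - 2 * v)"
  obtains R S where "pt_iso w = Aff R S" "R = rf (iso_num w) / rf ([:9:] * iso_z w^2)" "z \<noteq> 0"
    "9 * z^2 * R = (1 - v)^2 * (x * z^2 + (264 - 264 * v) * z + (- 616 - 704 * v))"
    "27 * z^3 * S = (1 - v)^3 * (z^3 - (264 - 264 * v) * z - 2 * (- 616 - 704 * v))"
proof -
  have rz: "rf (iso_z w) = z" unfolding z_def x_def v_def by (rule rf_iso_z[OF w])
  have rA: "rf (iso_num w) = (1 - v)^2 * (x * z^2 + (264 - 264 * v) * z + (- 616 - 704 * v))"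
    unfolding iso_num_def[OF w] rf_hom rz rf_const x_def v_def by simp
  have rC: "rf (iso_ynum w) = (1 - v)^3 * (z^3 - (264 - 264 * v) * z - 2 * (- 616 - 704 * v))"
    unfolding iso_ynum_def[OF w] rf_hom rz rf_const x_def v_def by simp
  have "iso_z w \<noteq> 0" by (simp add: iso_z_def[OF w])
  then have z0: "z \<noteq> 0" by (simp flip: rz)
  define R where "R = rf (iso_num w) / rf ([:9:] * iso_z w^2)"
  define S where "S = rf (iso_ynum w) / rf ([:27:] * iso_z w^3)"
  have "pt_iso w = Aff R S" by (simp add: pt_iso_def[OF w] R_def S_def)
  moreover have "9 * z^2 * R = (1 - v)^2 * (x * z^2 + (264 - 264 * v) * z + (- 616 - 704 * v))"
    unfolding R_def rA rf_hom rf_const rz using z0 three_nz by simp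
  moreover have "27 * z^3 * S = (1 - v)^3 * (z^3 - (264 - 264 * v) * z - 2 * (- 616 - 704 * v))"
    unfolding S_def rC rf_hom rf_const rz using z0 three_nz by simp
  ultimately show ?thesis using that z0 R_def by blast
qed

lemma rf_coeffs: "rf [:-264::'a:] = - 264" "rf [:1694::'a:] = 1694"
  using rf_const(6)[of 264] by (simp_all add: rf_const)

lemma rf_cub': "rf cub = rf [:0, 1:]^3 - 264 * rf [:0, 1:] + 1694"
  unfolding rf_cub rf_coeffs by simp

lemma pt_iso_facts:
  assumes w: "w^2 = w - (3::'a)"
  shows "E.onc (pt_iso w)" "pdeg (pt_iso w) 3" "tangent fderiv (pt_iso w) (rf [:w:])"
proof -
  define x where "x = rf [:0, 1::'a:]"
  define v where "v = rf [:w:]"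
  have v2: "v^2 = v - 3" unfolding v_def by (rule rf_const_root[OF w])
  define z where "z = x - (12 - 2 * v)"
  define t where "t = 264 - 264 * v"
  define u where "u = - 616 - 704 * v"
  obtain R S where P: "pt_iso w = Aff R S" and R_def: "R = rf (iso_num w) / rf ([:9:] * iso_z w^2)"
    and z0: "z \<noteq> 0" and R: "9 * z^2 * R = (1 - v)^2 * (x * z^2 + t * z + u)"
    and S: "27 * z^3 * S = (1 - v)^3 * (z^3 - t * z - 2 * u)"
    using pt_iso_coords[OF w] unfolding x_def v_def z_def t_def u_def by blast
  note n9 = three_nz(2,3)
  have zz: "iso_z w \<noteq> 0" by (simp add: iso_z_def[OF w])
  have rz: "rf (iso_z w) = z" unfolding z_def x_def v_def by (rule rf_iso_z[OF w])
  have rc: "rf cub = x^3 - 264 * x + 1694" unfolding rf_cub' x_def ..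
  have "729 * z^6 * (rf cub * S^2) = (x^3 - 264 * x + 1694) * (27 * z^3 * S)^2"
    unfolding rc by Groebner_Basis.algebra
  also have "\<dots> = (9 * z^2 * R)^3 - 264 * 81 * (9 * z^2 * R) * z^4 + 1694 * 729 * z^6"
    unfolding S R by (rule cm_identity1[OF v2, of x, folded z_def t_def u_def])
  also have "\<dots> = 729 * z^6 * (R^3 + rf [:-264:] * R + rf [:1694:])"
    unfolding rf_coeffs by Groebner_Basis.algebra
  finally have "729 * z^6 * (rf cub * S^2) = 729 * z^6 * (R^3 + rf [:-264:] * R + rf [:1694:])" .
  moreover have "729 * z^6 \<noteq> 0"
  proof -
    have "(729::'a poly fract) = 27 * 27" by simp
    then have "(729::'a poly fract) \<noteq> 0" using n9 by (metis mult_eq_0_iff)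
    then show ?thesis using z0 by simp
  qed
  ultimately have "rf cub * S^2 = R^3 + rf [:-264:] * R + rf [:1694:]" by simp
  then show "E.onc (pt_iso w)" by (simp add: P)
  have w1: "1 - w \<noteq> 0" using root_nz[OF conj_root[OF w]] .
  have n9': "(9::'a) \<noteq> 0"
    using nz3 mult_eq_0_iff[of 3 "3::'a"] by simp
  have u0: "- 616 - 704 * w \<noteq> 0"
  proof
    assume h: "- 616 - 704 * w = 0"
    \<comment> \<open>Multiplication by the conjugate gives the norm. Up to a power of
      \<open>1 - w\<close> the constant is the value of \<open>iso_num\<close> at the kernel
      abscissa, so the fraction is reduced.\<close>
    have "(2^6 * 3^3 * 11^3 :: 'a) = (- 616 - 704 * w) * (- 1320 + 704 * w) + 704^2 * (w^2 - (w - 3))"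
      by Groebner_Basis.algebra
    also have "\<dots> = 0" using h w by simp
    finally have "(2^6 * 3^3 * 11^3 :: 'a) = 0" .
    then show False using nz2 nz3 nz11 by (simp only: mult_eq_0_iff power_eq_0_iff) simp
  qed
  have dz: "degree (iso_z w) = 1" by (simp add: iso_z_def[OF w])
  have "degree (iso_num w) = 3"
  proof -
    have "degree ([:0, 1:] * iso_z w^2) = 3" using zz dz
      by (simp add: degree_mult_eq degree_power_eq)
    moreover have "degree ([:264 - 264 * w:] * iso_z w + [:- 616 - 704 * w:]) \<le> 1"
      using degree_smult_le[of "264 - 264 * w" "iso_z w"] dz by (intro degree_add_le) simp_all
    ultimately have "degree ([:0, 1:] * iso_z w^2 + ([:264 - 264 * w:] * iso_z w + [:- 616 - 704 * w:])) = 3"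
      by (intro degree_add_left) auto
    then show ?thesis using w1 by (simp add: iso_num_def[OF w] add.assoc)
  qed
  moreover have "degree ([:9:] * iso_z w^2) < 3" using zz dz n9' by (simp add: degree_power_eq)
  moreover have "[:9:] * iso_z w^2 \<noteq> 0" using zz n9' by simp
  moreover have "\<not> (poly (iso_num w) y = 0 \<and> poly ([:9:] * iso_z w^2) y = 0)" for y
    using n9' u0 w1 by (auto simp: iso_num_def[OF w])
  ultimately show "pdeg (pt_iso w) 3"
    unfolding P pdeg_def point.case ratdeg_def R_def by blast
  have "fderiv (rf ([:9:] * iso_z w^2) * R) = fderiv (rf (iso_num w))"
    using zz n9' by (simp add: R_def)
  then have "rf (pderiv ([:9:] * iso_z w^2)) * R + rf ([:9:] * iso_z w^2) * fderiv R = rf (pderiv (iso_num w))"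
    by (simp only: fderiv_mult fderiv_rf)
  moreover have dz1: "pderiv (iso_z w) = 1"
    by (simp add: iso_z_def[OF w] pderiv_pCons flip: one_pCons)
  have "pderiv ([:9:] * iso_z w^2) = [:9:] * ([:2:] * iso_z w)"
    by (simp add: pderiv_smult pderiv_power dz1 numeral_poly power2_eq_square pderiv_mult flip: mult_2)
  ultimately have D: "18 * z * R + 9 * z^2 * fderiv R = rf (pderiv (iso_num w))"
    by (simp only: rf_mult rf_power rf_const rz) (simp add: mult_ac)
  have "pderiv (iso_num w) = [:(1 - w)^2:] * (iso_z w^2 + [:0, 1:] * ([:2:] * iso_z w) + [:264 - 264 * w:])"
    unfolding iso_num_def[OF w] by (simp add: pderiv_smult pderiv_add pderiv_mult pderiv_power dz1 pderiv_pCons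
      numeral_poly power2_eq_square flip: one_pCons mult_2)
  then have D2: "rf (pderiv (iso_num w)) = (1 - v)^2 * (z^2 + 2 * x * z + t)"
    by (simp only: rf_hom rz rf_const t_def x_def v_def) (simp add: mult_ac)
  have "27 * z^3 * fderiv R = 27 * z^3 * (v * S)"
  proof -
    have "27 * z^3 * fderiv R = 3 * z * (9 * z^2 * fderiv R)" by Groebner_Basis.algebra
    also have "\<dots> = 3 * z * ((1 - v)^2 * (z^2 + 2 * x * z + t)) - 6 * (9 * z^2 * R)"
      using D unfolding D2 by Groebner_Basis.algebra
    also have "\<dots> = v * (27 * z^3 * S)"
      unfolding R S using v2 unfolding t_def u_def z_def by Groebner_Basis.algebra
    finally show ?thesis by (simp only: mult_ac)
  qed
  then have "fderiv R = v * S" using n9 z0 by simp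
  then show "tangent fderiv (pt_iso w) (rf [:w:])" by (simp add: tangent_def P v_def)
qed

lemma pt_iso_carrier: "w^2 = w - (3::'a) \<Longrightarrow> pt_iso w \<in> carrier E.grp"
  using pt_iso_facts by auto

lemma deg_pt_id: "E.deg_pt pt_id = 1"
  by (rule E.deg_ptI[OF pdeg_pt_id])

lemma deg_pt_iso: "w^2 = w - (3::'a) \<Longrightarrow> E.deg_pt (pt_iso w) = 3"
  by (rule E.deg_ptI) (rule pt_iso_facts)

text \<open>Makes \<open>1 - w\<close> an isogeny of known degree 3; the parallelogram law then
  gives degree 5 to \<open>1 + w\<close>, the last value that the quadratic form requires.\<close>

lemma id_minus_iso:
  assumes w: "w^2 = w - (3::'a)"
  shows "padd (rf cub) (rf [:-264:]) pt_id (pneg (pt_iso w)) = pt_iso (1 - w)"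
proof -
  define x where "x = rf [:0, 1::'a:]"
  define v where "v = rf [:w:]"
  have v2: "v^2 = v - 3" unfolding v_def by (rule rf_const_root[OF w])
  have e1: "rf [:1 - w:] = 1 - v" by (simp only: rf_const v_def)
  have v2': "(1 - v)^2 = (1 - v) - 3"
    unfolding e1[symmetric] by (rule rf_const_root[OF conj_root[OF w]])
  note n3 = three_nz(1) and n9 = three_nz(2,3)
  define z where "z = x - (12 - 2 * v)"
  define z' where "z' = x - (10 + 2 * v)"
  obtain R S where P: "pt_iso w = Aff R S" and z0: "z \<noteq> 0"
    and R: "9 * z^2 * R = (1 - v)^2 * (x * z^2 + (264 - 264 * v) * z + (- 616 - 704 * v))"
    and S: "27 * z^3 * S = (1 - v)^3 * (z^3 - (264 - 264 * v) * z - 2 * (- 616 - 704 * v))"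
    using pt_iso_coords[OF w] unfolding x_def v_def z_def by blast
  have e2: "x - (12 - 2 * (1 - v)) = z'" by (simp add: z'_def algebra_simps)
  have e3: "264 - 264 * (1 - v) = 264 * v" "- 616 - 704 * (1 - v) = - 1320 + 704 * v" "1 - (1 - v) = v"
    by (simp_all add: algebra_simps)
  obtain R' S' where P': "pt_iso (1 - w) = Aff R' S'" and z'0: "z' \<noteq> 0"
    and R': "9 * z'^2 * R' = v^2 * (x * z'^2 + 264 * v * z' + (- 1320 + 704 * v))"
    and S': "27 * z'^3 * S' = v^3 * (z'^3 - 264 * v * z' - 2 * (- 1320 + 704 * v))"
    using pt_iso_coords[OF conj_root[OF w]] unfolding e1 e2 e3 x_def[symmetric] by blast
  have xR: "R \<noteq> x"
  proof
    assume "R = x"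
    then have "ratdeg R 1" using pdeg_pt_id by (simp add: pdeg_def pt_id_def x_def)
    moreover have "ratdeg R 3" using pt_iso_facts(2)[OF w] by (simp add: P pdeg_def)
    ultimately show False using ratdeg_unique by fastforce
  qed
  define l where "l = (44 - 2 * x) / (3 * z * z')"
  have l: "3 * z * z' * l = 44 - 2 * x" using n3 z0 z'0 by (simp add: l_def)
  have i2: "z' * (27 * z^3 * S + 27 * z^3) = (44 - 2 * x) * (9 * z^2 * R - 9 * x * z^2)"
    unfolding R S unfolding z'_def z_def by (rule cm_identity2[OF v2])
  have s: "S + 1 = l * (R - x)"
  proof -
    have "27 * z^3 * z' * (S + 1) = z' * (27 * z^3 * S + 27 * z^3)" by Groebner_Basis.algebra
    also have "\<dots> = 27 * z^3 * z' * (l * (R - x))"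
      unfolding i2 l[symmetric] by Groebner_Basis.algebra
    finally show ?thesis using n9 z0 z'0 by simp
  qed
  have i2': "z * (27 * z'^3 * S' + 27 * z'^3) = (44 - 2 * x) * (9 * z'^2 * R' - 9 * x * z'^2)"
  proof -
    have "x - (10 + 2 * (1 - v)) = z" by (simp add: z_def algebra_simps)
    then show ?thesis unfolding R' S'
      using cm_identity2[OF v2', of x] unfolding e2 e3 by simp
  qed
  have s': "S' + 1 = l * (R' - x)"
  proof -
    have "27 * z'^3 * z * (S' + 1) = z * (27 * z'^3 * S' + 27 * z'^3)" by Groebner_Basis.algebra
    also have "\<dots> = 27 * z'^3 * z * (l * (R' - x))"
      unfolding i2' l[symmetric] by Groebner_Basis.algebra
    finally show ?thesis using n9 z0 z'0 by simp
  qed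
  have rc: "rf cub = x^3 - 264 * x + 1694" unfolding rf_cub' x_def ..
  have x3: "rf cub * l^2 - x - R = R'"
  proof -
    have "9 * z^2 * z'^2 * (rf cub * l^2) = rf cub * (3 * z * z' * l)^2" by Groebner_Basis.algebra
    also have "\<dots> = 9 * x * z^2 * z'^2 + (9 * z^2 * R) * z'^2 + (9 * z'^2 * R') * z^2"
      unfolding l rc R R' unfolding z'_def z_def by (rule cm_identity3[OF v2])
    also have "\<dots> = 9 * z^2 * z'^2 * (x + R + R')" by Groebner_Basis.algebra
    finally have "rf cub * l^2 = x + R + R'" using n9 z0 z'0 by simp
    then show ?thesis by simp
  qed
  have sl: "slope (rf cub) (rf [:-264:]) x 1 R (- S) = - l"
  proof -
    have "- S - 1 = - l * (R - x)" using s by (simp add: algebra_simps)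
    then show ?thesis using xR by (simp add: slope_def)
  qed
  have "- l * (x - R') - 1 = S'" using s' by (simp add: algebra_simps)
  then show ?thesis
    unfolding P' P pt_id_def using xR x3 sl by (auto simp: Let_def simp flip: x_def)
qed

lemma deg_id_plus_iso:
  assumes w: "w^2 = w - (3::'a)"
  shows "E.deg_pt (pt_id \<otimes>\<^bsub>E.grp\<^esub> pt_iso w) = 5"
proof -
  have "pt_id \<otimes>\<^bsub>E.grp\<^esub> inv\<^bsub>E.grp\<^esub> (pt_iso w) = pt_iso (1 - w)"
    unfolding E.inv_grp[OF pt_iso_carrier[OF w]] using id_minus_iso[OF w] by simp
  then show ?thesis
    using E.deg_parallelogram[OF pt_id_carrier pt_iso_carrier[OF w]]
      deg_pt_id deg_pt_iso[OF w] deg_pt_iso[OF conj_root[OF w]] by simp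
qed

section \<open>The lattice of elements \<open>m + n w\<close>, and Frobenius\<close>

definition lat :: "'a \<Rightarrow> int \<Rightarrow> int \<Rightarrow> 'a poly fract point" where
  "lat w m n = pt_id [^]\<^bsub>E.grp\<^esub> m \<otimes>\<^bsub>E.grp\<^esub> pt_iso w [^]\<^bsub>E.grp\<^esub> n"

lemma deg_lat:
  assumes w: "w^2 = w - (3::'a)"
  shows "int (E.deg_pt (lat w m n)) = m^2 + m * n + 3 * n^2"
  using E.deg_lattice[OF pt_id_carrier pt_iso_carrier[OF w], of m n]
  by (simp only: lat_def deg_pt_id deg_pt_iso[OF w] deg_id_plus_iso[OF w]) simp

lemma lat_carrier: "w^2 = w - (3::'a) \<Longrightarrow> lat w m n \<in> carrier E.grp"
  unfolding lat_def by (intro E.m_closed E.int_pow_closed pt_id_carrier pt_iso_carrier)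

lemma tangent_lat:
  assumes w: "w^2 = w - (3::'a)"
  shows "tangent fderiv (lat w m n) (rf [:of_int m + of_int n * w:])"
proof -
  have "tangent fderiv (lat w m n) (of_int m * rf 1 + of_int n * rf [:w:])"
    unfolding lat_def using pt_id_carrier pt_iso_carrier[OF w] tangent_pt_id pt_iso_facts(3)[OF w]
    by (intro E.tangent_mult E.tangent_int_pow E.int_pow_closed)
  moreover have "of_int m * rf 1 + of_int n * rf [:w:] = rf [:of_int m + of_int n * w:]"
    by (simp only: rf_const rf_const_of_int rf_1 mult_1_right)
  ultimately show ?thesis by simp
qed

text \<open>The abscissa is \<open>u ^ p\<close> with \<open>u\<close> linear. The cubic has
  coefficients in the prime field, so the curve equation reads \<open>cub * y^2 = q ^ p\<close> with
  \<open>q\<close> the cubic at \<open>u\<close>. Hence \<open>cub * q\<close> is a square, and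
  separability makes \<open>q\<close> a multiple of \<open>cub\<close>; comparing coefficients gives
  \<open>u = x\<close> once 264 and \<open>1694 = 2 * 7 * 11^2\<close> are nonzero. In geometric
  terms, such a point is Frobenius followed by an automorphism, and the only automorphisms are plus
  and minus one.\<close>

lemma frobenius_twist_trivial:
  assumes p7: "p \<noteq> 7" and on: "E.onc (Aff (rf ([:e0:] + monom e1 p)) y)" and e1: "e1 \<noteq> 0"
  shows "e0 = 0 \<and> e1 = 1 \<and> (y = rf (cub ^ nn) \<or> y = - rf (cub ^ nn))"
proof -
  have pp: "0 < p" using p_gt_3 by simp
  obtain g0 g1 where g: "g0 ^ p = e0" "g1 ^ p = e1" using nth_root_exists[OF pp] by metis
  define u where "u = [:g0, g1:]"
  have up: "u ^ p = [:e0:] + monom e1 p"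
  proof -
    have "u = [:g0:] + monom g1 1" by (simp add: u_def monom_altdef)
    then have "u ^ p = [:g0:] ^ p + monom g1 1 ^ p" by (simp only: poly_freshman)
    then show ?thesis by (simp add: poly_const_pow monom_power g)
  qed
  define q where "q = u^3 + [:-264:] * u + [:1694:]"
  have c: "[:-264::'a:] ^ p = [:-264:]" "[:1694::'a:] ^ p = [:1694:]"
    using of_int_power_p[of "-264"] of_int_power_p[of 1694] by (simp_all add: poly_const_pow)
  have qp: "q ^ p = (u ^ p)^3 + [:-264:] * u ^ p + [:1694:]"
    unfolding q_def poly_freshman power_mult_distrib c by (simp flip: power_mult add: mult.commute)
  have g1: "g1 \<noteq> 0" using e1 g pp by auto
  have qc: "q = [:g0^3 - 264 * g0 + 1694, 3 * g0^2 * g1 - 264 * g1, 3 * g0 * g1^2, g1^3:]"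
    by (simp add: q_def u_def power3_eq_cube power2_eq_square algebra_simps)
  have q0: "q \<noteq> 0" and dq: "degree q = 3" using g1 by (simp_all add: qc)
  have y: "rf cub * y^2 = rf (q ^ p)"
    using on unfolding qp up rf_hom by simp
  \<comment> \<open>A square root of \<open>cub * q\<close> among the rational functions: the even
    part of \<open>q ^ p\<close> has been divided out.\<close>
  define r where "r = rf cub * y / rf (q ^ nn)"
  have qn: "rf (q ^ nn) \<noteq> 0" using q0 by simp
  have "r^2 * rf (q ^ nn)^2 = rf cub * (rf cub * y^2)"
    using qn by (simp add: r_def power2_eq_square)
  also have "\<dots> = rf (cub * q) * rf (q ^ nn)^2"
  proof -
    have "q ^ p = q * (q ^ nn)^2" by (rule power_p)
    then show ?thesis unfolding y by (simp add: rf_hom)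
  qed
  finally have r2: "r^2 = rf (cub * q)" using q0 by simp
  obtain m s where ms: "r = rf m / rf s" "s \<noteq> 0" "\<And>z. \<not> (poly m z = 0 \<and> poly s z = 0)"
    by (rule reduced_fraction[of r]) auto
  have "rf (m^2) = rf (cub * q * s^2)"
    using r2 ms(2) unfolding ms(1) by (simp add: power_divide field_simps rf_hom)
  then have m2: "m^2 = cub * q * s^2" by (simp only: rf_eq_iff)
  have "degree s = 0"
  proof (rule ccontr)
    assume "degree s \<noteq> 0"
    then obtain z where z: "poly s z = 0" using alg_closed_imp_poly_has_root by blast
    then have "poly (m^2) z = 0" unfolding m2 by simp
    then show False using ms(3)[of z] z by simp
  qed
  then obtain s0 where s0: "s = [:s0:]" by (meson degree_eq_zeroE)
  have "cub dvd m"
    by (rule separable_dvd_power2[OF cub_separable]) (auto simp: m2)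
  then obtain k where k: "m = cub * k" by (rule dvdE)
  have cub0: "cub \<noteq> 0" by (simp add: cub_def)
  have "cub * (cub * k^2) = cub * (q * s^2)" using m2 unfolding k by (simp add: power2_eq_square mult_ac)
  then have ck: "cub * k^2 = q * s^2" using cub0 by simp
  have k0: "k \<noteq> 0" using ck q0 ms(2) by auto
  have "degree (cub * k^2) = 3 + 2 * degree k" using k0 cub0 degree_cub by (simp add: degree_mult_eq degree_power_eq)
  moreover have "degree (q * s^2) = 3" using s0 ms(2) dq by (simp add: power2_eq_square)
  ultimately have "degree k = 0" using ck by simp
  then obtain k1 where k1: "k = [:k1:]" by (meson degree_eq_zeroE)
  have s00: "s0 \<noteq> 0" and "k1 \<noteq> 0" using s0 ms(2) k1 k0 by auto
  have "smult (k1^2) cub = smult (s0^2) q"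
    using ck by (simp add: k1 s0 power2_eq_square mult.commute)
  then have co: "k1^2 * coeff cub i = s0^2 * coeff q i" for i
    by (metis coeff_smult)
  have "3 * g0 * g1^2 = 0" using co[of 2] s00 by (simp add: cub_def qc numeral_2_eq_2)
  then have g00: "g0 = 0" using nz3 g1 by simp
  have 3: "k1^2 = s0^2 * g1^3" using co[of 3] by (simp add: cub_def qc numeral_3_eq_3)
  have 1: "k1^2 * 264 = s0^2 * (264 * g1)" using co[of 1] by (simp add: cub_def qc g00)
  have 0: "k1^2 * 1694 = s0^2 * 1694" using co[of 0] by (simp add: cub_def qc g00)
  have n7: "(7::'a) \<noteq> 0" using prime_numeral_nz[of 7] p7 by simp
  have "(1694::'a) = 2 * 7 * 11 * 11" "(264::'a) = 2 * 2 * 2 * 3 * 11" by simp_all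
  then have nz: "(1694::'a) \<noteq> 0" "(264::'a) \<noteq> 0" using nz2 nz3 nz11 n7 by (metis mult_eq_0_iff)+
  have ks: "k1^2 = s0^2" using 0 nz by simp
  have "s0^2 * 264 * 1 = s0^2 * 264 * g1" using 1 unfolding ks by (simp add: mult_ac)
  then have g11: "g1 = 1" using s00 nz by (metis mult_left_cancel mult_eq_0_iff power_not_zero)
  have e: "e0 = 0" "e1 = 1" using g g00 g11 pp by (auto simp: power_0_left)
  have "q = cub" by (simp add: qc g00 g11 cub_def)
  then have "rf cub * y^2 = rf cub * rf (cub ^ nn)^2"
    using y unfolding power_p rf_mult rf_power by simp
  then have "y^2 = rf (cub ^ nn)^2" using cub0 by simp
  then show ?thesis using e by (simp add: power2_eq_iff)
qed

text \<open>Frobenius sends \<open>y\<close> to \<open>y ^ p = (y^2) ^ nn * y\<close>, and the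
  second coordinate of a point of the twist is the factor in front of \<open>y\<close>.\<close>

definition pt_frob :: "'a poly fract point" where
  "pt_frob = Aff (rf (monom 1 p)) (rf (cub ^ nn))"

lemma lat_frobenius:
  assumes p7: "p \<noteq> 7" and w: "w^2 = w - (3::'a)" and norm: "m^2 + m * n + 3 * n^2 = int p"
    and k: "of_int m + of_int n * w = 0"
  shows "lat w m n = pt_frob \<or> lat w m n = pneg pt_frob"
proof -
  have d: "E.deg_pt (lat w m n) = p" using deg_lat[OF w, of m n] norm by simp
  have C: "lat w m n \<in> carrier E.grp" by (rule lat_carrier[OF w])
  have "lat w m n \<noteq> Infty" using d p_gt_3 by auto
  then obtain t y where ty: "lat w m n = Aff t y" by (cases "lat w m n") auto
  have "fderiv t = 0"
    using tangent_lat[OF w, of m n] by (simp add: ty k tangent_def)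
  moreover have "ratdeg t p" using E.pdeg_deg_pt[OF C] unfolding d by (simp add: ty pdeg_def)
  ultimately obtain e0 e1 where e: "t = rf ([:e0:] + monom e1 p)" "e1 \<noteq> 0"
    by (rule inseparable_degree_p)
  have "E.onc (Aff (rf ([:e0:] + monom e1 p)) y)" using C by (simp add: ty e)
  from frobenius_twist_trivial[OF p7 this e(2)]
  show ?thesis by (auto simp: ty e pt_frob_def)
qed

section \<open>The Hasse invariant\<close>

definition hasse :: 'a where "hasse = coeff (cub ^ nn) (p - 1)"

text \<open>The multiplicity of \<open>z\<close> that cancels between numerator and denominator in the
  x-coordinate of the identity minus Frobenius, whose denominator is \<open>frob\<^sup>2\<close>.\<close>

definition mult_at :: "'a \<Rightarrow> nat" where
  "mult_at z = (if poly cub z = 0 then 1 else if poly cub z ^ nn = 1 then 0 else 2)"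

lemma Fp_cub: "z \<in> Fp \<Longrightarrow> poly cub z \<in> Fp"
proof -
  assume "z \<in> Fp"
  then obtain n where "z = of_nat n" by (auto simp: Fp_def)
  then have "poly cub z = of_int (int n^3 - 264 * int n + 1694)" by (simp add: poly_cub)
  then show ?thesis by (simp only: of_int_Fp)
qed

lemma cub_power_nn:
  assumes "z \<in> Fp"
  shows "poly cub z = 0 \<or> poly cub z ^ nn = 1 \<or> poly cub z ^ nn = - 1"
proof (cases "poly cub z = 0")
  case False
  then have "poly cub z ^ (p - 1) = 1" using Fp_power_pred[OF Fp_cub[OF assms]] by simp
  then have "(poly cub z ^ nn)^2 = 1" unfolding power_p_pred .
  then show ?thesis using power2_eq_1_iff by blast
qed simp

lemma mult_at_eq:
  assumes "z \<in> Fp"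
  shows "of_nat (mult_at z) = 1 - poly (cub ^ nn) z"
proof -
  have "(1::'a) \<noteq> - 1" using nz2 by (metis add_neg_numeral_special(7) one_add_one add.right_inverse)
  then show ?thesis using cub_power_nn[OF assms] nn_ge_2
    by (auto simp: mult_at_def poly_power power_0_left)
qed

lemma of_nat_sum_mult_at: "of_nat (\<Sum>z\<in>Fp. mult_at z) = hasse"
proof -
  have c: "of_nat p = (0::'a)" using of_nat_0_iff by simp
  have "degree (cub ^ nn) < 2 * (p - 1)"
    using degree_power_le[of cub nn] nn_ge_2 p_odd degree_cub by simp
  from sum_poly_Fp[OF this] show ?thesis
    by (simp add: mult_at_eq sum_subtractf card_Fp c hasse_def)
qed

text \<open>\<open>2 - mult_at z\<close> is the number of affine points with abscissa
  \<open>z\<close> over the prime field, so the right side is the full point count. The chord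
  formula puts the abscissa of the difference over \<open>frob^2\<close>, and the proof determines
  what cancels at each \<open>z\<close> in \<open>Fp\<close>.\<close>

lemma deg_minus_frobenius:
  "int (E.deg_pt (pt_id \<otimes>\<^bsub>E.grp\<^esub> pneg pt_frob)) = 2 * int p + 1 - (\<Sum>z\<in>Fp. int (mult_at z))"
proof -
  define F where "F = cub ^ nn"
  define u where "u = cub * (F + 1)^2"
  define num where "num = u - (monom 1 p + [:0, 1:]) * frob^2"
  define A where "A = (\<Prod>z\<in>Fp. [:- z, 1:] ^ mult_at z)"
  define B where "B = (\<Prod>z\<in>Fp. [:- z, 1:] ^ (2 - mult_at z))"
  define M where "M = (\<Sum>z\<in>Fp. mult_at z)"
  have m2: "mult_at z \<le> 2" for z by (simp add: mult_at_def)
  have AB: "A * B = frob^2"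
  proof -
    have "A * B = (\<Prod>z\<in>Fp. [:- z, 1:] ^ 2)"
      unfolding A_def B_def using m2 by (simp flip: prod.distrib power_add)
    then show ?thesis by (simp add: frob_prod prod_power_distrib)
  qed
  have A0: "A \<noteq> 0" and B0: "B \<noteq> 0" by (simp_all add: A_def B_def)
  have dA: "degree A = M" and dB: "degree B = 2 * p - M"
  proof -
    show "degree A = M" unfolding A_def M_def
      by (subst degree_prod_eq_sum_degree) (simp_all add: degree_power_eq)
    have "degree (frob^2) = 2 * p"
      unfolding AB[symmetric] by (simp add: AB frob_prod degree_power_idom degree_prod_eq_sum_degree card_Fp)
    then show "degree B = 2 * p - M"
      using \<open>degree A = M\<close> degree_mult_eq[OF A0 B0] by (simp add: AB)
  qed
  have Mp: "M \<le> 2 * p" unfolding M_def using sum_bounded_above[of Fp mult_at 2] m2 by (simp add: card_Fp)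
  have pn: "p = 2 * nn + 1" by (rule p_odd)
  have c264: "[:-264::'a:] ^ p = [:-264:]" "[:1694::'a:] ^ p = [:1694:]"
    using of_int_power_p[of "-264"] of_int_power_p[of 1694] by (simp_all add: poly_const_pow)
  have cubp: "cub ^ p = monom 1 (3 * p) + [:-264:] * monom 1 p + [:1694:]"
  proof -
    have "cub = monom 1 3 + [:-264:] * monom 1 1 + [:1694:]"
      by (simp add: cub_def monom_altdef power3_eq_cube)
    then have "cub ^ p = (monom 1 3 + [:-264:] * monom 1 1 + [:1694:]) ^ p" by simp
    also have "\<dots> = monom 1 3 ^ p + [:-264:] * monom 1 1 ^ p + [:1694:]"
      unfolding poly_freshman power_mult_distrib c264 ..
    finally show ?thesis by (simp add: monom_power)
  qed
  define low where "low = monom 1 (p + 2) + (- monom 1 3 + ([:-264:] * monom 1 p + ([:1694:]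
     + ([:2:] * cub ^ Suc nn + cub))))"
  \<comment> \<open>The terms of degree \<open>3 * p\<close> in \<open>cub ^ p\<close> and in the
    subtracted product cancel, which leaves degree \<open>2 * p + 1\<close> in front.\<close>
  have num: "num = monom 1 (2 * p + 1) + low"
  proof -
    have U: "u = cub ^ p + [:2:] * cub ^ Suc nn + cub"
    proof -
      have "cub ^ p = cub * F^2" unfolding F_def by (rule power_p)
      moreover have "[:2:] * cub ^ Suc nn = 2 * (cub * F)" by (simp add: F_def numeral_poly)
      moreover have "u = cub * F^2 + 2 * (cub * F) + cub" unfolding u_def by Groebner_Basis.algebra
      ultimately show ?thesis by (simp only:)
    qed
    have V: "(monom 1 p + [:0, 1:]) * frob^2 = monom 1 (3 * p) - monom 1 (2 * p + 1) - monom 1 (p + 2) + monom (1::'a) 3"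
    proof -
      define x where "x = (monom 1 1 :: 'a poly)"
      have x: "[:0, 1:] = x" "monom 1 k = x ^ k" for k by (simp_all add: x_def monom_power monom_altdef)
      define y where "y = x ^ p"
      have "x ^ (3 * p) = y^3" "x ^ (2 * p + 1) = y^2 * x" "x ^ (p + 2) = y * x^2"
        unfolding y_def power_mult[symmetric] power_add
        by (simp_all only: mult.commute[of p] power_one_right)
      moreover have "(y + x) * (y - x)^2 = y^3 - y^2 * x - y * x^2 + x^3" by Groebner_Basis.algebra
      ultimately show ?thesis unfolding frob_def x y_def[symmetric] by (simp only:)
    qed
    show ?thesis unfolding num_def V U cubp low_def by Groebner_Basis.algebra
  qed
  have dlow: "degree low < 2 * p + 1"
  proof -
    have 1: "degree (monom 1 (p + 2) :: 'a poly) < 2 * p + 1" "degree (- monom 1 3 :: 'a poly) < 2 * p + 1"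
        "degree ([:-264:] * monom (1::'a) p) < 2 * p + 1" "degree [:1694::'a:] < 2 * p + 1" "degree cub < 2 * p + 1"
      using p_gt_3 degree_smult_le[of "-264" "monom (1::'a) p"] by (simp_all add: degree_monom_eq degree_cub)
    have "degree ([:2:] * cub ^ Suc nn) \<le> 3 * Suc nn"
      using degree_smult_le[of 2 "cub ^ Suc nn"] degree_power_le[of cub "Suc nn"] by (simp add: degree_cub)
    then have "degree ([:2:] * cub ^ Suc nn) < 2 * p + 1" using nn_ge_2 pn by simp
    then show ?thesis unfolding low_def by (intro degree_add_less 1)
  qed
  have dnum: "degree num = 2 * p + 1"
    unfolding num by (rule degree_add_left[OF dlow]) (simp add: degree_monom_eq)
  have dvd1: "A dvd u" unfolding A_def
  proof (rule prod_linear_powers_dvd)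
    fix z assume z: "z \<in> Fp"
    consider "mult_at z = 0" | "mult_at z = 1" "poly cub z = 0" | "mult_at z = 2" "poly cub z ^ nn = - 1"
    proof -
      have "mult_at z = 0 \<or> mult_at z = 1 \<and> poly cub z = 0 \<or> mult_at z = 2 \<and> poly cub z ^ nn = - 1"
        using cub_power_nn[OF z]
        by (cases "poly cub z = 0"; cases "poly cub z ^ nn = 1") (auto simp: mult_at_def)
      then show ?thesis using that by blast
    qed
    then show "[:- z, 1:] ^ mult_at z dvd u"
    proof cases
      case 2
      then show ?thesis by (simp add: u_def dvd_mult2 flip: poly_eq_0_iff_dvd)
    next
      case 3
      then have "[:- z, 1:] dvd F + 1" by (simp add: F_def poly_power flip: poly_eq_0_iff_dvd)
      then show ?thesis unfolding 3 u_def by (intro dvd_mult dvd_power_same)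
    qed simp
  qed (simp)
  have "A dvd num" unfolding num_def
    by (intro dvd_diff dvd1 dvd_mult) (simp flip: AB)
  then obtain C where C: "num = A * C" by (rule dvdE)
  have "num \<noteq> 0" using dnum by auto
  then have C0: "C \<noteq> 0" using C by auto
  have dC: "degree C = 2 * p + 1 - M" using degree_mult_eq[OF A0 C0] dA dnum C by simp
  have nc: "\<not> (poly C z = 0 \<and> poly B z = 0)" for z
  proof
    assume h: "poly C z = 0 \<and> poly B z = 0"
    then have z: "z \<in> Fp" and m: "mult_at z < 2"
      by (auto simp: B_def poly_prod split: if_splits)
    have fz: "poly frob z = 0" using z by (simp add: poly_frob Fp_power)
    have nz: "poly num z = 0" using h C by simp
    show False
    proof (cases "poly cub z = 0")
      case False
      then have "poly cub z ^ nn = 1" using m by (auto simp: mult_at_def split: if_splits)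
      then have "poly cub z * 2^2 = 0" using nz fz by (simp add: num_def u_def F_def poly_power)
      then show False using False nz2 by (simp only: mult_eq_0_iff power_eq_0_iff) simp
    next
      \<comment> \<open>At a root of the cubic only one linear factor may cancel: \<open>F\<close>
        and \<open>frob\<close> vanish there, so \<open>num\<close> has the derivative of
        \<open>cub\<close>, hence a simple zero.\<close>
      case True
      have "mult_at z = 1" using True by (simp add: mult_at_def)
      then have "[:- z, 1:] dvd A" unfolding A_def using z
        by (intro dvd_trans[OF _ dvd_prodI[OF finite_Fp z]]) simp
      then have "poly A z = 0" using poly_eq_0_iff_dvd by blast
      then have "poly (pderiv num) z = 0" using h unfolding C pderiv_mult by simp
      moreover have "poly (pderiv num) z = poly (pderiv cub) z"
      proof -
        have "poly F z = 0" using True nn_ge_2 by (simp add: F_def poly_power power_0_left)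
        moreover have "poly (pderiv (frob^2)) z = 0" using fz by (simp add: power2_eq_square pderiv_mult)
        ultimately show ?thesis unfolding num_def u_def pderiv_diff pderiv_mult
          using True fz by (simp add: poly_power)
      qed
      ultimately show False using cub_separable[OF True] by simp
    qed
  qed
  have frob0: "frob \<noteq> 0" using A0 B0 AB by auto
  have val: "rf cub * (slope (rf cub) (rf [:-264:]) (rf [:0, 1:]) 1 (rf (monom 1 p)) (- rf F))^2
      - rf [:0, 1:] - rf (monom 1 p) = rf C / rf B"
  proof -
    have ne: "rf [:0, 1::'a:] \<noteq> rf (monom 1 p)" using frob0 by (simp add: frob_def)
    define y where "y = rf (monom 1 p) - rf [:0, 1::'a:]"
    have y: "y = rf frob" by (simp add: y_def frob_def rf_hom)
    have y0: "y \<noteq> 0" using frob0 y by simp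
    have sl: "slope (rf cub) (rf [:-264:]) (rf [:0, 1:]) 1 (rf (monom 1 p)) (- rf F) = (- rf F - 1) / y"
      using ne by (simp add: slope_def y_def)
    have frac: "d * (k / y)^2 - s - t = (d * k^2 - (t + s) * y^2) / y^2" for d k s t :: "'a poly fract"
      using y0 by (simp add: power_divide field_simps)
    have "rf cub * (slope (rf cub) (rf [:-264:]) (rf [:0, 1:]) 1 (rf (monom 1 p)) (- rf F))^2
      - rf [:0, 1:] - rf (monom 1 p) = (rf cub * (- rf F - 1)^2 - (rf (monom 1 p) + rf [:0, 1:]) * y^2) / y^2"
      unfolding sl by (rule frac)
    also have "rf cub * (- rf F - 1)^2 = rf cub * (rf F + 1)^2" by Groebner_Basis.algebra
    also have "rf cub * (rf F + 1)^2 - (rf (monom 1 p) + rf [:0, 1:]) * y^2 = rf num"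
      unfolding y num_def u_def by (simp add: rf_hom)
    also have "y^2 = rf A * rf B" unfolding y by (simp add: AB flip: rf_hom)
    finally show ?thesis using A0 by (simp add: C rf_hom)
  qed
  have "degree B < degree C" using dB dC Mp by linarith
  then have "ratdeg (rf C / rf B) (degree C)" unfolding ratdeg_def using B0 nc by blast
  moreover have "pt_id \<otimes>\<^bsub>E.grp\<^esub> pneg pt_frob =
      padd (rf cub) (rf [:-264:]) (Aff (rf [:0, 1:]) 1) (Aff (rf (monom 1 p)) (- rf F))"
    by (simp add: pt_id_def pt_frob_def F_def)
  moreover have "rf [:0, 1::'a:] \<noteq> rf (monom 1 p)" using frob0 by (simp add: frob_def)
  ultimately have "pdeg (pt_id \<otimes>\<^bsub>E.grp\<^esub> pneg pt_frob) (degree C)"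
    using val by (simp add: pdeg_def Let_def)
  then have "E.deg_pt (pt_id \<otimes>\<^bsub>E.grp\<^esub> pneg pt_frob) = 2 * p + 1 - M"
    unfolding dC by (rule E.deg_ptI)
  then show ?thesis using Mp by (simp add: M_def of_nat_diff)
qed

text \<open>If \<open>m + n w\<close> has norm \<open>p\<close> and vanishes in characteristic \<open>p\<close>, it acts as plus or minus
  the Frobenius, so the number of points over the prime field is the norm of \<open>1 \<mp> (m + n w)\<close>.\<close>

lemma hasse_ordinary:
  assumes p7: "p \<noteq> 7" and norm: "m^2 + m * n + 3 * n^2 = int p"
  shows "hasse^2 = of_int ((2 * m + n)^2)"
proof -
  \<comment> \<open>If \<open>p\<close> divided \<open>n\<close>, it would divide \<open>m\<close>
    too, and the norm would be divisible by \<open>p^2\<close>.\<close>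
  have n0: "of_int n \<noteq> (0::'a)"
  proof
    assume "of_int n = (0::'a)"
    then have "int p dvd n" using of_int_eq_0_iff_char_dvd[of n, where 'a='a] by (simp add: char)
    then have n: "int p dvd 3 * n^2 + m * n" by (simp add: power2_eq_square)
    have "m^2 = int p - (3 * n^2 + m * n)" using norm by simp
    then have "int p dvd m^2" using n by simp
    moreover have "prime (int p)" using prime by simp
    ultimately have "int p dvd m" by (rule prime_dvd_power[rotated])
    then obtain m' n' where "m = int p * m'" "n = int p * n'" using \<open>int p dvd n\<close> by (auto elim!: dvdE)
    then have "int p * (int p * (m'^2 + m' * n' + 3 * n'^2)) = int p * 1"
      using norm by (simp add: power2_eq_square algebra_simps)
    then have "int p * (m'^2 + m' * n' + 3 * n'^2) = 1" using p_gt_3 mult_left_cancel[of "int p"] by auto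
    then have "int p dvd 1" by (metis dvd_triv_left)
    then show False using p_gt_3 by simp
  qed
  \<comment> \<open>Taking this root of \<open>w^2 = w - 3\<close> selects the prime above
    \<open>p\<close> that contains \<open>m + n w\<close>; the differential of
    \<open>lat w m n\<close> then vanishes.\<close>
  define w where "w = - of_int m / (of_int n :: 'a)"
  have mw: "of_int m + of_int n * w = 0" using n0 by (simp add: w_def)
  have "of_int (m^2 + m * n + 3 * n^2) = (0::'a)" unfolding norm using of_nat_0_iff[of p] by simp
  moreover have m: "of_int m = - of_int n * w" using mw by (simp add: add_eq_0_iff2)
  ultimately have "of_int n^2 * (w^2 - (w - 3)) = 0"
    by (simp add: m power2_eq_square algebra_simps)
  then have w: "w^2 = w - 3" using n0 by simp
  let ?t = "2 * m + n"
  have key: "hasse = 1 - of_int d"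
    if "int (E.deg_pt (pt_id \<otimes>\<^bsub>E.grp\<^esub> pneg pt_frob)) = d" for d
  proof -
    have "of_int d = (of_int (2 * int p + 1 - (\<Sum>z\<in>Fp. int (mult_at z))) :: 'a)"
      using that deg_minus_frobenius by simp
    also have "\<dots> = 1 - of_nat (\<Sum>z\<in>Fp. mult_at z)"
      using of_nat_0_iff[of p] by simp
    finally show ?thesis unfolding of_nat_sum_mult_at by simp
  qed
  have lat1: "pt_id \<otimes>\<^bsub>E.grp\<^esub> lat w i j = lat w (1 + i) j" for i j
    using pt_id_carrier pt_iso_carrier[OF w] unfolding lat_def
    by (simp add: E.int_pow_mult E.m_assoc del: E.grp_simps)
  have latneg: "pneg (lat w i j) = lat w (- i) (- j)" for i j
  proof -
    have "pneg (lat w i j) = inv\<^bsub>E.grp\<^esub> (lat w i j)" using E.inv_grp lat_carrier[OF w] by simp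
    then show ?thesis using pt_id_carrier pt_iso_carrier[OF w] unfolding lat_def
      by (simp add: E.int_pow_neg E.inv_mult del: E.grp_simps)
  qed
  have dl: "int (E.deg_pt (lat w (1 + i) j)) = 1 + 2 * i + j + (i^2 + i * j + 3 * j^2)" for i j
    using deg_lat[OF w, of "1 + i" j] by (simp add: power2_eq_square algebra_simps)
  have p0: "of_nat p = (0::'a)" using of_nat_0_iff by simp
  from lat_frobenius[OF p7 w norm mw] show ?thesis
  proof
    assume "lat w m n = pt_frob"
    then have "pt_id \<otimes>\<^bsub>E.grp\<^esub> pneg pt_frob = lat w (1 + (- m)) (- n)"
      using latneg[of m n] lat1 by metis
    then have "int (E.deg_pt (pt_id \<otimes>\<^bsub>E.grp\<^esub> pneg pt_frob)) = 1 - ?t + int p"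
      using dl[of "- m" "- n"] norm by simp
    then have "hasse = 1 - of_int (1 - ?t + int p)" by (rule key)
    then show ?thesis using p0 by simp
  next
    assume "lat w m n = pneg pt_frob"
    then have "pt_id \<otimes>\<^bsub>E.grp\<^esub> pneg pt_frob = lat w (1 + m) n"
      using lat1 by metis
    then have "int (E.deg_pt (pt_id \<otimes>\<^bsub>E.grp\<^esub> pneg pt_frob)) = 1 + ?t + int p"
      using dl[of m n] norm by simp
    then have "hasse = 1 - of_int (1 + ?t + int p)" by (rule key)
    then have h: "hasse = - of_int ?t" using p0 by simp
    show ?thesis unfolding h by (simp only: power2_minus of_int_power)
  qed
qed

text \<open>Up to the unit \<open>Suc k\<close> the series is a derivative, and the coefficient of
  index \<open>p - 1\<close> of a derivative carries the factor \<open>p\<close>.\<close>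

lemma fps_deriv_power_nth:
  fixes r :: "'a fps"
  assumes "\<not> p dvd Suc k"
  shows "(r ^ k * fps_deriv r) $ (p - 1) = 0"
proof -
  have "of_nat (Suc k) * (r ^ k * fps_deriv r) = fps_deriv (r ^ Suc k)"
    by (simp only: fps_deriv_power diff_Suc_1 fps_of_nat mult_ac)
  then have "(of_nat (Suc k) * (r ^ k * fps_deriv r)) $ (p - 1) = of_nat p * (r ^ Suc k) $ p"
    using p_gt_3 by (simp only: fps_deriv_nth) simp
  moreover have "of_nat p = (0::'a)" using of_nat_0_iff by simp
  ultimately have "of_nat (Suc k) * (r ^ k * fps_deriv r) $ (p - 1) = 0"
    by (simp only: fps_of_nat[symmetric] fps_mult_left_const_nth) simp
  then show ?thesis using assms of_nat_0_iff[of "Suc k"] by (simp only: mult_eq_0_iff) simp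
qed

text \<open>Taking the coefficient of index \<open>p - 1\<close> plays the role of the Cartier
  operator: after a substitution only the exponent \<open>p - 1\<close> survives, multiplied by the
  \<open>p\<close>-th power of the linear coefficient. The bound on \<open>k\<close> stops before
  \<open>2 * p - 1\<close>, the next exponent with \<open>Suc k\<close> divisible by
  \<open>p\<close>.\<close>

lemma fps_power_deriv_coeff:
  fixes r :: "'a fps"
  assumes r: "r $ 0 = 0" and k: "k < 2 * p - 1"
  shows "((fps_const y + r) ^ k * fps_deriv r) $ (p - 1) = (if k = p - 1 then (r $ 1) ^ p else 0)"
proof (cases "k = p - 1")
  case False
  have "\<not> p dvd Suc k"
  proof
    assume "p dvd Suc k"
    then obtain m where m: "Suc k = p * m" by (rule dvdE)
    have "m \<noteq> 0" by (rule notI) (use m in simp)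
    moreover have "m \<noteq> 1" by (rule notI) (use m False in simp)
    ultimately have "2 \<le> m" by linarith
    then have "p * 2 \<le> p * m" by (rule mult_le_mono2)
    then show False using m k by linarith
  qed
  from fps_deriv_power_nth[OF this, of "fps_const y + r"] show ?thesis using False by simp
next
  case True
  have "(fps_const y + r) ^ k * fps_deriv r =
      (\<Sum>i\<le>k. of_nat (k choose i) * (fps_const y ^ (k - i) * (r ^ i * fps_deriv r)))"
    using binomial_ring[of r "fps_const y" k] by (simp add: add.commute sum_distrib_left mult_ac)
  then have "((fps_const y + r) ^ k * fps_deriv r) $ (p - 1) =
      (\<Sum>i\<le>k. (fps_const (of_nat (k choose i) * y ^ (k - i)) * (r ^ i * fps_deriv r)) $ (p - 1))"
    by (simp add: fps_sum_nth fps_const_power mult.assoc flip: fps_of_nat fps_const_mult)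
  also have "\<dots> = (\<Sum>i\<in>{k}. (fps_const (of_nat (k choose i) * y ^ (k - i)) * (r ^ i * fps_deriv r)) $ (p - 1))"
  proof (rule sum.mono_neutral_right)
    show "\<forall>i\<in>{..k} - {k}. (fps_const (of_nat (k choose i) * y ^ (k - i)) * (r ^ i * fps_deriv r)) $ (p - 1) = 0"
    proof
      fix i assume "i \<in> {..k} - {k}"
      then have "Suc i < p" using True p_gt_3 by auto
      then have "\<not> p dvd Suc i" by (simp add: nat_dvd_not_less)
      then show "(fps_const (of_nat (k choose i) * y ^ (k - i)) * (r ^ i * fps_deriv r)) $ (p - 1) = 0"
        by (simp only: fps_mult_left_const_nth fps_deriv_power_nth mult_zero_right not_False_eq_True)
    qed
  qed auto
  also have "\<dots> = (r ^ k * fps_deriv r) $ k" using True by simp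
  also have "\<dots> = (\<Sum>i\<in>{k}. (r ^ k) $ i * fps_deriv r $ (k - i))"
    unfolding fps_mult_nth
    by (rule sum.mono_neutral_right) (use startsby_zero_power_prefix[OF r, of k] in auto)
  also have "\<dots> = (r $ 1) ^ k * r $ 1"
    using startsby_zero_power_nth_same[OF r, of k] by simp
  also have "\<dots> = (r $ 1) ^ p" using True p_gt_3 by (metis Suc_pred' gr_implies_not0 neq0_conv power_Suc2 less_trans)
  finally show ?thesis using True by simp
qed

text \<open>Evaluation rather than composition of power series, because the argument may have a
  nonzero constant term.\<close>

definition fev :: "'a poly \<Rightarrow> 'a fps \<Rightarrow> 'a fps" where
  "fev q r = (\<Sum>k\<le>degree q. fps_const (coeff q k) * r ^ k)"

lemma fev_alt: "fev q r = poly (map_poly fps_const q) r"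
  by (simp add: fev_def poly_altdef degree_map_poly coeff_map_poly)

lemma fev_mult: "fev (q1 * q2) r = fev q1 r * fev q2 r"
proof -
  interpret map_poly_comm_ring_hom "fps_const :: 'a \<Rightarrow> 'a fps"
    by unfold_locales (simp_all flip: fps_const_add fps_const_mult)
  show ?thesis by (simp add: fev_alt hom_mult)
qed

lemma fev_power: "fev (q ^ n) r = fev q r ^ n"
  by (induction n) (simp_all add: fev_mult, simp add: fev_def)

lemma fev_cub: "fev cub r = r^3 - 264 * r + 1694"
proof -
  have "fev cub r = fps_const 1694 + fps_const (- 264) * r + r^3"
    by (simp add: fev_alt cub_def map_poly_pCons power3_eq_cube algebra_simps)
  also have "fps_const (1694::'a) = 1694" by (rule fps_numeral_fps_const[symmetric])
  also have "fps_const (- 264::'a) = - 264" by (simp add: fps_numeral_fps_const flip: fps_const_neg)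
  finally show ?thesis by simp
qed

lemma fev_coeff:
  assumes r: "r $ 0 = 0" and q: "degree q < 2 * p - 1"
  shows "(fev q (fps_const y + r) * fps_deriv r) $ (p - 1) = coeff q (p - 1) * (r $ 1) ^ p"
proof -
  have "(fev q (fps_const y + r) * fps_deriv r) $ (p - 1) =
      (\<Sum>k\<le>degree q. coeff q k * ((fps_const y + r) ^ k * fps_deriv r) $ (p - 1))"
    by (simp add: fev_def sum_distrib_right fps_sum_nth mult.assoc)
  also have "\<dots> = (\<Sum>k\<le>degree q. if k = p - 1 then coeff q k * (r $ 1) ^ p else 0)"
  proof (rule sum.cong)
    fix k assume "k \<in> {..degree q}"
    then have "k < 2 * p - 1" using q by simp
    then show "coeff q k * ((fps_const y + r) ^ k * fps_deriv r) $ (p - 1) =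
        (if k = p - 1 then coeff q k * (r $ 1) ^ p else 0)"
      by (simp only: fps_power_deriv_coeff[OF r]) simp
  qed simp
  also have "\<dots> = coeff q (p - 1) * (r $ 1) ^ p"
    by (simp add: coeff_eq_0)
  finally show ?thesis .
qed

text \<open>The isogeny \<open>w\<close> fixes the point with \<open>x = 10 + 2 w\<close>, since that point generates the
  kernel of \<open>1 - w\<close>. Comparing coefficients of index \<open>p - 1\<close> in the pullback of the invariant
  differential, expanded around this point, gives \<open>hasse * w ^ p = w * hasse\<close>.\<close>

lemma hasse_supersingular:
  assumes w: "w^2 = w - (3::'a)" and wp: "w ^ p \<noteq> w"
  shows "hasse = 0"
proof -
  define v :: "'a fps" where "v = fps_const w"
  define x :: "'a fps" where "x = fps_const (10 + 2 * w) + fps_X"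
  define z where "z = x - (12 - 2 * v)"
  define t where "t = 264 - 264 * v"
  define u where "u = - 616 - 704 * v"
  have num: "fps_const (numeral k :: 'a) = numeral k" for k
    by (rule fps_numeral_fps_const[symmetric])
  have v2: "v^2 = v - 3"
  proof -
    have "v^2 = fps_const (w - 3)" by (simp add: v_def fps_const_power w)
    then show ?thesis by (simp add: v_def num flip: fps_const_sub)
  qed
  \<comment> \<open>The fixed abscissa \<open>10 + 2 * w\<close> minus the kernel abscissa
    \<open>12 - 2 * w\<close>. Its square is -44, so the isogeny has no pole at the fixed point and
    expands as a power series.\<close>
  define dl where "dl = 4 * w - 2"
  have z: "z = fps_const dl + fps_X"
    by (simp add: z_def x_def v_def dl_def num flip: fps_const_add fps_const_mult fps_const_sub)
  have dl2: "dl^2 = - 44"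
  proof -
    have "dl^2 = 16 * (w^2 - (w - 3)) - 44" unfolding dl_def by Groebner_Basis.algebra
    then show ?thesis using w by simp
  qed
  have "(44::'a) = 2 * 2 * 11" by simp
  then have "(44::'a) \<noteq> 0" using nz2 nz11 by (metis mult_eq_0_iff)
  then have dl0: "dl \<noteq> 0" using dl2 by auto
  have z0: "z $ 0 = dl" by (simp add: z)
  have n3: "(9::'a) \<noteq> 0" "(27::'a) \<noteq> 0"
  proof -
    have "(9::'a) = 3 * 3" "(27::'a) = 3 * 3 * 3" by simp_all
    then show "(9::'a) \<noteq> 0" "(27::'a) \<noteq> 0" using nz3 by (metis mult_eq_0_iff)+
  qed
  define R where "R = (1 - v)^2 * (x * z^2 + t * z + u) * inverse (9 * z^2)"
  define S where "S = (1 - v)^3 * (z^3 - t * z - 2 * u) * inverse (27 * z^3)"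
  have u9: "(9 * z^2) $ 0 \<noteq> 0" "(27 * z^3) $ 0 \<noteq> 0"
    using n3 dl0 z0 by (simp_all add: fps_nth_power_0 flip: num)
  have R: "9 * z^2 * R = (1 - v)^2 * (x * z^2 + t * z + u)"
    unfolding R_def using inverse_mult_eq_1[OF u9(1)] by (simp add: mult_ac)
  have S: "27 * z^3 * S = (1 - v)^3 * (z^3 - t * z - 2 * u)"
    unfolding S_def using inverse_mult_eq_1[OF u9(2)] by (simp add: mult_ac)
  have nz: "z \<noteq> 0" "9 * z^2 \<noteq> 0" "27 * z^3 \<noteq> 0" using u9 z0 dl0 by auto
  have "(9 * z^2)^3 * ((x^3 - 264 * x + 1694) * S^2) = (x^3 - 264 * x + 1694) * (27 * z^3 * S)^2"
    by Groebner_Basis.algebra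
  also have "\<dots> = (9 * z^2 * R)^3 - 264 * 81 * (9 * z^2 * R) * z^4 + 1694 * 729 * z^6"
    unfolding S R by (rule cm_identity1[OF v2, of x, folded z_def t_def u_def])
  also have "\<dots> = (9 * z^2)^3 * (R^3 - 264 * R + 1694)" by Groebner_Basis.algebra
  finally have curve: "R^3 - 264 * R + 1694 = (x^3 - 264 * x + 1694) * S^2"
    using nz by (simp only: mult_cancel_left power_eq_0_iff) auto
  have dx: "fps_deriv x = 1" "fps_deriv z = 1" by (simp_all add: x_def z)
  have dv: "fps_deriv v = 0" by (simp add: v_def)
  have dn: "fps_deriv (numeral k :: 'a fps) = 0" for k by (simp flip: num)
  have dtu: "fps_deriv t = 0" "fps_deriv u = 0"
    by (simp_all add: t_def u_def dv dn)
  have "fps_deriv (9 * z^2 * R) = fps_deriv ((1 - v)^2 * (x * z^2 + t * z + u))"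
    by (simp only: R)
  then have D: "18 * z * R + 9 * z^2 * fps_deriv R = (1 - v)^2 * (z^2 + 2 * x * z + t)"
    by (simp add: dx dv dn dtu fps_deriv_power power2_eq_square algebra_simps)
  have "27 * z^3 * fps_deriv R = 3 * z * (9 * z^2 * fps_deriv R)" by Groebner_Basis.algebra
  also have "\<dots> = 3 * z * ((1 - v)^2 * (z^2 + 2 * x * z + t)) - 6 * (9 * z^2 * R)"
    unfolding D[symmetric] by Groebner_Basis.algebra
  also have "\<dots> = v * (27 * z^3 * S)"
    unfolding R S using v2 unfolding t_def u_def z_def by Groebner_Basis.algebra
  also have "\<dots> = 27 * z^3 * (v * S)" by (simp only: mult_ac)
  finally have dR: "fps_deriv R = v * S" using nz by (simp only: mult_cancel_left) simp
  have R0: "R $ 0 = 10 + 2 * w"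
  proof -
    have "(9 * z^2 * R) $ 0 = ((1 - v)^2 * (x * z^2 + t * z + u)) $ 0" by (simp only: R)
    then have "9 * dl^2 * R $ 0 = (1 - w)^2 * ((10 + 2 * w) * dl^2 + (264 - 264 * w) * dl + (- 616 - 704 * w))"
      by (simp add: fps_nth_power_0 z0 x_def t_def u_def v_def flip: num)
    also have "\<dots> = 9 * dl^2 * (10 + 2 * w)"
      using w unfolding dl_def by Groebner_Basis.algebra
    finally show ?thesis using n3 dl0 by simp
  qed
  have S0: "S $ 0 = 1"
  proof -
    have "(27 * z^3 * S) $ 0 = ((1 - v)^3 * (z^3 - t * z - 2 * u)) $ 0" by (simp only: S)
    then have "27 * dl^3 * S $ 0 = (1 - w)^3 * (dl^3 - (264 - 264 * w) * dl - 2 * (- 616 - 704 * w))"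
      by (simp add: fps_nth_power_0 z0 x_def t_def u_def v_def flip: num)
    also have "\<dots> = 27 * dl^3 * 1"
      using w unfolding dl_def by Groebner_Basis.algebra
    finally show ?thesis using n3 dl0 by simp
  qed
  \<comment> \<open>\<open>S\<close> has constant term 1, so \<open>S ^ p\<close> differs from 1
    only in degrees at least \<open>p\<close>.\<close>
  have Sp: "(q * S ^ p) $ (p - 1) = q $ (p - 1)" for q
  proof -
    have "CHAR('a fps) = p" using char by simp
    then have fr: "(a + b :: 'a fps) ^ p = a ^ p + b ^ p" for a b
      by (intro freshmans_dream) (simp_all add: prime)
    obtain s where s: "S = 1 + fps_X * s"
    proof
      show "S = 1 + fps_X * fps_shift 1 S"
        using fps_shift_times_fps_X'[of "S - 1"] S0 by (intro fps_ext) (auto simp: fps_X_mult_nth)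
    qed
    have "S ^ p = 1 + fps_X ^ p * s ^ p" unfolding s fr by (simp add: power_mult_distrib)
    then have "q * S ^ p = q + fps_X ^ p * (q * s ^ p)" by (simp add: algebra_simps)
    then show ?thesis using p_gt_3 by (simp add: fps_X_power_mult_nth)
  qed
  define G where "G = cub ^ nn"
  have dG: "degree G < 2 * p - 1"
    unfolding G_def using degree_power_le[of cub nn] degree_cub nn_ge_2 p_odd by simp
  have "(fev G R * fps_deriv R) $ (p - 1) = hasse * w ^ p"
  proof -
    have 0: "(R - fps_const (10 + 2 * w)) $ 0 = 0" by (simp add: R0)
    have 1: "(R - fps_const (10 + 2 * w)) $ 1 = w"
    proof -
      have "fps_deriv R $ 0 = w" by (simp add: dR v_def S0)
      then show ?thesis by simp
    qed
    have "(fev G R * fps_deriv R) $ (p - 1) = (fev G (fps_const (10 + 2 * w) + (R - fps_const (10 + 2 * w)))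
       * fps_deriv (R - fps_const (10 + 2 * w))) $ (p - 1)" by simp
    also have "\<dots> = hasse * w ^ p"
      unfolding fev_coeff[OF 0 dG] 1 by (simp add: G_def hasse_def)
    finally show ?thesis .
  qed
  \<comment> \<open>The power \<open>nn\<close> of \<open>curve\<close> contributes \<open>S\<close>
    to the power \<open>2 * nn\<close>; \<open>dR\<close> supplies the last factor \<open>S\<close>
    and the factor \<open>v\<close>.\<close>
  moreover have "fev G R * fps_deriv R = v * (fev G x * S ^ p)"
    unfolding G_def fev_power fev_cub curve dR power_p by (simp add: power_mult_distrib mult_ac flip: power_mult)
  moreover have "(v * (fev G x * S ^ p)) $ (p - 1) = w * hasse"
  proof -
    have "(fev G x * fps_deriv fps_X) $ (p - 1) = hasse"
      unfolding x_def using fev_coeff[OF _ dG, of fps_X "10 + 2 * w"] by (simp add: G_def hasse_def)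
    then have "(fev G x * S ^ p) $ (p - 1) = hasse" by (simp only: Sp) simp
    then show ?thesis by (simp only: v_def fps_mult_left_const_nth)
  qed
  ultimately have "hasse * w ^ p = w * hasse" by (simp only:)
  then have "hasse * (w ^ p - w) = 0" by (simp add: right_diff_distrib mult.commute)
  then show ?thesis using wp by simp
qed

end

section \<open>The sum as the square of the Hasse invariant\<close>

lemma choose_Suc_field:
  "of_nat (n choose Suc j) * of_nat (Suc j) = of_nat (n choose j) * (of_nat n - of_nat j :: 'b::comm_ring_1)"
proof (cases "j \<le> n")
  case True
  have "(n choose Suc j) * Suc j = (n choose j) * (n - j)"
    by (metis binomial_absorb_comp binomial_absorption mult.commute)
  then show ?thesis using True by (metis of_nat_diff of_nat_mult)
qed (simp add: binomial_eq_0)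

lemma choose_step_3:
  "of_nat (n choose (j + 3)) * (of_nat (j + 1) * of_nat (j + 2) * of_nat (j + 3)) =
    of_nat (n choose j) * ((of_nat n - of_nat j) * (of_nat n - of_nat j - 1) * (of_nat n - of_nat j - 2) :: 'b::comm_ring_1)"
proof -
  have e: "j + 3 = Suc (j + 2)" "j + 2 = Suc (j + 1)" "j + 1 = Suc j" by simp_all
  have 1: "of_nat (n choose (j + 3)) * of_nat (j + 3) = of_nat (n choose (j + 2)) * (of_nat n - of_nat j - 2 :: 'b)"
    using choose_Suc_field[of n "j + 2", where 'b='b] by (simp add: e(1) algebra_simps)
  have 2: "of_nat (n choose (j + 2)) * of_nat (j + 2) = of_nat (n choose (j + 1)) * (of_nat n - of_nat j - 1 :: 'b)"
    using choose_Suc_field[of n "j + 1", where 'b='b] by (simp add: e(2) algebra_simps)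
  have 3: "of_nat (n choose (j + 1)) * of_nat (j + 1) = of_nat (n choose j) * (of_nat n - of_nat j :: 'b)"
    using choose_Suc_field[of n j, where 'b='b] by simp
  have "of_nat (n choose (j + 3)) * (of_nat (j + 1) * of_nat (j + 2) * of_nat (j + 3)) =
      (of_nat (n choose (j + 3)) * of_nat (j + 3)) * of_nat (j + 2) * (of_nat (j + 1) :: 'b)"
    by (simp only: mult_ac)
  also have "\<dots> = (of_nat (n choose (j + 2)) * of_nat (j + 2)) * of_nat (j + 1) * (of_nat n - of_nat j - 2)"
    unfolding 1 by (simp only: mult_ac)
  also have "\<dots> = (of_nat (n choose (j + 1)) * of_nat (j + 1)) * (of_nat n - of_nat j - 1) * (of_nat n - of_nat j - 2)"
    unfolding 2 by (simp only: mult_ac)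
  finally show ?thesis unfolding 3 by (simp only: mult_ac)
qed

definition tri :: "nat \<Rightarrow> nat" where "tri k = ((2 * k) choose k) * ((3 * k) choose k)"

lemma tri_fact: "tri k * fact k ^ 3 = fact (3 * k)"
proof -
  have "fact k * fact k * ((2 * k) choose k) = (fact (2 * k) :: nat)"
    using binomial_fact_lemma[of k "2 * k"] by simp
  moreover have "fact k * fact (2 * k) * ((3 * k) choose k) = (fact (3 * k) :: nat)"
    using binomial_fact_lemma[of k "3 * k"] by simp
  ultimately have "fact k * (fact k * fact k * ((2 * k) choose k)) * ((3 * k) choose k) = (fact (3 * k) :: nat)"
    by simp
  then show ?thesis by (simp add: tri_def power3_eq_cube mult_ac)
qed

lemma tri_Suc: "tri (Suc k) * (k + 1)^3 = tri k * ((3 * k + 1) * (3 * k + 2) * (3 * k + 3))"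
proof -
  have f: "fact (3 * Suc k) = (3 * k + 3) * (3 * k + 2) * (3 * k + 1) * (fact (3 * k) :: nat)"
  proof -
    have "3 * Suc k = Suc (Suc (Suc (3 * k)))" by simp
    then show ?thesis by (simp only: fact_Suc of_nat_id) (simp add: algebra_simps)
  qed
  have fS: "fact (Suc k) = (k + 1) * (fact k :: nat)" by simp
  have "fact k ^ 3 * (tri (Suc k) * (k + 1)^3) = tri (Suc k) * (fact (Suc k) :: nat)^3"
    unfolding fS power_mult_distrib by (simp only: mult_ac)
  also have "\<dots> = (3 * k + 3) * (3 * k + 2) * (3 * k + 1) * (tri k * fact k ^ 3)"
    unfolding tri_fact f ..
  also have "\<dots> = fact k ^ 3 * (tri k * ((3 * k + 1) * (3 * k + 2) * (3 * k + 3)))"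
    by (simp only: mult_ac)
  finally show ?thesis by (simp only: mult_cancel1) (simp add: fact_nonzero)
qed

lemma W_tri: "W n = (\<Sum>k\<le>n. int (tri k) * int (n choose (3 * k)) * (- 3) ^ (n - 3 * k))"
proof -
  have "W n = (\<Sum>k=0..n div 3. int (tri k) * int (n choose (3 * k)) * (- 3) ^ (n - 3 * k))"
    by (simp add: W_def tri_def)
  also have "\<dots> = (\<Sum>k\<le>n. int (tri k) * int (n choose (3 * k)) * (- 3) ^ (n - 3 * k))"
  proof (rule sum.mono_neutral_left)
    show "{0..n div 3} \<subseteq> {..n}" by (auto intro: order.trans[OF _ div_le_dividend])
    show "\<forall>k\<in>{..n} - {0..n div 3}. int (tri k) * int (n choose (3 * k)) * (- 3) ^ (n - 3 * k) = 0"
    proof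
      fix k assume "k \<in> {..n} - {0..n div 3}"
      then have "n < 3 * k" by auto
      then show "int (tri k) * int (n choose (3 * k)) * (- 3) ^ (n - 3 * k) = 0" by (simp add: binomial_eq_0)
    qed
  qed simp
  finally show ?thesis .
qed

text \<open>After \<open>l\<close> choices of the constant term,
  \<open>x ^ (n - l) * (x^2 + A) ^ (n - l)\<close> reaches exponent \<open>2 * n\<close> only
  through the \<open>j\<close>-th power of \<open>x^2\<close> with \<open>2 * j = n + l\<close>;
  hence the parity condition.\<close>

lemma coeff_cubic_power:
  fixes A B :: "'b::comm_ring_1"
  shows "coeff ([:B, A, 0, 1:] ^ n) (2 * n) =
    (\<Sum>l\<le>n. if even (n + l) then of_nat (n choose l) * B ^ l * (of_nat ((n - l) choose ((n + l) div 2))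
        * A ^ (n - l - (n + l) div 2)) else 0)"
proof -
  have c: "[:B, A, 0, 1:] = [:B:] + monom 1 1 * (monom 1 2 + [:A:])"
    by (simp add: monom_altdef power2_eq_square)
  have q: "(monom 1 1 * (monom 1 2 + [:A:])) ^ m = (\<Sum>j\<le>m. monom (of_nat (m choose j) * A ^ (m - j)) (m + 2 * j))" for m
  proof -
    have "(monom 1 2 + [:A:]) ^ m = (\<Sum>j\<le>m. of_nat (m choose j) * monom 1 2 ^ j * [:A:] ^ (m - j))"
      by (rule binomial_ring)
    also have "\<dots> = (\<Sum>j\<le>m. monom (of_nat (m choose j) * A ^ (m - j)) (2 * j))"
      by (intro sum.cong refl)
         (simp add: monom_power poly_const_pow of_nat_poly smult_monom mult.commute)
    finally show ?thesis
      by (simp add: power_mult_distrib monom_power sum_distrib_left mult_monom)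
  qed
  have "coeff ([:B, A, 0, 1:] ^ n) (2 * n) = (\<Sum>l\<le>n. of_nat (n choose l) * B ^ l *
      coeff ((monom 1 1 * (monom 1 2 + [:A:])) ^ (n - l)) (2 * n))"
    unfolding c binomial_ring
    by (simp add: coeff_sum poly_const_pow of_nat_poly mult_ac)
  also have "\<dots> = (\<Sum>l\<le>n. if even (n + l) then of_nat (n choose l) * B ^ l * (of_nat ((n - l) choose ((n + l) div 2))
        * A ^ (n - l - (n + l) div 2)) else 0)"
  proof (rule sum.cong)
    fix l assume l: "l \<in> {..n}"
    have "coeff ((monom 1 1 * (monom 1 2 + [:A:])) ^ (n - l)) (2 * n) =
        (\<Sum>j\<le>n - l. if 2 * j = n + l then of_nat ((n - l) choose j) * A ^ (n - l - j) else 0)"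
      unfolding q coeff_sum using l by (intro sum.cong) auto
    also have "\<dots> = (if even (n + l) then of_nat ((n - l) choose ((n + l) div 2)) * A ^ (n - l - (n + l) div 2) else 0)"
    proof (cases "even (n + l)")
      case True
      then have "2 * j = n + l \<longleftrightarrow> j = (n + l) div 2" for j by auto
      then show ?thesis using True by (simp add: binomial_eq_0 not_le)
    next
      case False
      then have "2 * j \<noteq> n + l" for j by (metis dvd_triv_left)
      then show ?thesis using False by simp
    qed
    finally show "of_nat (n choose l) * B ^ l * coeff ((monom 1 1 * (monom 1 2 + [:A:])) ^ (n - l)) (2 * n) =
      (if even (n + l) then of_nat (n choose l) * B ^ l * (of_nat ((n - l) choose ((n + l) div 2))
        * A ^ (n - l - (n + l) div 2)) else 0)" by simp
  qed simp
  finally show ?thesis .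
qed

section \<open>Legendre polynomial and Clausen's formula in characteristic \<open>p\<close>\<close>

context cm_field
begin

text \<open>In the field \<open>nn\<close> acts as -1/2, which turns binomial coefficients of
  \<open>nn\<close> into hypergeometric ones.\<close>

lemma two_nn: "2 * of_nat nn = (- 1 :: 'a)"
proof -
  have "of_nat p = (2 * of_nat nn + 1 :: 'a)" using arg_cong[OF p_odd, of "of_nat :: nat \<Rightarrow> 'a"] by simp
  moreover have "of_nat p = (0::'a)" using of_nat_0_iff by simp
  ultimately show ?thesis by (simp add: eq_neg_iff_add_eq_0)
qed

text \<open>\<open>leg_poly\<close> at \<open>s\<close> is the coefficient of \<open>x\<close> to the power \<open>2 nn\<close> in \<open>(x\<^sup>3 - 3 x + 2 s)\<close> to the
  power \<open>nn\<close>.\<close>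

definition leg :: "nat \<Rightarrow> 'a" where
  "leg l = (if even (nn + l) then of_nat (nn choose l) * 2 ^ l * (of_nat ((nn - l) choose ((nn + l) div 2))
     * (- 3) ^ (nn - l - (nn + l) div 2)) else 0)"

definition leg_poly :: "'a poly" where "leg_poly = (\<Sum>l\<le>nn. monom (leg l) l)"

lemma leg_large: "nn < l \<Longrightarrow> leg l = 0"
  by (simp add: leg_def binomial_eq_0)

lemma coeff_leg_poly: "coeff leg_poly l = leg l"
  by (cases "l \<le> nn") (simp_all add: leg_poly_def coeff_sum leg_large)

lemma leg_step: "36 * (of_nat (l + 1) * of_nat (l + 2)) * leg (l + 2) =
    (6 * of_nat l + 1) * (6 * of_nat l + 5) * leg l"
proof (cases "even (nn + l) \<and> l \<le> nn")
  case False
  then consider "odd (nn + l)" | "nn < l" by linarith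
  then have "leg l = 0 \<and> leg (l + 2) = 0"
  proof cases
    case 1
    then show ?thesis by (simp add: leg_def)
  next
    case 2
    then show ?thesis by (simp add: leg_large)
  qed
  then show ?thesis by (simp only: mult_zero_right)
next
  case True
  define j where "j = (nn + l) div 2"
  define m where "m = nn - l"
  define N where "N = (of_nat nn :: 'a)"
  define L where "L = (of_nat l :: 'a)"
  have j2: "2 * j = nn + l" using True by (auto simp: j_def)
  have J: "2 * of_nat j = N + L" using arg_cong[OF j2, of "of_nat :: nat \<Rightarrow> 'a"] by (simp add: N_def L_def)
  have M: "of_nat m = N - L" using True by (simp add: m_def N_def L_def of_nat_diff)
  have N: "2 * N = - 1" unfolding N_def by (rule two_nn)
  have j': "(nn + (l + 2)) div 2 = j + 1" and m': "nn - (l + 2) = m - 2"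
    using j2 by (auto simp: m_def)
  \<comment> \<open>The factor -27 makes up for the exponent that drops by 3; where truncated
    subtraction would break this, the binomial coefficient is zero.\<close>
  have pow: "of_nat ((m - 2) choose (j + 1)) * (- 27) * (- 3) ^ (m - 2 - (j + 1)) =
      of_nat ((m - 2) choose (j + 1)) * (- 3 :: 'a) ^ (m - j)"
  proof (cases "j + 1 \<le> m - 2")
    case True
    then have "m - j = (m - 2 - (j + 1)) + 3" by linarith
    then have "(- 3 :: 'a) ^ (m - j) = (- 3) ^ (m - 2 - (j + 1)) * (- 27)" by (simp only: power_add) simp
    then show ?thesis by simp
  qed (simp add: binomial_eq_0)
  have ch: "of_nat (nn choose (l + 2)) * (of_nat (l + 1) * of_nat (l + 2)) * (of_nat ((m - 2) choose (j + 1)) * of_nat (j + 1)) =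
      of_nat (nn choose l) * (of_nat (m choose j) * ((of_nat m - of_nat j) * (of_nat m - of_nat j - 1) * (of_nat m - of_nat j - 2) :: 'a))"
  proof (cases "2 \<le> m")
    case small: False
    have "nn choose (l + 2) = 0" using small True by (simp add: m_def binomial_eq_0)
    moreover have "of_nat (m choose j) * ((of_nat m - of_nat j) * (of_nat m - of_nat j - 1) * (of_nat m - of_nat j - 2) :: 'a) = 0"
    proof -
      consider "m < j" | "m = j" | "m = j + 1" using small by linarith
      then show ?thesis by cases (auto simp: binomial_eq_0)
    qed
    ultimately show ?thesis by (simp only: of_nat_0 mult_zero_left mult_zero_right)
  next
    case big: True
    have 1: "of_nat (nn choose (l + 1)) * of_nat (l + 1) = of_nat (nn choose l) * (of_nat m :: 'a)"
      using choose_Suc_field[of nn l, where 'b='a] by (simp add: M N_def L_def)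
    have 2: "of_nat (nn choose (l + 2)) * of_nat (l + 2) = of_nat (nn choose (l + 1)) * (of_nat m - 1 :: 'a)"
      using choose_Suc_field[of nn "l + 1", where 'b='a] by (simp add: M N_def L_def algebra_simps)
    have 3: "of_nat ((m - 2) choose (j + 1)) * of_nat (j + 1) = of_nat ((m - 2) choose j) * (of_nat m - 2 - of_nat j :: 'a)"
      using choose_Suc_field[of "m - 2" j, where 'b='a] big by (simp add: of_nat_diff)
    have c: "of_nat k * of_nat ((k - 1) choose j) = of_nat (k choose j) * (of_nat k - of_nat j :: 'a)" if "1 \<le> k" for k
    proof (cases "j \<le> k")
      case True
      have "k * ((k - 1) choose j) = (k choose j) * (k - j)" by (metis binomial_absorb_comp mult.commute)
      then show ?thesis using True by (metis of_nat_diff of_nat_mult)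
    qed (use that in \<open>simp add: binomial_eq_0\<close>)
    have 4: "of_nat m * of_nat ((m - 1) choose j) = of_nat (m choose j) * (of_nat m - of_nat j :: 'a)"
      using c[of m] big by simp
    have 5: "(of_nat m - 1) * of_nat ((m - 2) choose j) = of_nat ((m - 1) choose j) * (of_nat m - 1 - of_nat j :: 'a)"
      using c[of "m - 1"] big by (simp add: of_nat_diff numeral_2_eq_2)
    have "of_nat (nn choose (l + 2)) * (of_nat (l + 1) * of_nat (l + 2)) * (of_nat ((m - 2) choose (j + 1)) * of_nat (j + 1)) =
      (of_nat (nn choose (l + 2)) * of_nat (l + 2)) * of_nat (l + 1) * (of_nat ((m - 2) choose (j + 1)) * of_nat (j + 1) :: 'a)"
      by (simp only: mult_ac)
    also have "\<dots> = (of_nat (nn choose (l + 1)) * of_nat (l + 1)) * (of_nat m - 1) * (of_nat ((m - 2) choose j) * (of_nat m - 2 - of_nat j))"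
      unfolding 2 3 by (simp only: mult_ac)
    also have "\<dots> = of_nat (nn choose l) * of_nat m * ((of_nat m - 1) * of_nat ((m - 2) choose j)) * (of_nat m - 2 - of_nat j)"
      unfolding 1 by (simp only: mult_ac)
    also have "\<dots> = of_nat (nn choose l) * (of_nat m * of_nat ((m - 1) choose j)) * (of_nat m - 1 - of_nat j) * (of_nat m - 2 - of_nat j)"
      unfolding 5 by (simp only: mult_ac)
    also have "\<dots> = of_nat (nn choose l) * (of_nat (m choose j) * ((of_nat m - of_nat j) * (of_nat m - of_nat j - 1) * (of_nat m - of_nat j - 2)))"
      unfolding 4 by Groebner_Basis.algebra
    finally show ?thesis .
  qed
  have l0: "leg l = of_nat (nn choose l) * 2 ^ l * (of_nat (m choose j) * (- 3) ^ (m - j))"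
    using True by (simp add: leg_def j_def m_def)
  have l2: "leg (l + 2) = of_nat (nn choose (l + 2)) * (2 ^ l * 4) * (of_nat ((m - 2) choose (j + 1)) * (- 3) ^ (m - 2 - (j + 1)))"
    unfolding leg_def j' m' using True by (simp add: power_add)
  define Z where "Z = of_nat m - (of_nat j :: 'a)"
  have "(- 27) * (of_nat (l + 1) * of_nat (l + 2)) * of_nat (j + 1) * leg (l + 2) =
      of_nat (nn choose (l + 2)) * (of_nat (l + 1) * of_nat (l + 2)) * of_nat (j + 1) * (4 * 2 ^ l) *
      (of_nat ((m - 2) choose (j + 1)) * (- 27) * (- 3) ^ (m - 2 - (j + 1)))"
    unfolding l2 by (simp only: mult_ac)
  also have "\<dots> = (of_nat (nn choose (l + 2)) * (of_nat (l + 1) * of_nat (l + 2)) *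
      (of_nat ((m - 2) choose (j + 1)) * of_nat (j + 1))) * (4 * 2 ^ l) * (- 3) ^ (m - j)"
    unfolding pow by (simp only: mult_ac)
  also have "\<dots> = 4 * (Z * (Z - 1) * (Z - 2)) * leg l"
    unfolding ch l0 Z_def by (simp only: mult_ac)
  finally have step: "(- 27) * (of_nat (l + 1) * of_nat (l + 2)) * of_nat (j + 1) * leg (l + 2) =
      4 * (Z * (Z - 1) * (Z - 2)) * leg l" .
  have Z4: "4 * Z = - (6 * L + 1)"
  proof -
    have "4 * Z = 4 * of_nat m - 2 * (2 * of_nat j)" unfolding Z_def by simp
    also have "\<dots> = 2 * N - 6 * L" unfolding J M by Groebner_Basis.algebra
    finally show ?thesis unfolding N by simp
  qed
  have j4: "4 * of_nat (j + 1) = 2 * L + 3"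
  proof -
    have "4 * of_nat (j + 1) = 2 * (2 * of_nat j) + (4::'a)" by simp
    also have "\<dots> = 2 * N + 2 * L + 4" unfolding J by Groebner_Basis.algebra
    finally show ?thesis unfolding N by simp
  qed
  have jp: "of_nat (j + 1) \<noteq> (0::'a)"
    by (rule of_nat_nz) (use j2 True p_odd nn_ge_2 in linarith)+
  define C where "C = (of_nat (l + 1) * of_nat (l + 2) :: 'a)"
  \<comment> \<open>By \<open>Z4\<close> and \<open>j4\<close>, \<open>4 * Z - 8\<close> equals
    \<open>- 12 * of_nat (j + 1)\<close>, so the unit \<open>of_nat (j + 1)\<close> cancels and a
    two-term recurrence in \<open>l\<close> remains.\<close>
  have "48 * of_nat (j + 1) * (36 * C * leg (l + 2)) = - 64 * ((- 27) * C * of_nat (j + 1) * leg (l + 2))"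
    by Groebner_Basis.algebra
  also have "\<dots> = - 4 * ((4 * Z) * (4 * Z - 4) * (4 * Z - 8)) * leg l"
  proof -
    have "(- 27) * C * of_nat (j + 1) * leg (l + 2) = 4 * (Z * (Z - 1) * (Z - 2)) * leg l"
      unfolding C_def by (rule step)
    then have "- 64 * ((- 27) * C * of_nat (j + 1) * leg (l + 2)) = - 64 * (4 * (Z * (Z - 1) * (Z - 2)) * leg l)"
      by (rule arg_cong)
    also have "\<dots> = - 4 * ((4 * Z) * (4 * Z - 4) * (4 * Z - 8)) * leg l" by Groebner_Basis.algebra
    finally show ?thesis .
  qed
  also have "\<dots> = 48 * of_nat (j + 1) * ((6 * L + 1) * (6 * L + 5) * leg l)"
  proof -
    have f: "48 * of_nat (j + 1) = 12 * (2 * L + (3::'a))" unfolding j4[symmetric] by simp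
    show ?thesis unfolding Z4 f by Groebner_Basis.algebra
  qed
  finally have "48 * of_nat (j + 1) * (36 * C * leg (l + 2)) = 48 * of_nat (j + 1) * ((6 * L + 1) * (6 * L + 5) * leg l)" .
  moreover have "48 * of_nat (j + 1) \<noteq> (0::'a)"
  proof -
    have "(48::'a) = 2 * 2 * 2 * 2 * 3" by simp
    then have "(48::'a) \<noteq> 0" using nz2 nz3 by (metis mult_eq_0_iff)
    then show ?thesis using jp by (metis mult_eq_0_iff)
  qed
  ultimately show ?thesis unfolding C_def L_def by simp
qed

abbreviation "sv \<equiv> ([:-1, 0, 1:] :: 'a poly)"
abbreviation "sx \<equiv> ([:0, 1:] :: 'a poly)"

text \<open>Legendre's equation of degree -1/6, the product of -1/6 and 5/6 being -5/36; coefficient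
  by coefficient it is \<open>leg_step\<close>.\<close>

lemma leg_ode: "36 * sv * pderiv (pderiv leg_poly) + 72 * sx * pderiv leg_poly + 5 * leg_poly = 0"
proof (rule poly_eqI)
  fix l
  have c1: "coeff (sx * pderiv leg_poly) l = of_nat l * leg l"
    by (cases l) (simp_all add: coeff_pderiv coeff_leg_poly)
  have c2: "coeff (sv * pderiv (pderiv leg_poly)) l =
      of_nat l * (of_nat l - 1) * leg l - of_nat (l + 1) * of_nat (l + 2) * leg (l + 2)"
  proof -
    have "sv = monom 1 2 - 1" by (simp add: monom_altdef power2_eq_square one_pCons)
    then have "coeff (sv * pderiv (pderiv leg_poly)) l =
        coeff (monom 1 2 * pderiv (pderiv leg_poly)) l - coeff (pderiv (pderiv leg_poly)) l"
      by (simp only: left_diff_distrib mult_1_left coeff_diff)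
    moreover have "coeff (monom 1 2 * pderiv (pderiv leg_poly)) l = of_nat l * (of_nat l - 1) * leg l"
    proof (cases "l < 2")
      case True
      then have "l = 0 \<or> l = 1" by auto
      then show ?thesis using True by (auto simp: coeff_monom_mult)
    next
      case False
      then obtain k where k: "l = k + 2" by (metis add.commute le_Suc_ex not_le)
      have "coeff (monom 1 2 * pderiv (pderiv leg_poly)) l = coeff (pderiv (pderiv leg_poly)) k"
        by (simp add: k coeff_monom_mult)
      then show ?thesis unfolding k by (simp add: coeff_pderiv coeff_leg_poly algebra_simps)
    qed
    moreover have "coeff (pderiv (pderiv leg_poly)) l = of_nat (l + 1) * of_nat (l + 2) * leg (l + 2)"
      by (simp add: coeff_pderiv coeff_leg_poly mult.assoc)
    ultimately show ?thesis by simp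
  qed
  have n: "coeff (numeral k * q) l = numeral k * coeff q l" for k and q :: "'a poly"
    by (simp add: numeral_poly)
  have "coeff (36 * sv * pderiv (pderiv leg_poly) + 72 * sx * pderiv leg_poly + 5 * leg_poly) l =
      36 * coeff (sv * pderiv (pderiv leg_poly)) l + 72 * coeff (sx * pderiv leg_poly) l + 5 * leg l"
    by (simp only: coeff_add mult.assoc n coeff_leg_poly)
  also have "\<dots> = (6 * of_nat l + 1) * (6 * of_nat l + 5) * leg l - 36 * (of_nat (l + 1) * of_nat (l + 2)) * leg (l + 2)"
    unfolding c1 c2 by Groebner_Basis.algebra
  also have "\<dots> = 0" unfolding leg_step by simp
  finally show "coeff (36 * sv * pderiv (pderiv leg_poly) + 72 * sx * pderiv leg_poly + 5 * leg_poly) l = coeff 0 l"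
    by simp
qed

text \<open>The symmetric square of the differential equation of \<open>leg_poly\<close>.\<close>

definition sym2 :: "'a poly \<Rightarrow> 'a poly" where
  "sym2 q = 9 * sv^2 * pderiv (pderiv (pderiv q)) + 54 * sx * sv * pderiv (pderiv q)
     + (59 * sv + 36) * pderiv q + 5 * sx * q"

lemma pderiv_numeral_mult: "pderiv (numeral k * q) = numeral k * pderiv (q :: 'a poly)"
  by (simp add: numeral_poly pderiv_smult)

lemma pderiv_s: "pderiv sv = 2 * sx" "pderiv sx = 1"
  by (simp_all add: pderiv_pCons numeral_poly one_pCons)

lemma sv_sx: "sv = sx^2 - 1"
  by (simp add: power2_eq_square one_pCons)

text \<open>Writes four times the third order operator at \<open>f^2\<close> as a combination of the
  equation for \<open>f\<close>, its derivative, and the relation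
  \<open>v = x^2 - 1\<close>.\<close>

lemma sym2_identity:
  fixes v x f f1 f2 f3 :: "'b::idom"
  shows "4 * (9 * v^2 * (2 * (3 * f1 * f2 + f * f3)) + 54 * x * v * (2 * (f1^2 + f * f2))
      + (59 * v + 36) * (2 * (f * f1)) + 5 * x * f^2) =
    2 * v * f * (36 * v * f3 + 144 * x * f2 + 77 * f1)
      + (6 * v * f1 + 4 * x * f) * (36 * v * f2 + 72 * x * f1 + 5 * f)
      + 288 * f * f1 * (v + 1 - x^2)"
  by Groebner_Basis.algebra

lemma sym2_leg: "sym2 (leg_poly^2) = 0"
proof -
  define P where "P = leg_poly"
  define P1 where "P1 = pderiv P"
  define P2 where "P2 = pderiv P1"
  define P3 where "P3 = pderiv P2"
  have o1: "36 * sv * P2 + 72 * sx * P1 + 5 * P = 0"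
    unfolding P2_def P1_def P_def by (rule leg_ode)
  have "36 * (sv * P2) + 72 * (sx * P1) + 5 * P = 0" using o1 by (simp only: mult.assoc)
  then have "pderiv (36 * (sv * P2) + 72 * (sx * P1) + 5 * P) = 0" by (simp only: pderiv_0)
  then have o2: "36 * sv * P3 + 144 * sx * P2 + 77 * P1 = 0"
    unfolding pderiv_add pderiv_numeral_mult pderiv_mult pderiv_s P1_def[symmetric] P2_def[symmetric] P3_def[symmetric]
    by (simp add: algebra_simps)
  have a1: "pderiv (P^2) = P * P1 + P * P1"
    unfolding power2_eq_square pderiv_mult P1_def[symmetric] ..
  have a2: "pderiv (pderiv (P^2)) = P * P2 + P1 * P1 + (P * P2 + P1 * P1)"
    unfolding a1 pderiv_add pderiv_mult P1_def[symmetric] P2_def[symmetric] ..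
  have d3: "pderiv (pderiv (pderiv (P^2))) = 2 * (3 * P1 * P2 + P * P3)"
    unfolding a2 pderiv_add pderiv_mult P1_def[symmetric] P2_def[symmetric] P3_def[symmetric]
    by Groebner_Basis.algebra
  have d2: "pderiv (pderiv (P^2)) = 2 * (P1^2 + P * P2)" unfolding a2 by Groebner_Basis.algebra
  have d1: "pderiv (P^2) = 2 * (P * P1)" unfolding a1 by Groebner_Basis.algebra
  have "4 * sym2 (P^2) = 2 * sv * P * (36 * sv * P3 + 144 * sx * P2 + 77 * P1)
      + (6 * sv * P1 + 4 * sx * P) * (36 * sv * P2 + 72 * sx * P1 + 5 * P)
      + 288 * P * P1 * (sv + 1 - sx^2)"
    unfolding sym2_def unfolding d3 unfolding d2 unfolding d1 by (rule sym2_identity)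
  also have "\<dots> = 0" unfolding o1 o2 unfolding sv_sx by simp
  finally have "4 * sym2 (P^2) = 0" .
  moreover have "(4 :: 'a poly) \<noteq> 0"
  proof -
    have "(4::'a) = 2 * 2" by simp
    then have "(4::'a) \<noteq> 0" using nz2 by (metis mult_eq_0_iff)
    then show ?thesis by (simp add: numeral_poly)
  qed
  ultimately show ?thesis by (simp add: P_def)
qed

text \<open>The only exponent of the equation at 1 is zero: a zero of order \<open>n\<close> there
  would give the leading coefficient \<open>36 * n^3\<close>, which does not vanish because
  \<open>n\<close> is positive and at most \<open>degree q\<close>, hence below
  \<open>p\<close>.\<close>

lemma sym2_unique:
  assumes e: "sym2 q = 0" and q1: "poly q 1 = 0" and d: "degree q < p"
  shows "q = 0"
proof (rule ccontr)
  assume q: "q \<noteq> 0"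
  define y where "y = ([:-1, 1:] :: 'a poly)"
  have dy: "pderiv y = 1" by (simp add: y_def pderiv_pCons one_pCons)
  have y0: "y \<noteq> 0" "poly y 1 = 0" by (simp_all add: y_def)
  define n where "n = order 1 q"
  obtain u where u: "q = y ^ n * u" "\<not> y dvd u"
    using order_decomp[OF q, of 1] unfolding n_def y_def by auto
  have u1: "poly u 1 \<noteq> 0" using u(2) poly_eq_0_iff_dvd unfolding y_def by blast
  have n: "0 < n" using q1 q by (simp add: n_def order_root)
  have "n \<le> degree q" unfolding n_def by (rule order_degree[OF q])
  then have np: "of_nat n \<noteq> (0::'a)" using n d by (intro of_nat_nz) auto
  \<comment> \<open>Euler's operator \<open>y * pderiv\<close>, transported to the cofactor of
    \<open>y ^ n\<close>.\<close>
  define th where "th = (\<lambda>r. of_nat n * r + y * pderiv r :: 'a poly)"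
  have th: "y * pderiv (y ^ n * r) = y ^ n * th r" for r
  proof -
    obtain m where m: "n = Suc m" using n by (cases n) auto
    have "pderiv (y ^ n) = of_nat n * y ^ m"
      unfolding m pderiv_power_Suc dy of_nat_poly by simp
    then have "y * pderiv (y ^ n * r) = y * (y ^ n * pderiv r + r * (of_nat n * y ^ m))"
      by (simp only: pderiv_mult)
    also have "\<dots> = y ^ n * th r" unfolding th_def m power_Suc by Groebner_Basis.algebra
    finally show ?thesis .
  qed
  have th1: "poly (th r) 1 = of_nat n * poly r 1" for r by (simp add: th_def y0)
  have e1: "y * pderiv q = y ^ n * th u" unfolding u(1) by (rule th)
  have a2: "y * pderiv (y * pderiv q) = y ^ n * th (th u)" unfolding e1 by (rule th)
  have "y * pderiv (y * pderiv q) = y * pderiv q + y^2 * pderiv (pderiv q)"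
    unfolding pderiv_mult dy by Groebner_Basis.algebra
  then have e2: "y^2 * pderiv (pderiv q) = y ^ n * (th (th u) - th u)"
    unfolding a2 unfolding e1 by (simp add: algebra_simps)
  have a3: "y * pderiv (y * pderiv (y * pderiv q)) = y ^ n * th (th (th u))"
    unfolding a2 by (rule th)
  have "y * pderiv (y * pderiv (y * pderiv q)) =
      y * pderiv q + 3 * (y^2 * pderiv (pderiv q)) + y^3 * pderiv (pderiv (pderiv q))"
    unfolding pderiv_mult pderiv_add dy pderiv_1 by Groebner_Basis.algebra
  then have e3: "y^3 * pderiv (pderiv (pderiv q)) = y ^ n * (th (th (th u)) - 3 * th (th u) + 2 * th u)"
    unfolding a3 unfolding e1 e2 by (simp add: algebra_simps)
  have sv: "sv = y * (y + 2)" and sx: "sx = y + 1"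
    by (simp_all add: y_def numeral_poly one_pCons)
  define K where "K = 9 * (y + 2)^2 * (th (th (th u)) - 3 * th (th u) + 2 * th u)
     + 54 * (y + 1) * (y + 2) * (th (th u) - th u) + (59 * (y * (y + 2)) + 36) * th u + 5 * (y + 1) * y * u"
  have "y * sym2 q = 9 * (y + 2)^2 * (y^3 * pderiv (pderiv (pderiv q))) + 54 * (y + 1) * (y + 2) * (y^2 * pderiv (pderiv q))
      + (59 * (y * (y + 2)) + 36) * (y * pderiv q) + 5 * (y + 1) * y * q"
    unfolding sym2_def unfolding sv unfolding sx by Groebner_Basis.algebra
  also have "\<dots> = y ^ n * K" unfolding e1 e2 e3 K_def unfolding u(1) by Groebner_Basis.algebra
  finally have "y ^ n * K = 0" using e by simp
  then have "K = 0" using y0 by simp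
  then have "poly K 1 = 0" by simp
  moreover have "poly K 1 = 36 * of_nat n ^ 3 * poly u 1"
    by (simp add: K_def th1 y0 numeral_poly) Groebner_Basis.algebra
  moreover have "(36::'a) \<noteq> 0"
  proof -
    have "(36::'a) = 2 * 2 * 3 * 3" by simp
    then show ?thesis using nz2 nz3 by (metis mult_eq_0_iff)
  qed
  ultimately show False using np u1 by simp
qed

text \<open>At 1 the cubic is \<open>(x - 1)^2 * (x + 2)\<close>. Its power \<open>nn\<close>
  contains \<open>(x - 1) ^ (p - 1)\<close>, which is the sum of all \<open>x ^ i\<close> with
  \<open>i < p\<close>, so the coefficient sought is the sum of the coefficients of
  \<open>(x + 2) ^ nn\<close>, that is \<open>3 ^ nn\<close>.\<close>

lemma leg_poly_1: "poly leg_poly 1 ^ 2 = 1"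
proof -
  define q where "q = ([:2, 1:] :: 'a poly) ^ nn"
  have pm: "p - 1 = 2 * nn" using p_odd by linarith
  have "poly leg_poly 1 = (\<Sum>l\<le>nn. leg l)"
    by (simp add: leg_poly_def poly_sum poly_monom)
  also have "\<dots> = coeff ([:2, - 3, 0, 1:] ^ nn) (2 * nn)"
    unfolding coeff_cubic_power leg_def ..
  also have "[:2, - 3, 0, 1:] ^ nn = ([:- 1, 1:] :: 'a poly) ^ (p - 1) * q"
  proof -
    have h: "[:2, - 3, 0, 1:] = ([:- 1, 1:] :: 'a poly) ^ 2 * [:2, 1:]"
      by (simp add: power2_eq_square)
    show ?thesis unfolding h power_mult_distrib q_def pm power_mult ..
  qed
  also have "([:- 1, 1:] :: 'a poly) ^ (p - 1) = (\<Sum>i<p. monom 1 i)"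
  proof -
    define x where "x = (monom 1 1 :: 'a poly)"
    have x: "[:- 1, 1:] = x - 1" "monom 1 i = x ^ i" for i
      by (simp_all add: x_def monom_power monom_altdef one_pCons)
    have "[:- 1, 1:] = [:0, 1:] + [:- 1 :: 'a:]" by simp
    then have "([:- 1, 1:] :: 'a poly) ^ p = [:0, 1:] ^ p + [:- 1:] ^ p" by (simp only: poly_freshman)
    moreover have "[:0, 1:] = x" by (simp add: x_def monom_altdef)
    moreover have "[:- 1 :: 'a:] ^ p = - 1" using of_int_power_p[of "-1"] by (simp add: poly_const_pow one_pCons)
    ultimately have "(x - 1) ^ p = x ^ p - 1" unfolding x by simp
    also have "\<dots> = (x - 1) * (\<Sum>i<p. x ^ i)" by (rule power_diff_1_eq)
    finally have "(x - 1) * (x - 1) ^ (p - 1) = (x - 1) * (\<Sum>i<p. x ^ i)"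
      using p_gt_3 by (metis power_eq_if not_numeral_less_zero)
    moreover have "x - 1 \<noteq> 0" by (simp flip: x)
    ultimately show ?thesis unfolding x by simp
  qed
  also have "coeff ((\<Sum>i<p. monom 1 i) * q) (2 * nn) = (\<Sum>i<p. coeff q (2 * nn - i))"
    unfolding sum_distrib_right coeff_sum
    by (intro sum.cong) (use p_odd in \<open>auto simp: coeff_monom_mult\<close>)
  also have "\<dots> = (\<Sum>i<p. coeff q i)"
    by (subst sum.nat_diff_reindex[symmetric]) (use p_odd in \<open>auto intro!: sum.cong arg_cong[of _ _ "coeff q"]\<close>)
  also have "\<dots> = (\<Sum>i\<le>degree q. coeff q i)"
  proof (rule sum.mono_neutral_right)
    have "degree q \<le> nn" unfolding q_def using degree_power_le[of "[:2, 1 :: 'a:]" nn] by simp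
    then show "{..degree q} \<subseteq> {..<p}" using p_odd by auto
  qed (auto simp: coeff_eq_0)
  also have "\<dots> = poly q 1" by (simp add: poly_altdef)
  finally have "poly leg_poly 1 = 3 ^ nn" by (simp add: q_def poly_power)
  moreover have "(3 ^ nn)^2 = (1::'a)"
  proof -
    have "(3::'a) \<in> Fp" using of_int_Fp[of 3] by simp
    then have "(3::'a) ^ (p - 1) = 1" using nz3 by (rule Fp_power_pred)
    then show ?thesis unfolding power_p_pred .
  qed
  ultimately show ?thesis by simp
qed

text \<open>With \<open>nn\<close> read as -1/2, these are the coefficients of the 3F2 series with
  parameters 1/6, 1/2, 5/6; 1, 1 at argument \<open>- z\<close>. Hence \<open>tri_poly\<close> is
  that series at \<open>1 - s^2\<close>, cut off modulo \<open>p\<close>.\<close>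

definition tt :: "nat \<Rightarrow> 'a" where
  "tt k = of_nat (nn choose (3 * k)) * of_nat (tri k) / 27 ^ k"

definition tri_poly :: "'a poly" where "tri_poly = (\<Sum>k\<le>nn. smult (tt k) (sv ^ k))"

lemma nz27: "(27::'a) \<noteq> 0"
proof -
  have "(27::'a) = 3 * 3 * 3" by simp
  then show ?thesis using nz3 by (metis mult_eq_0_iff)
qed

lemma tt_step: "72 * of_nat (k + 1) ^ 3 * tt (k + 1) + (2 * of_nat k + 1) * (6 * of_nat k + 1) * (6 * of_nat k + 5) * tt k = 0"
proof -
  define K where "K = (of_nat k :: 'a)"
  define N where "N = (of_nat nn :: 'a)"
  define D where "D = (of_nat (3 * k + 1) * of_nat (3 * k + 2) * of_nat (3 * k + 3) :: 'a)"
  define Y where "Y = (N - 3 * K) * (N - 3 * K - 1) * (N - 3 * K - 2)"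
  have 1: "of_nat (nn choose (3 * (k + 1))) * D = of_nat (nn choose (3 * k)) * Y"
    using choose_step_3[of nn "3 * k", where 'b='a] by (simp add: D_def Y_def N_def K_def algebra_simps)
  have "of_nat (tri (Suc k) * (k + 1)^3) = (of_nat (tri k * ((3 * k + 1) * (3 * k + 2) * (3 * k + 3))) :: 'a)"
    unfolding tri_Suc ..
  then have 2: "of_nat (tri (k + 1)) * of_nat (k + 1) ^ 3 = of_nat (tri k) * D"
    by (simp only: of_nat_mult of_nat_power D_def Suc_eq_plus1)
  have "27 ^ (k + 1) * (tt (k + 1) * of_nat (k + 1) ^ 3) =
      of_nat (nn choose (3 * (k + 1))) * (of_nat (tri (k + 1)) * of_nat (k + 1) ^ 3)"
    using nz27 by (simp add: tt_def)
  also have "\<dots> = (of_nat (nn choose (3 * (k + 1))) * D) * of_nat (tri k)"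
    unfolding 2 by (simp only: mult_ac)
  also have "\<dots> = 27 ^ k * (tt k * Y)" unfolding 1 using nz27 by (simp add: tt_def)
  finally have "27 ^ k * (27 * (tt (k + 1) * of_nat (k + 1) ^ 3)) = 27 ^ k * (tt k * Y)"
    by (simp only: power_Suc Suc_eq_plus1[symmetric] mult_ac)
  then have 3: "27 * (tt (k + 1) * of_nat (k + 1) ^ 3) = tt k * Y" using nz27 by simp
  have N: "2 * N = - 1" unfolding N_def by (rule two_nn)
  have "8 * Y = (2 * N - 6 * K) * (2 * N - 6 * K - 2) * (2 * N - 6 * K - 4)"
    unfolding Y_def by Groebner_Basis.algebra
  also have "\<dots> = - ((6 * K + 1) * (6 * K + 3) * (6 * K + 5))" unfolding N by Groebner_Basis.algebra
  finally have Y: "8 * Y = - ((6 * K + 1) * (6 * K + 3) * (6 * K + 5))" .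
  have "3 * (72 * of_nat (k + 1) ^ 3 * tt (k + 1) + (2 * K + 1) * (6 * K + 1) * (6 * K + 5) * tt k) =
      8 * (27 * (tt (k + 1) * of_nat (k + 1) ^ 3)) + (6 * K + 1) * (6 * K + 3) * (6 * K + 5) * tt k"
    by Groebner_Basis.algebra
  also have "\<dots> = tt k * (8 * Y + (6 * K + 1) * (6 * K + 3) * (6 * K + 5))"
    unfolding 3 by Groebner_Basis.algebra
  also have "\<dots> = 0" unfolding Y by simp
  finally show ?thesis using nz3 unfolding K_def by (metis mult_eq_0_iff)
qed

text \<open>On powers of \<open>s^2 - 1\<close> the operator yields two terms only, so a series in
  these powers is annihilated by a two-term recurrence. Writing the lower term as a derivative
  avoids the power \<open>k - 1\<close> at \<open>k = 0\<close>.\<close>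

lemma sym2_power: "sym2 (sv ^ k) = of_nat ((2 * k + 1) * (6 * k + 1) * (6 * k + 5)) * (sx * sv ^ k)
    + 36 * of_nat k ^ 2 * pderiv (sv ^ k)"
proof -
  define c where "c = (of_nat k :: 'a poly)"
  define w where "w = sv ^ k"
  define w1 where "w1 = pderiv w"
  define w2 where "w2 = pderiv w1"
  define w3 where "w3 = pderiv w2"
  have dc: "pderiv c = 0" by (simp add: c_def)
  have pn: "pderiv (numeral m :: 'a poly) = 0" for m by (simp add: numeral_poly pderiv_pCons)
  have e1: "sv * w1 = 2 * c * sx * w"
  proof (cases k)
    case 0
    then show ?thesis by (simp add: w1_def w_def c_def)
  next
    case (Suc m)
    have h: "w1 = of_nat (Suc m) * sv ^ m * (2 * sx)"
      unfolding w1_def w_def Suc pderiv_power_Suc pderiv_s of_nat_poly by simp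
    show ?thesis unfolding h unfolding w_def c_def Suc power_Suc by (simp only: mult_ac)
  qed
  have "pderiv (sv * w1) = pderiv (2 * c * sx * w)" unfolding e1 ..
  then have "sv * w2 + w1 * (2 * sx) = 2 * c * sx * w1 + w * (2 * c)"
    unfolding pderiv_mult pderiv_s dc pn w1_def[symmetric] w2_def[symmetric] by simp
  then have "sv * w2 = 2 * c * sx * w1 + w * (2 * c) - w1 * (2 * sx)" by (simp only: eq_diff_eq)
  also have "\<dots> = 2 * c * w + (2 * c - 2) * sx * w1" by Groebner_Basis.algebra
  finally have e2: "sv * w2 = 2 * c * w + (2 * c - 2) * sx * w1" .
  have "pderiv (sv * w2) = pderiv (2 * c * w + (2 * c - 2) * sx * w1)" unfolding e2 ..
  then have "sv * w3 + w2 * (2 * sx) = 2 * c * w1 + ((2 * c - 2) * sx * w2 + w1 * (2 * c - 2))"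
    unfolding pderiv_mult pderiv_add pderiv_diff pderiv_s dc pn w1_def[symmetric] w2_def[symmetric] w3_def[symmetric]
    by simp
  then have "sv * w3 = 2 * c * w1 + ((2 * c - 2) * sx * w2 + w1 * (2 * c - 2)) - w2 * (2 * sx)"
    by (simp only: eq_diff_eq)
  also have "\<dots> = (4 * c - 2) * w1 + (2 * c - 4) * sx * w2" by Groebner_Basis.algebra
  finally have e3: "sv * w3 = (4 * c - 2) * w1 + (2 * c - 4) * sx * w2" .
  have "sym2 w = 9 * sv * (sv * w3) + 54 * sx * (sv * w2) + (59 * sv + 36) * w1 + 5 * sx * w"
    unfolding sym2_def w1_def[symmetric] w2_def[symmetric] w3_def[symmetric] power2_eq_square by (simp only: mult_ac)
  also have "\<dots> = 9 * (4 * c - 2) * (sv * w1) + (9 * (2 * c - 4) + 54) * sx * (sv * w2) + 59 * (sv * w1) + 36 * w1 + 5 * sx * w"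
    unfolding e3 by Groebner_Basis.algebra
  also have "\<dots> = 9 * (4 * c - 2) * (sv * w1) + (18 * c + 18) * (2 * c * (sx * w)) + (18 * c + 18) * (2 * c - 2) * (sx^2 * w1)
      + 59 * (sv * w1) + 36 * w1 + 5 * sx * w"
    unfolding e2 by Groebner_Basis.algebra
  also have "sx^2 * w1 = sv * w1 + w1" unfolding sv_sx by Groebner_Basis.algebra
  also have "9 * (4 * c - 2) * (sv * w1) + (18 * c + 18) * (2 * c * (sx * w)) + (18 * c + 18) * (2 * c - 2) * (sv * w1 + w1)
      + 59 * (sv * w1) + 36 * w1 + 5 * sx * w = (2 * c + 1) * (6 * c + 1) * (6 * c + 5) * (sx * w) + 36 * c^2 * w1"
    unfolding e1 by Groebner_Basis.algebra
  finally have "sym2 w = (2 * c + 1) * (6 * c + 1) * (6 * c + 5) * (sx * w) + 36 * c^2 * w1" .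
  moreover have "of_nat ((2 * k + 1) * (6 * k + 1) * (6 * k + 5)) = (2 * c + 1) * (6 * c + 1) * (6 * c + 5)"
    by (simp only: c_def of_nat_mult of_nat_add of_nat_numeral of_nat_1)
  ultimately show ?thesis by (simp only: c_def w_def w1_def)
qed

lemma sym2_add: "sym2 (q + r) = sym2 q + sym2 r"
  unfolding sym2_def pderiv_add by Groebner_Basis.algebra

lemma sym2_smult: "sym2 (smult c q) = smult c (sym2 q)"
proof -
  have sm: "smult c r = [:c:] * r" for r :: "'a poly" by simp
  show ?thesis unfolding sym2_def pderiv_smult unfolding sm by Groebner_Basis.algebra
qed

lemma sym2_sum: "sym2 (sum g A) = (\<Sum>i\<in>A. sym2 (g i))"
proof (induction A rule: infinite_finite_induct)
  case (insert i A)
  then show ?case by (simp add: sym2_add)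
qed (simp_all add: sym2_def)

lemma sym2_tri: "sym2 tri_poly = 0"
proof -
  define e where "e = (\<lambda>k. (2 * of_nat k + 1) * (6 * of_nat k + 1) * (6 * of_nat k + 5) :: 'a)"
  have "sym2 (smult (tt k) (sv ^ k)) = smult (e k * tt k) (sx * sv ^ k) + smult (36 * of_nat k ^ 2 * tt k) (pderiv (sv ^ k))" for k
  proof -
    have "of_nat m * q = smult (of_nat m) q" for m and q :: "'a poly" by (simp add: of_nat_poly)
    moreover have "36 * (of_nat k)^2 = (of_nat (36 * k^2) :: 'a poly)" "36 * (of_nat k)^2 = (of_nat (36 * k^2) :: 'a)"
      "e k = of_nat ((2 * k + 1) * (6 * k + 1) * (6 * k + 5))"
      by (simp_all add: e_def algebra_simps)
    ultimately show ?thesis unfolding sym2_smult sym2_power by (simp only: smult_add_right smult_smult mult.commute)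
  qed
  then have "sym2 tri_poly = (\<Sum>k\<le>nn. smult (e k * tt k) (sx * sv ^ k)) + (\<Sum>k\<le>nn. smult (36 * of_nat k ^ 2 * tt k) (pderiv (sv ^ k)))"
    unfolding tri_poly_def sym2_sum by (simp only: sum.distrib)
  also have "(\<Sum>k\<le>nn. smult (36 * of_nat k ^ 2 * tt k) (pderiv (sv ^ k))) =
      (\<Sum>k<nn. smult (36 * of_nat (Suc k) ^ 2 * tt (Suc k)) (pderiv (sv ^ Suc k)))"
    unfolding lessThan_Suc_atMost[symmetric] sum.lessThan_Suc_shift by simp
  also have "\<dots> = (\<Sum>k\<le>nn. smult (72 * of_nat (k + 1) ^ 3 * tt (k + 1)) (sx * sv ^ k))"
  proof -
    have z: "tt (nn + 1) = 0" by (simp add: tt_def binomial_eq_0)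
    have "smult (36 * of_nat (Suc k) ^ 2 * tt (Suc k)) (pderiv (sv ^ Suc k)) = smult (72 * of_nat (k + 1) ^ 3 * tt (k + 1)) (sx * sv ^ k)" for k
    proof -
      have h: "pderiv (sv ^ Suc k) = smult (2 * of_nat (Suc k)) (sx * sv ^ k)"
        unfolding pderiv_power_Suc pderiv_s by (simp add: numeral_poly)
      have c: "36 * of_nat (Suc k)^2 * tt (Suc k) * (2 * of_nat (Suc k)) = 72 * of_nat (k + 1)^3 * tt (k + 1)"
        unfolding Suc_eq_plus1 by Groebner_Basis.algebra
      show ?thesis unfolding h smult_smult c ..
    qed
    then show ?thesis unfolding lessThan_Suc_atMost[symmetric] sum.lessThan_Suc by (simp only: z) simp
  qed
  also have "(\<Sum>k\<le>nn. smult (e k * tt k) (sx * sv ^ k)) + (\<Sum>k\<le>nn. smult (72 * of_nat (k + 1) ^ 3 * tt (k + 1)) (sx * sv ^ k)) =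
      (\<Sum>k\<le>nn. smult (72 * of_nat (k + 1) ^ 3 * tt (k + 1) + e k * tt k) (sx * sv ^ k))"
    by (simp only: sum.distrib smult_add_left add.commute)
  also have "\<dots> = 0" unfolding e_def tt_step by simp
  finally show ?thesis .
qed

text \<open>Clausen's formula modulo \<open>p\<close>: both sides are annihilated by
  \<open>sym2\<close>, have degree at most \<open>2 * nn = p - 1\<close> and take the value 1 at 1,
  so \<open>sym2_unique\<close> applies to the difference.\<close>

lemma leg_square: "leg_poly^2 = tri_poly"
proof -
  have "sym2 (leg_poly^2 - tri_poly) = sym2 (leg_poly^2) + sym2 (smult (- 1) tri_poly)"
    by (simp flip: sym2_add)
  then have e: "sym2 (leg_poly^2 - tri_poly) = 0" unfolding sym2_smult sym2_leg sym2_tri by simp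
  have "poly tri_poly 1 = (\<Sum>k\<le>nn. if k = 0 then 1 else 0)"
    unfolding tri_poly_def poly_sum by (intro sum.cong) (auto simp: tt_def tri_def power_0_left)
  then have "poly (leg_poly^2 - tri_poly) 1 = 0" using leg_poly_1 by (simp add: poly_power)
  moreover have "degree (leg_poly^2 - tri_poly) < p"
  proof -
    have "degree leg_poly \<le> nn" by (rule degree_le) (simp add: coeff_leg_poly leg_large)
    then have "degree (leg_poly^2) \<le> 2 * nn" using degree_power_le[of leg_poly 2] by simp
    moreover have "degree tri_poly \<le> 2 * nn" unfolding tri_poly_def
    proof (rule degree_sum_le)
      fix k assume "k \<in> {..nn}"
      then show "degree (smult (tt k) (sv ^ k)) \<le> 2 * nn"
        using degree_smult_le[of "tt k" "sv ^ k"] degree_power_le[of sv k] by simp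
    qed simp
    ultimately have "degree (leg_poly^2 - tri_poly) \<le> 2 * nn" by (rule degree_diff_le)
    then show ?thesis using p_odd by linarith
  qed
  ultimately have "leg_poly^2 - tri_poly = 0" by (rule sym2_unique[OF e])
  then show ?thesis by simp
qed

lemma hasse_square: "hasse^2 = 88 ^ nn * (\<Sum>k\<le>nn. tt k * (27 / 512) ^ k)"
proof -
  obtain r where r: "r^2 = (88::'a)" using nth_root_exists[of 2] by auto
  have "(88::'a) = 2 * 2 * 2 * 11" by simp
  then have n88: "(88::'a) \<noteq> 0" using nz2 nz11 by (metis mult_eq_0_iff)
  then have r0: "r \<noteq> 0" using r by auto
  \<comment> \<open>With \<open>264 = 3 * r^2\<close> and \<open>1694 = 2 * s * r^3\<close>,
    replacing \<open>x\<close> by \<open>r * x\<close> turns the curve's cubic into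
    \<open>r^3\<close> times \<open>x^3 - 3 * x + 2 * s\<close>.\<close>
  define s where "s = 847 / r^3"
  have s: "s * r^3 = 847" using r0 by (simp add: s_def)
  have pm: "p - 1 = 2 * nn" using p_odd by linarith
  have "hasse = r ^ nn * poly leg_poly s"
  proof -
    have "hasse = (\<Sum>l\<le>nn. if even (nn + l) then of_nat (nn choose l) * 1694 ^ l * (of_nat ((nn - l) choose ((nn + l) div 2))
        * (- 264) ^ (nn - l - (nn + l) div 2)) else 0)"
      unfolding hasse_def cub_def pm by (rule coeff_cubic_power)
    also have "\<dots> = (\<Sum>l\<le>nn. r ^ nn * (leg l * s ^ l))"
    proof (rule sum.cong)
      fix l assume l: "l \<in> {..nn}"
      show "(if even (nn + l) then of_nat (nn choose l) * 1694 ^ l * (of_nat ((nn - l) choose ((nn + l) div 2))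
        * (- 264) ^ (nn - l - (nn + l) div 2)) else 0) = r ^ nn * (leg l * s ^ l)"
      proof (cases "even (nn + l) \<and> (nn + l) div 2 \<le> nn - l")
        case False
        then show ?thesis by (auto simp: leg_def binomial_eq_0)
      next
        case True
        define m where "m = nn - l - (nn + l) div 2"
        have "2 * ((nn + l) div 2) = nn + l" using True by auto
        moreover have "m + (nn + l) div 2 + l = nn" using conjunct2[OF True] l unfolding m_def atMost_iff by arith
        ultimately have "2 * m + 3 * l = nn" by linarith
        then have rn: "r ^ nn = (r^2) ^ m * (r^3) ^ l" by (metis power_add power_mult)
        have A: "(- 264 :: 'a) ^ m = (- 3) ^ m * (r^2) ^ m" unfolding r by (simp flip: power_mult_distrib)
        have B: "(1694 :: 'a) ^ l = 2 ^ l * (s ^ l * (r^3) ^ l)"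
          by (simp add: s flip: power_mult_distrib)
        show ?thesis using True unfolding leg_def m_def[symmetric] A B rn by (simp add: mult_ac)
      qed
    qed simp
    also have "\<dots> = r ^ nn * poly leg_poly s"
      by (simp add: leg_poly_def poly_sum poly_monom sum_distrib_left)
    finally show ?thesis .
  qed
  then have "hasse^2 = (r^2) ^ nn * poly (leg_poly^2) s"
    by (simp add: power_mult_distrib poly_power mult.commute flip: power_mult)
  also have "poly (leg_poly^2) s = (\<Sum>k\<le>nn. tt k * (s^2 - 1) ^ k)"
    unfolding leg_square tri_poly_def by (simp add: poly_sum poly_power power2_eq_square algebra_simps)
  also have "s^2 - 1 = 27 / 512"
  proof -
    have "s^2 * (r^2)^3 = (s * r^3)^2" by Groebner_Basis.algebra
    then have h: "s^2 * 88^3 = 847^2" unfolding s r .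
    have "88^3 * 512 * (s^2 - 1) = 512 * (s^2 * 88^3) - 512 * 88^3" by Groebner_Basis.algebra
    also have "\<dots> = 88^3 * 27" unfolding h by simp
    finally have "88^3 * 512 * (s^2 - 1) = (88^3 * 27 :: 'a)" .
    then have "512 * (s^2 - 1) = (27 :: 'a)" using n88
      by (simp only: mult.assoc mult_left_cancel power_eq_0_iff) (metis mult_left_cancel power_not_zero)
    moreover have "(512::'a) \<noteq> 0"
    proof -
      have "(512::'a) = 2 ^ 9" by simp
      then show ?thesis using nz2 by (metis power_not_zero)
    qed
    ultimately show ?thesis by (metis nonzero_mult_div_cancel_left)
  qed
  finally show ?thesis by (simp add: r)
qed

text \<open>The classical expression of the central binomial coefficient by the binomial coefficient
  of -1/2, with \<open>nn\<close> in its place. The induction divides by \<open>Suc n\<close>, a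
  unit below \<open>p\<close>.\<close>

lemma central_choose:
  "n < p \<Longrightarrow> of_nat ((2 * n) choose n) = of_nat (nn choose n) * (- 4 :: 'a) ^ n"
proof (induction n)
  case (Suc n)
  define N where "N = (of_nat nn :: 'a)"
  have N: "2 * N = - 1" unfolding N_def by (rule two_nn)
  have "Suc n * ((2 * Suc n) choose Suc n) = 2 * (2 * n + 1) * ((2 * n) choose n)"
  proof -
    have 1: "Suc n * ((2 * n + 2) choose Suc n) = (2 * n + 2) * ((2 * n + 1) choose n)"
      using binomial_absorption[of n "2 * n + 2"] by simp
    have 2: "(Suc (2 * n) - n) * (Suc (2 * n) choose n) = Suc (2 * n) * ((2 * n) choose n)"
      using binomial_absorb_comp[of "Suc (2 * n)" n] by simp
    have 2: "Suc n * ((2 * n + 1) choose n) = (2 * n + 1) * ((2 * n) choose n)"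
      using 2 by (simp add: Suc_diff_le)
    have "Suc n * (Suc n * ((2 * n + 2) choose Suc n)) = (2 * n + 2) * (Suc n * ((2 * n + 1) choose n))"
      unfolding 1 by (simp only: mult_ac)
    also have "\<dots> = Suc n * (2 * (2 * n + 1) * ((2 * n) choose n))"
      unfolding 2 by (simp add: algebra_simps)
    finally show ?thesis by (simp only: mult_cancel1) simp
  qed
  then have "of_nat (Suc n) * of_nat ((2 * Suc n) choose Suc n) = (2 * (2 * of_nat n + 1) * of_nat ((2 * n) choose n) :: 'a)"
    by (metis (no_types, lifting) of_nat_1 of_nat_add of_nat_mult of_nat_numeral)
  also have "\<dots> = 2 * (2 * of_nat n + 1) * (of_nat (nn choose n) * (- 4) ^ n)" using Suc by simp
  also have "\<dots> = (of_nat (nn choose n) * (N - of_nat n)) * (- 4) ^ Suc n"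
  proof -
    have "2 * (2 * of_nat n + 1) = - 4 * (N - (of_nat n :: 'a)) + 2 * (2 * N + 1)" by Groebner_Basis.algebra
    then have h: "2 * (2 * of_nat n + 1) = - 4 * (N - (of_nat n :: 'a))" using N by simp
    show ?thesis unfolding h power_Suc by (simp only: mult_ac)
  qed
  also have "\<dots> = of_nat (Suc n) * (of_nat (nn choose Suc n) * (- 4) ^ Suc n)"
    unfolding N_def choose_Suc_field[symmetric] by (simp only: mult_ac)
  finally have "of_nat (Suc n) * of_nat ((2 * Suc n) choose Suc n) = of_nat (Suc n) * (of_nat (nn choose Suc n) * (- 4 :: 'a) ^ Suc n)" .
  moreover have "of_nat (Suc n) \<noteq> (0::'a)" by (rule of_nat_nz) (use Suc.prems in auto)
  ultimately show ?case by (metis mult_left_cancel)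
qed simp

text \<open>By \<open>central_choose\<close> the weight becomes
  \<open>(nn choose n) / 11 ^ n\<close>. After the sums are exchanged, the binomial theorem
  evaluates the inner one with \<open>1 - 3 / 11 = 8 / 11\<close>, and the exponent
  \<open>nn - 3 * k\<close> of 8 produces the powers of 512 in \<open>hasse_square\<close>.\<close>

lemma sum_eq_hasse_square:
  "(\<Sum>k=0..p - 1. of_nat ((2 * k) choose k) * (of_int (W k) / (- 44) ^ k)) = hasse^2"
proof -
  have "(44::'a) = 2 * 2 * 11" by simp
  then have n44: "(44::'a) \<noteq> 0" using nz2 nz11 by (metis mult_eq_0_iff)
  have n8: "(8::'a) \<noteq> 0"
  proof -
    have "(8::'a) = 2 * 2 * 2" by simp
    then show ?thesis using nz2 by (metis mult_eq_0_iff)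
  qed
  have q: "(- 4) ^ n / (- 44) ^ n = (1 / 11 :: 'a) ^ n" for n
  proof -
    have h: "(- 4) / (- 44) = (1 / 11 :: 'a)" using n44 nz11 by (simp add: field_simps)
    show ?thesis unfolding power_divide[symmetric] h ..
  qed
  have "(\<Sum>k=0..p - 1. of_nat ((2 * k) choose k) * (of_int (W k) / (- 44) ^ k)) =
      (\<Sum>n\<le>2 * nn. of_nat (nn choose n) * (1 / 11) ^ n * of_int (W n) :: 'a)"
  proof (rule sum.cong)
    show "{0..p - 1} = {..2 * nn}" using p_odd by auto
    fix n assume "n \<in> {..2 * nn}"
    then have "n < p" using p_odd by auto
    then have "of_nat ((2 * n) choose n) * (of_int (W n) / (- 44) ^ n) =
        of_nat (nn choose n) * ((- 4) ^ n / (- 44) ^ n) * (of_int (W n) :: 'a)"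
      by (simp add: central_choose)
    then show "of_nat ((2 * n) choose n) * (of_int (W n) / (- 44) ^ n) =
        of_nat (nn choose n) * (1 / 11) ^ n * (of_int (W n) :: 'a)" unfolding q .
  qed
  also have "\<dots> = (\<Sum>n\<le>nn. of_nat (nn choose n) * (1 / 11) ^ n * of_int (W n))"
    by (rule sum.mono_neutral_right) (auto simp: binomial_eq_0)
  also have "\<dots> = (\<Sum>n\<le>nn. \<Sum>k\<le>nn. of_nat (tri k) * (of_nat (nn choose n) * of_nat (n choose (3 * k)) * ((1 / 11) ^ n * (- 3) ^ (n - 3 * k))))"
  proof (rule sum.cong)
    fix n assume n: "n \<in> {..nn}"
    have "of_int (W n) = (\<Sum>k\<le>n. of_nat (tri k) * of_nat (n choose (3 * k)) * (- 3 :: 'a) ^ (n - 3 * k))"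
      unfolding W_tri by simp
    also have "\<dots> = (\<Sum>k\<le>nn. of_nat (tri k) * of_nat (n choose (3 * k)) * (- 3 :: 'a) ^ (n - 3 * k))"
      by (rule sum.mono_neutral_left) (use n in \<open>auto simp: binomial_eq_0\<close>)
    finally show "of_nat (nn choose n) * (1 / 11) ^ n * of_int (W n) =
      (\<Sum>k\<le>nn. of_nat (tri k) * (of_nat (nn choose n) * of_nat (n choose (3 * k)) * ((1 / 11 :: 'a) ^ n * (- 3) ^ (n - 3 * k))))"
      by (simp only: sum_distrib_left mult_ac)
  qed simp
  also have "\<dots> = (\<Sum>k\<le>nn. of_nat (tri k) * (\<Sum>n\<le>nn. of_nat (nn choose n) * of_nat (n choose (3 * k)) * ((1 / 11) ^ n * (- 3) ^ (n - 3 * k))))"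
    by (subst sum.swap) (simp only: sum_distrib_left)
  also have "\<dots> = (\<Sum>k\<le>nn. of_nat (tri k) * (of_nat (nn choose (3 * k)) * ((1 / 11) ^ (3 * k) * (8 / 11) ^ (nn - 3 * k))))"
  proof (intro sum.cong refl arg_cong2[where f = "(*)"])
    fix k assume "k \<in> {..nn}"
    define j where "j = 3 * k"
    show "(\<Sum>n\<le>nn. of_nat (nn choose n) * of_nat (n choose (3 * k)) * ((1 / 11) ^ n * (- 3) ^ (n - 3 * k))) =
      of_nat (nn choose (3 * k)) * ((1 / 11) ^ (3 * k) * (8 / 11 :: 'a) ^ (nn - 3 * k))"
      unfolding j_def[symmetric]
    proof (cases "j \<le> nn")
      case False
      then show "(\<Sum>n\<le>nn. of_nat (nn choose n) * of_nat (n choose j) * ((1 / 11) ^ n * (- 3) ^ (n - j))) =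
        of_nat (nn choose j) * ((1 / 11) ^ j * (8 / 11 :: 'a) ^ (nn - j))"
        by (simp add: binomial_eq_0)
    next
      case True
      have "(\<Sum>n\<le>nn. of_nat (nn choose n) * of_nat (n choose j) * ((1 / 11) ^ n * (- 3) ^ (n - j))) =
        (\<Sum>n\<in>{j..nn}. of_nat (nn choose n) * of_nat (n choose j) * ((1 / 11 :: 'a) ^ n * (- 3) ^ (n - j)))"
        by (rule sum.mono_neutral_right) (auto simp: binomial_eq_0)
      also have "\<dots> = (\<Sum>i\<in>{0..nn - j}. of_nat (nn choose (i + j)) * of_nat ((i + j) choose j) * ((1 / 11) ^ (i + j) * (- 3) ^ i))"
        by (rule sum.reindex_bij_witness[of _ "\<lambda>i. i + j" "\<lambda>n. n - j"]) (use True in auto)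
      also have "\<dots> = (\<Sum>i\<le>nn - j. of_nat (nn choose j) * (1 / 11) ^ j * (of_nat ((nn - j) choose i) * (- 3 / 11) ^ i * 1 ^ (nn - j - i)))"
      proof (rule sum.cong)
        fix i assume i: "i \<in> {..nn - j}"
        have "(nn choose (i + j)) * ((i + j) choose j) = (nn choose j) * ((nn - j) choose i)"
          using choose_mult[of j "i + j" nn] i True by simp
        then have c: "of_nat (nn choose (i + j)) * of_nat ((i + j) choose j) = (of_nat (nn choose j) * of_nat ((nn - j) choose i) :: 'a)"
          by (metis of_nat_mult)
        have "(1 / 11) ^ (i + j) * (- 3) ^ i = (1 / 11) ^ j * (- 3 / 11 :: 'a) ^ i"
        proof -
          have "(- 3 / 11 :: 'a) = (1 / 11) * (- 3)" by simp
          then show ?thesis by (simp only: power_add power_mult_distrib mult_ac)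
        qed
        then show "of_nat (nn choose (i + j)) * of_nat ((i + j) choose j) * ((1 / 11) ^ (i + j) * (- 3) ^ i) =
          of_nat (nn choose j) * (1 / 11 :: 'a) ^ j * (of_nat ((nn - j) choose i) * (- 3 / 11) ^ i * 1 ^ (nn - j - i))"
          unfolding c by (simp add: mult_ac)
      qed auto
      also have "\<dots> = of_nat (nn choose j) * (1 / 11) ^ j * (- 3 / 11 + 1) ^ (nn - j)"
        unfolding binomial_ring by (simp only: sum_distrib_left)
      also have "- 3 / 11 + 1 = (8 / 11 :: 'a)" using nz11 by (simp add: field_simps)
      finally show "(\<Sum>n\<le>nn. of_nat (nn choose n) * of_nat (n choose j) * ((1 / 11) ^ n * (- 3) ^ (n - j))) =
        of_nat (nn choose j) * ((1 / 11) ^ j * (8 / 11 :: 'a) ^ (nn - j))" by (simp only: mult_ac)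
    qed
  qed
  also have "\<dots> = (\<Sum>k\<le>nn. 88 ^ nn * (tt k * (27 / 512) ^ k))"
  proof (rule sum.cong)
    fix k
    \<comment> \<open>The inner sums leave \<open>8 ^ nn / 11 ^ nn\<close>; by Fermat this is
      \<open>88 ^ nn\<close>, the factor in \<open>hasse_square\<close>.\<close>
    have e11: "(1 / 11 :: 'a) ^ nn = 11 ^ nn"
    proof -
      have "(11::'a) \<in> Fp" using of_int_Fp[of 11] by simp
      then have "(11::'a) ^ (p - 1) = 1" using nz11 by (rule Fp_power_pred)
      then have "(11 ^ nn)^2 = (1::'a)" unfolding power_p_pred .
      then have "11 ^ nn * 11 ^ nn = (1::'a)" by (simp only: power2_eq_square)
      then show ?thesis using nz11 by (simp add: power_one_over divide_simps)
    qed
    show "of_nat (tri k) * (of_nat (nn choose (3 * k)) * ((1 / 11) ^ (3 * k) * (8 / 11) ^ (nn - 3 * k))) =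
      88 ^ nn * (tt k * (27 / 512 :: 'a) ^ k)"
    proof (cases "3 * k \<le> nn")
      case False
      then show ?thesis by (simp add: tt_def binomial_eq_0)
    next
      case True
      have n512: "(512::'a) \<noteq> 0"
      proof -
        have "(512::'a) = 8 * 8 * 8" by simp
        then show ?thesis using n8 by (metis mult_eq_0_iff)
      qed
      have "(1 / 11) ^ (3 * k) * (8 / 11) ^ (nn - 3 * k) = (1 / 11) ^ nn * (8 :: 'a) ^ (nn - 3 * k)"
      proof -
        have "(8 / 11 :: 'a) ^ (nn - 3 * k) = 8 ^ (nn - 3 * k) * (1 / 11) ^ (nn - 3 * k)"
          by (simp flip: power_mult_distrib)
        moreover have "(1 / 11 :: 'a) ^ (3 * k) * (1 / 11) ^ (nn - 3 * k) = (1 / 11) ^ nn"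
          using True by (simp flip: power_add)
        ultimately show ?thesis by (simp add: mult_ac)
      qed
      also have "\<dots> = 88 ^ nn / 512 ^ k"
      proof -
        have "(8::'a) ^ nn = 8 ^ (nn - 3 * k) * 8 ^ (3 * k)" using True by (simp flip: power_add)
        also have "(8::'a) ^ (3 * k) = 512 ^ k" by (simp add: power_mult)
        finally have "(8::'a) ^ (nn - 3 * k) = 8 ^ nn / 512 ^ k" using n512 by simp
        moreover have "(88::'a) ^ nn = 11 ^ nn * 8 ^ nn" by (simp flip: power_mult_distrib)
        ultimately show ?thesis unfolding e11 by simp
      qed
      finally have "(1 / 11) ^ (3 * k) * (8 / 11) ^ (nn - 3 * k) = (88 :: 'a) ^ nn / 512 ^ k" .
      then show ?thesis using nz27 n512 by (simp add: tt_def power_divide)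
    qed
  qed simp
  finally show ?thesis unfolding hasse_square by (simp only: sum_distrib_left)
qed

end

section \<open>Primes and the form of discriminant \<open>-11\<close>\<close>

text \<open>Class number one: the form with coefficients \<open>n, b, c\<close> arises from
  \<open>x^2 + x y + 3 y^2\<close> by the substitution with columns \<open>(m, k)\<close> and
  \<open>(m', k')\<close>. Carrying \<open>b\<close> and \<open>c\<close> along lets the induction
  exchange \<open>n\<close> with a smaller \<open>c\<close>.\<close>

lemma form_disc_11:
  fixes n b c :: int
  assumes "0 < n" "b^2 - 4 * n * c = - 11"
  shows "\<exists>m k m' k'. n = m^2 + m * k + 3 * k^2 \<and> c = m'^2 + m' * k' + 3 * k'^2 \<and>
    b = 2 * m * m' + m * k' + m' * k + 6 * k * k'"
  using assms
proof (induction "nat n" arbitrary: n b c rule: less_induct)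
  case less
  \<comment> \<open>Invariance under the translation by \<open>j\<close> of the first variable; the
    second column is corrected by \<open>j\<close> times the first.\<close>
  have shift: ?case if "\<exists>m k m' k'. n = m^2 + m * k + 3 * k^2 \<and> c + b * j + n * j^2 = m'^2 + m' * k' + 3 * k'^2 \<and>
    b + 2 * n * j = 2 * m * m' + m * k' + m' * k + 6 * k * k'" for j
  proof -
    from that obtain m k m' k' where h: "n = m^2 + m * k + 3 * k^2"
      "c + b * j + n * j^2 = m'^2 + m' * k' + 3 * k'^2"
      "b + 2 * n * j = 2 * m * m' + m * k' + m' * k + 6 * k * k'" by blast
    have b: "b = 2 * m * (m' - j * m) + m * (k' - j * k) + (m' - j * m) * k + 6 * k * (k' - j * k)"
      using h(3) unfolding h(1) by (simp add: algebra_simps power2_eq_square)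
    have "c = m'^2 + m' * k' + 3 * k'^2 - b * j - n * j^2" using h(2) by simp
    then have c: "c = (m' - j * m)^2 + (m' - j * m) * (k' - j * k) + 3 * (k' - j * k)^2"
      unfolding h(1) by (subst (asm) b) (simp add: algebra_simps power2_eq_square)
    show ?case using h(1) b c by blast
  qed
  have odd: "odd b"
  proof
    assume "even b"
    then obtain b' where "b = 2 * b'" by (rule evenE)
    then have "4 * (b'^2 - n * c) = - 11" using less.prems by (simp add: power2_eq_square algebra_simps)
    then show False by presburger
  qed
  show ?case
  proof (cases "n = 1")
    case True
    define j where "j = (1 - b) div 2"
    have bj: "b + 2 * j = 1" using odd by (auto simp: j_def elim!: oddE)
    have "4 * (c + b * j + j^2) = (b + 2 * j)^2 - (b^2 - 4 * n * c)"
      unfolding True by (simp add: power2_eq_square algebra_simps)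
    then have "c + b * j + j^2 = 3" unfolding bj less.prems(2) by simp
    then show ?thesis using bj True
      by (intro shift[of j] exI[of _ 1] exI[of _ 0] exI[of _ 0] exI[of _ 1]) simp
  next
    case False
    then have n2: "2 \<le> n" using less.prems by linarith
    \<comment> \<open>Brings the middle coefficient into the range from \<open>- n\<close> to
      \<open>n\<close>. Then \<open>4 * n * c' = b'^2 + 11\<close> is at most
      \<open>n^2 + 11\<close>, which is below \<open>4 * n^2\<close> for \<open>n\<close> at least
      2, so \<open>c' < n\<close>.\<close>
    define j where "j = - ((b + n) div (2 * n))"
    define b' where "b' = b + 2 * n * j"
    define c' where "c' = c + b * j + n * j^2"
    have "b' = (b + n) mod (2 * n) - n"
      unfolding b'_def j_def by (simp add: minus_mult_div_eq_mod[symmetric])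
    moreover have "0 \<le> (b + n) mod (2 * n)" "(b + n) mod (2 * n) < 2 * n" using n2 by simp_all
    ultimately have "\<bar>b'\<bar> \<le> n" by linarith
    then have b2: "b'^2 \<le> n^2" using n2 by (metis abs_le_square_iff abs_of_nonneg less.prems(1) less_imp_le)
    have disc: "b'^2 - 4 * n * c' = - 11"
      using less.prems(2) unfolding b'_def c'_def by (simp add: power2_eq_square algebra_simps)
    have n12: "12 \<le> 3 * n^2"
      using mult_mono[OF n2 n2] n2 by (simp add: power2_eq_square)
    have e: "4 * n * c' = b'^2 + 11" using disc by simp
    have cp: "0 < c'"
    proof (rule ccontr)
      assume "\<not> 0 < c'"
      then have "4 * n * c' \<le> 0" using n2 by (intro mult_nonneg_nonpos) auto
      then show False using e zero_le_power2[of b'] by linarith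
    qed
    have cn: "c' < n"
    proof (rule ccontr)
      assume "\<not> c' < n"
      then have "4 * n * n \<le> 4 * n * c'" using n2 by (intro mult_left_mono) auto
      then have "4 * n^2 \<le> b'^2 + 11" using e by (simp add: power2_eq_square)
      then show False using b2 n12 by linarith
    qed
    have "\<exists>m k m' k'. c' = m^2 + m * k + 3 * k^2 \<and> n = m'^2 + m' * k' + 3 * k'^2 \<and>
        - b' = 2 * m * m' + m * k' + m' * k + 6 * k * k'"
      by (rule less.hyps) (use cp cn disc in \<open>auto simp: algebra_simps\<close>)
    then obtain m k m' k' where h: "c' = m^2 + m * k + 3 * k^2" "n = m'^2 + m' * k' + 3 * k'^2"
        "- b' = 2 * m * m' + m * k' + m' * k + 6 * k * k'" by blast
    have "b' = 2 * m' * (- m) + m' * (- k) + (- m) * k' + 6 * k' * (- k)"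
      using h(3) by (simp add: algebra_simps)
    moreover have "c' = (- m)^2 + (- m) * (- k) + 3 * (- k)^2" using h(1) by simp
    ultimately show ?thesis using h(2) unfolding b'_def c'_def by (intro shift[of j]) blast
  qed
qed

section \<open>Rational congruences and the field of characteristic \<open>p\<close>\<close>

lemma p_integral_quotient:
  assumes "\<not> int p dvd d"
  shows "of_int t / of_int d \<in> p_integral p"
proof -
  define r where "r = (of_int t / of_int d :: rat)"
  obtain u v where uv: "quotient_of r = (u, v)" by (cases "quotient_of r")
  have v: "0 < v" "coprime u v" "r = of_int u / of_int v"
    using uv quotient_of_denom_pos quotient_of_coprime quotient_of_div by blast+
  have d0: "d \<noteq> 0" using assms by auto
  have "(of_int (u * d) :: rat) = of_int (t * v)"
    using v d0 unfolding r_def by (simp add: field_simps)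
  then have "u * d = t * v" by (simp only: of_int_eq_iff)
  then have "v dvd u * d" by simp
  then have "v dvd d" using v(2) by (simp add: coprime_commute coprime_dvd_mult_right_iff)
  then have "\<not> int p dvd v" using assms dvd_trans by blast
  then show ?thesis using uv by (simp add: p_integral_def r_def)
qed

lemma rat_congI:
  assumes "\<not> int p dvd d" "int p dvd t - z * d"
  shows "rat_cong p (of_int t / of_int d) (of_int z)"
proof -
  obtain k where k: "t - z * d = int p * k" using assms(2) by (rule dvdE)
  have d0: "d \<noteq> 0" using assms(1) by auto
  have "of_int t / of_int d - of_int z = (of_int (t - z * d) / of_int d :: rat)"
    using d0 by (simp add: diff_divide_distrib)
  also have "\<dots> = of_nat p * (of_int k / of_int d)" unfolding k by simp
  finally have "of_int t / of_int d - of_int z = of_nat p * (of_int k / of_int d :: rat)" .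
  moreover have "of_int z \<in> p_integral p" if "p \<noteq> 1"
    using p_integral_quotient[of p 1 z] that by simp
  moreover have "p \<noteq> 1" using assms(1) by auto
  ultimately show ?thesis unfolding rat_cong_def
    using p_integral_quotient[OF assms(1)] by blast
qed

definition W_sum :: "nat \<Rightarrow> rat" where
  "W_sum p = (\<Sum>k = 0..p - 1. of_nat ((2 * k) choose k) * (of_int (W k) / (- 44) ^ k))"

definition W_num :: "nat \<Rightarrow> int" where
  "W_num p = (\<Sum>k = 0..p - 1. int ((2 * k) choose k) * W k * (- 44) ^ (p - 1 - k))"

text \<open>The integer numerator over the common denominator is the same over the rationals and in
  characteristic \<open>p\<close>; this transfers a value in the field to a congruence.\<close>

lemma W_sum_field:
  assumes "(44::'b::field) \<noteq> 0"
  shows "(\<Sum>k = 0..p - 1. of_nat ((2 * k) choose k) * (of_int (W k) / (- 44) ^ k)) =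
    (of_int (W_num p) / of_int ((- 44) ^ (p - 1)) :: 'b)"
proof -
  have "of_nat ((2 * k) choose k) * (of_int (W k) / (- 44) ^ k) =
      (of_int (int ((2 * k) choose k) * W k * (- 44) ^ (p - 1 - k)) / of_int ((- 44) ^ (p - 1)) :: 'b)"
    if "k \<in> {0..p - 1}" for k
  proof -
    have "(- 44 :: 'b) ^ (p - 1) = (- 44) ^ k * (- 44) ^ (p - 1 - k)"
    proof -
      have "k \<le> p - 1" using that by simp
      then have "k + (p - 1 - k) = p - 1" by (rule le_add_diff_inverse)
      then show ?thesis by (metis power_add)
    qed
    then show ?thesis using assms by simp
  qed
  then show ?thesis by (simp add: W_num_def sum_divide_distrib)
qed

lemma W_sum_eq: "W_sum p = of_int (W_num p) / of_int ((- 44) ^ (p - 1))"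
  unfolding W_sum_def by (rule W_sum_field) simp

context cm_field
begin

lemma W_sum_cong:
  assumes "hasse^2 = of_int z"
  shows "rat_cong p (W_sum p) (of_int z)"
proof -
  have "(44::'a) = 2 * 2 * 11" by simp
  then have n44: "(44::'a) \<noteq> 0" using nz2 nz11 by (metis mult_eq_0_iff)
  have dvd: "of_int t = (0::'a) \<longleftrightarrow> int p dvd t" for t
    using of_int_eq_0_iff_char_dvd[of t, where 'a='a] by (simp add: char)
  have D: "of_int ((- 44) ^ (p - 1)) \<noteq> (0::'a)" using n44 by simp
  have "of_int z = (of_int (W_num p) / of_int ((- 44) ^ (p - 1)) :: 'a)"
    using sum_eq_hasse_square assms unfolding W_sum_field[OF n44] by simp
  then have "of_int z * of_int ((- 44) ^ (p - 1)) = (of_int (W_num p) :: 'a)"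
    by (simp only: nonzero_eq_divide_eq[OF D])
  then have "of_int (W_num p - z * (- 44) ^ (p - 1)) = (0::'a)"
    by (simp only: of_int_diff of_int_mult diff_self)
  then have "int p dvd W_num p - z * (- 44) ^ (p - 1)" by (simp only: dvd)
  moreover have "\<not> int p dvd (- 44) ^ (p - 1)" using D by (simp only: dvd not_False_eq_True)
  ultimately show ?thesis unfolding W_sum_eq by (intro rat_congI)
qed

lemma in_Fp_iff: "z \<in> Fp \<longleftrightarrow> z ^ p = z"
proof
  assume "z ^ p = z"
  then have "poly frob z = 0" by (simp add: poly_frob)
  then show "z \<in> Fp" unfolding frob_prod by (auto simp: poly_prod)
qed (rule Fp_power)

text \<open>The reciprocity sign is \<open>(- 1) ^ nn\<close>, because
  \<open>(11 - 1) div 2 = 5\<close> is odd; with Euler's criterion for 11 it combines to the power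
  of -11.\<close>

lemma legendre_power: "of_int (Legendre (int p) 11) = (- 11 :: 'a) ^ nn"
proof -
  have p11': "prime (11::nat)" by simp
  have "Legendre (int p) (int 11) * Legendre (int 11) (int p) = (- 1) ^ ((p - 1) div 2 * ((11 - 1) div 2))"
    by (rule Quadratic_Reciprocity) (use prime p11' p_gt_3 p11 in auto)
  also have "\<dots> = ((- 1) ^ nn) ^ 5" by (simp add: nn_def flip: power_mult)
  also have "((- 1) ^ nn) ^ 5 = (- 1 :: int) ^ nn" by (cases "even nn") simp_all
  finally have q: "Legendre (int p) 11 * Legendre 11 (int p) = (- 1) ^ nn" by simp
  have "[Legendre 11 (int p) = 11 ^ ((p - 1) div 2)] (mod int p)"
    by (rule euler_criterion) (use prime p_gt_3 in auto)
  then have e: "of_int (Legendre 11 (int p)) = (11 :: 'a) ^ nn"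
    using of_int_eq_iff_cong_CHAR[of "Legendre 11 (int p)" "11 ^ nn", where 'a='a]
    by (simp add: char nn_def)
  have "(11 ^ nn)^2 = (1::'a)"
    using Fp_power_pred[OF of_int_Fp[of 11]] nz11 unfolding power_p_pred by simp
  then have "of_int (Legendre (int p) 11) = of_int (Legendre (int p) 11) * (11 :: 'a) ^ nn * 11 ^ nn"
    by (simp add: power2_eq_square mult.assoc)
  also have "\<dots> = of_int (Legendre (int p) 11 * Legendre 11 (int p)) * 11 ^ nn" by (simp add: e)
  also have "\<dots> = (- 11) ^ nn" unfolding q by (simp flip: power_mult_distrib)
  finally show ?thesis .
qed

lemma legendre_cong_minus:
  assumes L: "Legendre (int p) 11 = - 1"
  shows "rat_cong p (W_sum p) 0"
proof -
  obtain r where r: "r^2 = (- 11 :: 'a)" using nth_root_exists[of 2] by auto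
  define w where "w = (1 + r) / 2"
  have "2 * w = 1 + r" using nz2 by (simp add: w_def)
  then have rw: "r = 2 * w - 1" by simp
  have "4 * (w^2 - (w - 3)) = r^2 + 11" unfolding rw by Groebner_Basis.algebra
  also have "\<dots> = 0" unfolding r by simp
  finally have "4 * (w^2 - (w - 3)) = 0" .
  moreover have "(4::'a) = 2 * 2" by simp
  ultimately have "w^2 - (w - 3) = 0" using nz2 by (metis mult_eq_0_iff)
  then have w: "w^2 = w - 3" by (simp only: right_minus_eq)
  have rp: "r ^ p = - r" using legendre_power L unfolding power_p
    by (simp add: r flip: power_mult mult.commute[of nn])
      (metis mult.commute mult_minus1_right power_mult r)
  have "w ^ p \<noteq> w"
  proof
    assume "w ^ p = w"
    then have "w \<in> Fp" by (simp add: in_Fp_iff)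
    then obtain k where "w = of_nat k" by (auto simp: Fp_def)
    then have "r = of_int (2 * int k - 1)" by (simp add: rw)
    then have "r \<in> Fp" by (simp only: of_int_Fp)
    then have "r = - r" using rp by (simp add: in_Fp_iff)
    then have "2 * r = 0" by (metis add.right_inverse mult_2)
    then have "r = 0" using nz2 by (metis mult_eq_0_iff)
    then show False using r nz11 by simp
  qed
  then have "hasse^2 = of_int 0" using hasse_supersingular[OF w] by simp
  from W_sum_cong[OF this] show ?thesis by simp
qed

lemma legendre_representation:
  assumes L: "Legendre (int p) 11 = 1"
  shows "\<exists>x y :: int. 4 * int p = x\<^sup>2 + 11 * y\<^sup>2"
proof -
  obtain r where r: "r^2 = (- 11 :: 'a)" using nth_root_exists[of 2] by auto
  have "r ^ p = r * (r^2) ^ nn" unfolding power_p by (simp add: power_mult[symmetric] mult.commute)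
  then have "r \<in> Fp" using legendre_power L by (simp add: r in_Fp_iff)
  then obtain k where k: "r = of_nat k" by (auto simp: Fp_def)
  have "of_int (int k^2 + 11) = (0::'a)" using r k by simp
  then have d: "int p dvd int k^2 + 11"
    using of_int_eq_0_iff_char_dvd[of "int k^2 + 11", where 'a='a] by (simp add: char)
  \<comment> \<open>Adding the odd \<open>p\<close> makes \<open>b\<close> odd without changing it
    modulo \<open>p\<close>, so \<open>b^2 + 11\<close> is divisible by \<open>4 * p\<close> and has
    discriminant -11 as a form.\<close>
  define b where "b = (if odd k then int k else int k + int p)"
  have "odd p" using p_odd by presburger
  then have "odd b" by (auto simp: b_def)
  then obtain b' where b': "b = 2 * b' + 1" by (rule oddE)
  have "b^2 + 11 = int k^2 + 11 + int p * (if odd k then 0 else 2 * int k + int p)"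
    by (simp add: b_def power2_eq_square algebra_simps)
  then have "int p dvd b^2 + 11" by (simp only: dvd_add[OF d dvd_triv_left])
  moreover have e: "b^2 + 11 = 4 * (b'^2 + b' + 3)" unfolding b' by (simp add: power2_eq_square algebra_simps)
  moreover have "coprime (int p) 4"
  proof -
    have "coprime (int p) (2^2)" using \<open>odd p\<close> by (simp only: coprime_power_right_iff) simp
    then show ?thesis by simp
  qed
  ultimately have "int p dvd b'^2 + b' + 3" by (metis coprime_dvd_mult_right_iff)
  then obtain c where "b'^2 + b' + 3 = int p * c" by (rule dvdE)
  then have "b^2 - 4 * int p * c = - 11" using e by simp
  moreover have "0 < int p" using p_gt_3 by simp
  ultimately obtain m n where "int p = m^2 + m * n + 3 * n^2" using form_disc_11[of "int p" b c] by blast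
  then have "4 * int p = (2 * m + n)^2 + 11 * n^2" by (simp add: power2_eq_square algebra_simps)
  then show ?thesis by blast
qed

lemma representation_cong:
  fixes x y :: int
  assumes xy: "4 * int p = x\<^sup>2 + 11 * y\<^sup>2"
  shows "rat_cong p (W_sum p) (of_int (x\<^sup>2 - 2 * int p))"
proof -
  have "even (x^2 + 11 * y^2)" unfolding xy[symmetric] by simp
  then have "even (x - y)" by simp
  then obtain m where m: "x - y = 2 * m" by (rule evenE)
  then have x: "x = 2 * m + y" by simp
  have "4 * int p = 4 * (m^2 + m * y + 3 * y^2)"
    unfolding xy x by (simp add: power2_eq_square algebra_simps)
  then have norm: "m^2 + m * y + 3 * y^2 = int p" by simp
  \<comment> \<open>The prime excluded in \<open>frobenius_twist_trivial\<close> has no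
    representation: 28 minus 11 times a square is never a square.\<close>
  have p7: "p \<noteq> 7"
  proof
    assume "p = 7"
    then have s: "x^2 + 11 * y^2 = 28" using xy by simp
    have "\<bar>y\<bar> < 2"
    proof (rule ccontr)
      assume "\<not> \<bar>y\<bar> < 2"
      then have "2^2 \<le> \<bar>y\<bar>^2" by (intro power_mono) auto
      then show False using s zero_le_power2[of x] by simp
    qed
    then have "y \<in> {-1, 0, 1}" by auto
    moreover have "\<bar>x\<bar> < 6"
    proof (rule ccontr)
      assume "\<not> \<bar>x\<bar> < 6"
      then have "6^2 \<le> \<bar>x\<bar>^2" by (intro power_mono) auto
      then show False using s zero_le_power2[of y] by simp
    qed
    then have "- 6 < x \<and> x < 6" by linarith
    then have "x = - 5 \<or> x = - 4 \<or> x = - 3 \<or> x = - 2 \<or> x = - 1 \<or> x = 0 \<or> x = 1 \<or> x = 2 \<or> x = 3 \<or> x = 4 \<or> x = 5"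
      by presburger
    ultimately show False using s by auto
  qed
  have p0: "of_nat p = (0::'a)" using of_nat_0_iff by simp
  have "hasse^2 = of_int (x^2 - 2 * int p)"
    using hasse_ordinary[OF p7 norm] unfolding x by (simp add: p0)
  then show ?thesis by (rule W_sum_cong)
qed

end

section \<open>Assembly over all primes\<close>

definition W_claim :: "nat \<Rightarrow> bool" where
  "W_claim p \<longleftrightarrow> (Legendre (int p) 11 = 1 \<longrightarrow>
      (\<exists>x y :: int. 4 * int p = x\<^sup>2 + 11 * y\<^sup>2) \<and>
      (\<forall>x y :: int. 4 * int p = x\<^sup>2 + 11 * y\<^sup>2 \<longrightarrow> rat_cong p (W_sum p) (of_int (x\<^sup>2 - 2 * int p)))) \<and>
    (Legendre (int p) 11 = - 1 \<longrightarrow> rat_cong p (W_sum p) 0)"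

lemma (in cm_field) W_claim: "W_claim p"
  unfolding W_claim_def
  using legendre_representation representation_cong legendre_cong_minus by blast

text \<open>A field of characteristic \<open>p\<close> is a type, and types cannot depend on the variable \<open>p\<close>. We
  therefore fix the prime to be a hypothetical counterexample and refute it.\<close>

definition bad_prime :: "nat \<Rightarrow> bool" where
  "bad_prime p \<longleftrightarrow> prime p \<and> p \<noteq> 2 \<and> p \<noteq> 3 \<and> p \<noteq> 11 \<and> \<not> W_claim p"

text \<open>The default 5 satisfies the side conditions, so the type below has an admissible prime
  cardinality even when no counterexample exists.\<close>

definition the_prime :: nat where
  "the_prime = (if \<exists>p. bad_prime p then SOME p. bad_prime p else 5)"

lemma the_prime: "prime the_prime" "the_prime \<noteq> 2" "the_prime \<noteq> 3" "the_prime \<noteq> 11"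
proof -
  have "prime the_prime \<and> the_prime \<noteq> 2 \<and> the_prime \<noteq> 3 \<and> the_prime \<noteq> 11"
  proof (cases "\<exists>p. bad_prime p")
    case True
    then have "bad_prime the_prime" using someI_ex[of bad_prime] by (simp add: the_prime_def)
    then show ?thesis by (simp add: bad_prime_def)
  next
    case False
    then have e: "the_prime = 5" by (simp add: the_prime_def)
    show ?thesis unfolding e by simp
  qed
  then show "prime the_prime" "the_prime \<noteq> 2" "the_prime \<noteq> 3" "the_prime \<noteq> 11" by blast+
qed

typedef residue_index = "{..<the_prime}"
  using the_prime(1) prime_gt_0_nat by blast

lemma CARD_residue_index: "CARD(residue_index) = the_prime"
  using type_definition.card[OF type_definition_residue_index] by simp

instance residue_index :: prime_card
  by standard (simp add: CARD_residue_index the_prime)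

lemma cm_field_the_prime: "cm_field TYPE(residue_index mod_ring alg_closure) the_prime"
  by unfold_locales (simp_all add: CARD_residue_index the_prime)

lemma W_claim_all:
  assumes "prime p" "p \<noteq> 2" "p \<noteq> 3" "p \<noteq> 11"
  shows "W_claim p"
proof (rule ccontr)
  assume "\<not> W_claim p"
  then have "\<exists>p. bad_prime p" using assms by (auto simp: bad_prime_def)
  then have "bad_prime the_prime" using someI_ex[of bad_prime] by (simp add: the_prime_def)
  then show False using cm_field.W_claim[OF cm_field_the_prime] by (simp add: bad_prime_def)
qed

text \<open>In \<open>12 = x^2 + 11 y^2\<close> the only possibility is \<open>x^2 = 1\<close>, so
  the claim is the congruence of \<open>2254 / 1936\<close> with -5 modulo 3.\<close>

lemma W_claim_3: "W_claim 3"
proof -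
  have W: "W 0 = 1" "W 1 = - 3" "W 2 = 9" by (simp_all add: W_def)
  have s: "{0..3 - 1 :: nat} = {0, 1, 2}" by auto
  have "W_num 3 = 2254" unfolding W_num_def s by (simp add: W W(2)[simplified] choose_two)
  then have S: "W_sum 3 = of_int 2254 / of_int 1936" by (simp add: W_sum_eq)
  have x: "x^2 = 1" if "4 * int 3 = x\<^sup>2 + 11 * y\<^sup>2" for x y :: int
  proof -
    have "\<bar>y\<bar> < 2"
    proof (rule ccontr)
      assume "\<not> \<bar>y\<bar> < 2"
      then have "2^2 \<le> \<bar>y\<bar>^2" by (intro power_mono) auto
      then show False using that zero_le_power2[of x] by simp
    qed
    then have y: "y \<in> {-1, 0, 1}" by auto
    have "\<bar>x\<bar> < 4"
    proof (rule ccontr)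
      assume "\<not> \<bar>x\<bar> < 4"
      then have "4^2 \<le> \<bar>x\<bar>^2" by (intro power_mono) auto
      then show False using that zero_le_power2[of y] by simp
    qed
    then have "- 4 < x \<and> x < 4" by linarith
    then have "x = - 3 \<or> x = - 2 \<or> x = - 1 \<or> x = 0 \<or> x = 1 \<or> x = 2 \<or> x = 3" by presburger
    then show ?thesis using y that by auto
  qed
  have "rat_cong 3 (W_sum 3) (of_int (x\<^sup>2 - 2 * int 3))" if "4 * int 3 = x\<^sup>2 + 11 * y\<^sup>2" for x y :: int
    unfolding S x[OF that] by (rule rat_congI) simp_all
  moreover have "\<exists>x y :: int. 4 * int 3 = x\<^sup>2 + 11 * y\<^sup>2"
    by (intro exI[of _ 1]) simp
  moreover have "Legendre (int 3) 11 \<noteq> - 1"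
  proof -
    have "QuadRes 11 3" unfolding QuadRes_def by (rule exI[of _ 5]) (simp add: cong_def)
    then show ?thesis by (simp add: Legendre_def)
  qed
  ultimately show ?thesis unfolding W_claim_def by blast
qed

theorem theorem2p6:
  fixes p :: nat
  assumes "prime p" and "p \<noteq> 2" and "p \<noteq> 11"
  defines "S \<equiv> (\<Sum>k = 0..p - 1. of_nat ((2 * k) choose k) * (of_int (W k) / (- 44) ^ k) :: rat)"
  shows "(Legendre (int p) 11 = 1 \<longrightarrow>
            (\<exists>x y :: int. 4 * int p = x\<^sup>2 + 11 * y\<^sup>2) \<and>
            (\<forall>x y :: int. 4 * int p = x\<^sup>2 + 11 * y\<^sup>2 \<longrightarrow>
               rat_cong p S (of_int (x\<^sup>2 - 2 * int p)))) \<and>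
         (Legendre (int p) 11 = - 1 \<longrightarrow> rat_cong p S 0)"
proof -
  have "W_claim p" using W_claim_all W_claim_3 assms by (cases "p = 3") auto
  then show ?thesis unfolding W_claim_def S_def W_sum_def .
qed

end
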